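(* Assume (A1) and (A2) hold (see context) and that $\mathbf\Sigma$ is invertible. Suppose that the overall sample size satisfies $N\ge18B_X^2\,p\,\|\mathbf\Sigma^{-1}\|\log(3pN^2)$. Then, for the tuning parameter $$\lambda=8B_XB_Y\Big(\frac{\log(6pN^2)}{n}\Big)^{1/2}\bigg[1+\frac{B_X}{3}\Big(\frac{\log(6pN^2)}{n}\Big)^{1/2}\bigg],$$ the semi-supervised lasso estimator $$\hat{\boldsymbol\beta}\in\operatorname*{arg\,min}_{\boldsymbol\beta\in\mathbb R^p}\Big\{\|\hat{\mathbf\Sigma}_{\rm all}^{1/2}\boldsymbol\beta\|_2^2-\frac2n\boldsymbol Y^\top\mathbf X_{\rm lab}\boldsymbol\beta+2\lambda\|\boldsymbol\beta\|_1\Big\}$$ satisfies $$\mathbb E[\mathcal E(f_{\hat{\boldsymbol\beta}})]\le\inf_{J\subseteq[p]}\inf_{\boldsymbol\beta\in\mathbb R^p}\Big\{\mathcal E(f_{\boldsymbol\beta})+4\lambda\|\boldsymbol\beta_{J^c}\|_1+\frac{27\|\mathbf\Sigma^{-1}\|}{4}\lambda^2|J|\Big\}+\frac{2B_Y^2}{N^2}+\frac{B_Y^2}{2^7\,n\log^2(6pN^2)}.$$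
   Context: Setting. $p\ge1$ and $1\le n<N$ are integers, $[k]=\{1,\dots,k\}$. $(\boldsymbol X,Y)$ is a random pair in $\mathbb R^p\times\mathbb R$ with distribution $P$; $P_X$ is the marginal distribution of $\boldsymbol X=(X^1,\dots,X^p)^\top$; $f^\star(\boldsymbol x)=\mathbb E[Y\mid\boldsymbol X=\boldsymbol x]$; $\mathbf\Sigma=\mathbb E[\boldsymbol X\boldsymbol X^\top]$. The labeled data $(\boldsymbol X_1,Y_1),\dots,(\boldsymbol X_n,Y_n)$ are i.i.d. with distribution $P$; the unlabeled data $\boldsymbol X_{n+1},\dots,\boldsymbol X_N$ are i.i.d. with distribution $P_X$ and independent of the labeled data. $\boldsymbol Y=(Y_1,\dots,Y_n)^\top$ and $\mathbf X_{\rm lab}\in\mathbb R^{n\times p}$ is the matrix with rows $\boldsymbol X_1^\top,\dots,\boldsymbol X_n^\top$. $\hat{\mathbf\Sigma}_{\rm all}=\frac1N\sum_{i=1}^N\boldsymbol X_i\boldsymbol X_i^\top$. $\|\mathbf A\|$ denotes the spectral norm of a matrix $\mathbf A$. Assumptions. (A1): $Y$ and $\boldsymbol X$ have zero mean and finite variance, and $\mathbb E[(X^j)^2]=1$ for all $j\in[p]$. (A2): there exist constants $B_Y,B_X$ such that $\mathbf P(|Y|\le B_Y;\ \max_{j\in[p]}|X^j|\le B_X)=1$. Linear predictors: $f_{\boldsymbol\beta}(\boldsymbol x)=\boldsymbol x^\top\boldsymbol\beta$. The excess risk is $\mathcal E(f)=\int(f(\boldsymbol x)-f^\star(\boldsymbol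 x))^2P_X(d\boldsymbol x)$; for a data-dependent $\hat{\boldsymbol\beta}$, $\mathcal E(f_{\hat{\boldsymbol\beta}})$ is the (random) value of $\boldsymbol\beta\mapsto\mathcal E(f_{\boldsymbol\beta})$ at $\hat{\boldsymbol\beta}$. The tuning parameter is positive: $\lambda>0$. For $J\subseteq[p]$ and $\boldsymbol v\in\mathbb R^p$, $\boldsymbol v_J\in\mathbb R^p$ has $j$-th coordinate $v_j$ if $j\in J$ and $0$ otherwise; $J^c=[p]\setminus J$. $\log^2(x)=(\log x)^2$. *)

theory Defs
  imports "HOL-Probability.Probability"
begin

subsection \<open>Vectors and matrices\<close>

definition l1_norm :: "real ^ 'p \<Rightarrow> real" where
  "l1_norm v = (\<Sum>j\<in>UNIV. \<bar>v $ j\<bar>)"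

definition restrict_vec :: "'p set \<Rightarrow> real ^ 'p \<Rightarrow> real ^ 'p" where
  "restrict_vec J v = (\<chi> j. if j \<in> J then v $ j else 0)"

definition spectral_norm :: "real ^ 'p ^ 'p \<Rightarrow> real" where
  "spectral_norm A = onorm (\<lambda>v. A *v v)"

definition positive_semidefinite :: "real ^ 'p ^ 'p \<Rightarrow> bool" where
  "positive_semidefinite A \<longleftrightarrow> transpose A = A \<and> (\<forall>v. 0 \<le> v \<bullet> (A *v v))"

(* A positive semidefinite matrix has exactly one positive semidefinite square root;
   psd_sqrt is only meaningful for such matrices. *)
definition psd_sqrt :: "real ^ 'p ^ 'p \<Rightarrow> real ^ 'p ^ 'p" where
  "psd_sqrt A = (THE B. positive_semidefinite B \<and> B ** B = A)"

subsection \<open>The population\<close>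

text \<open>The joint distribution of the pair (features, label) is a probability measure \<open>P\<close> on
  the Borel sets of \<open>(real ^ 'p) \<times> real\<close>; the dimension of the feature space is \<open>CARD('p)\<close>.\<close>

definition marginal :: "((real ^ 'p) \<times> real) measure \<Rightarrow> (real ^ 'p) measure" where
  "marginal P = distr P borel fst"

definition second_moment_matrix :: "((real ^ 'p) \<times> real) measure \<Rightarrow> real ^ 'p ^ 'p" where
  "second_moment_matrix P = (\<chi> j k. \<integral>z. fst z $ j * fst z $ k \<partial>P)"

definition centered_normalized :: "((real ^ 'p) \<times> real) measure \<Rightarrow> bool" where
  "centered_normalized P \<longleftrightarrow>
     integrable P snd \<and> integrable P (\<lambda>z. (snd z)\<^sup>2) \<and> (\<integral>z. snd z \<partial>P) = 0 \<and>
     (\<forall>j. integrable P (\<lambda>z. fst z $ j) \<and> integrable P (\<lambda>z. (fst z $ j)\<^sup>2) \<and>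
          (\<integral>z. fst z $ j \<partial>P) = 0 \<and> (\<integral>z. (fst z $ j)\<^sup>2 \<partial>P) = 1)"

definition almost_surely_bounded ::
  "((real ^ 'p) \<times> real) measure \<Rightarrow> real \<Rightarrow> real \<Rightarrow> bool" where
  "almost_surely_bounded P B_Y B_X \<longleftrightarrow>
     (AE z in P. \<bar>snd z\<bar> \<le> B_Y \<and> (MAX j. \<bar>fst z $ j\<bar>) \<le> B_X)"

text \<open>A version of the map sending \<open>x\<close> to the conditional expectation of the label given that the
  feature vector is \<open>x\<close>: a Borel function whose composition with the feature vector is a version
  of the conditional expectation of the label given the sigma-algebra generated by the features.\<close>

definition regression_function ::
  "((real ^ 'p) \<times> real) measure \<Rightarrow> (real ^ 'p \<Rightarrow> real) \<Rightarrow> bool" where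
  "regression_function P f \<longleftrightarrow>
     f \<in> borel_measurable borel \<and>
     (AE z in P. f (fst z) = real_cond_exp P (vimage_algebra (space P) fst borel) snd z)"

definition linear_predictor :: "real ^ 'p \<Rightarrow> real ^ 'p \<Rightarrow> real" where
  "linear_predictor b x = x \<bullet> b"

definition excess_risk ::
  "((real ^ 'p) \<times> real) measure \<Rightarrow> (real ^ 'p \<Rightarrow> real) \<Rightarrow> (real ^ 'p \<Rightarrow> real) \<Rightarrow> real" where
  "excess_risk P fstar f = (\<integral>x. (f x - fstar x)\<^sup>2 \<partial>marginal P)"

subsection \<open>The sample and the estimator\<close>

text \<open>Observations are indexed from 1: the pairs \<open>(X i, Y i)\<close> with \<open>i \<le> n\<close> are labeled, and only
  \<open>X i\<close> is observed for \<open>n < i \<le> N\<close>; the values \<open>Y i\<close> with \<open>i > n\<close> play no role.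
  All \<open>N\<close> observations are mutually independent; padding the unlabeled ones with the constant
  label 0 only serves to give all members of the independent family the same type.\<close>

definition semi_supervised_sample ::
  "'w measure \<Rightarrow> ((real ^ 'p) \<times> real) measure \<Rightarrow> nat \<Rightarrow> nat \<Rightarrow>
   (nat \<Rightarrow> 'w \<Rightarrow> real ^ 'p) \<Rightarrow> (nat \<Rightarrow> 'w \<Rightarrow> real) \<Rightarrow> bool" where
  "semi_supervised_sample M P n N X Y \<longleftrightarrow>
     prob_space.indep_vars M (\<lambda>_. borel)
       (\<lambda>i \<omega>. (X i \<omega>, if i \<le> n then Y i \<omega> else 0)) {1..N} \<and>
     (\<forall>i\<in>{1..n}. distr M borel (\<lambda>\<omega>. (X i \<omega>, Y i \<omega>)) = P) \<and>
     (\<forall>i\<in>{n+1..N}. distr M borel (X i) = marginal P)"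

definition empirical_second_moment :: "nat \<Rightarrow> (nat \<Rightarrow> real ^ 'p) \<Rightarrow> real ^ 'p ^ 'p" where
  "empirical_second_moment N x = (\<chi> j k. (\<Sum>i=1..N. x i $ j * x i $ k) / real N)"

text \<open>For a realized sample \<open>x\<close>, \<open>y\<close>. The sum over the labeled data is the product of the
  transposed label vector, the labeled design matrix (with rows \<open>x i\<close>) and the vector \<open>b\<close>.\<close>

definition ss_lasso_objective ::
  "nat \<Rightarrow> nat \<Rightarrow> (nat \<Rightarrow> real ^ 'p) \<Rightarrow> (nat \<Rightarrow> real) \<Rightarrow> real \<Rightarrow> real ^ 'p \<Rightarrow> real" where
  "ss_lasso_objective n N x y lam b =
     (norm (psd_sqrt (empirical_second_moment N x) *v b))\<^sup>2
     - 2 / real n * (\<Sum>i=1..n. y i * (x i \<bullet> b))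
     + 2 * lam * l1_norm b"

text \<open>The estimator is a random vector that takes its values in the set of minimizers; no
  particular choice of the minimizer is imposed.\<close>

definition ss_lasso_estimator ::
  "'w measure \<Rightarrow> nat \<Rightarrow> nat \<Rightarrow> (nat \<Rightarrow> 'w \<Rightarrow> real ^ 'p) \<Rightarrow> (nat \<Rightarrow> 'w \<Rightarrow> real) \<Rightarrow>
   real \<Rightarrow> ('w \<Rightarrow> real ^ 'p) \<Rightarrow> bool" where
  "ss_lasso_estimator M n N X Y lam bhat \<longleftrightarrow>
     bhat \<in> borel_measurable M \<and>
     (\<forall>\<omega>\<in>space M. is_arg_min
        (ss_lasso_objective n N (\<lambda>i. X i \<omega>) (\<lambda>i. Y i \<omega>) lam) (\<lambda>_. True) (bhat \<omega>))"

end

theory Submission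
  imports Defs
begin

text \<open>Write \<open>S\<close> for the population second moment matrix, \<open>Sh\<close> for the empirical one over all \<open>N\<close>
features, \<open>m\<close> and \<open>g\<close> for the population and labeled-sample cross moments of features and label,
and \<open>u\<close> for the difference between the estimator \<open>bh\<close> and a competitor \<open>b\<close>. Up to a constant
the risk of \<open>b\<close> is \<open>b \<bullet> S b - 2 (b \<bullet> m)\<close>, and the lasso minimizes the same expression with \<open>Sh\<close>
and \<open>g\<close> in place of \<open>S\<close> and \<open>m\<close>, plus the penalty. The first-order condition at the minimizer
therefore bounds the excess of the risk of \<open>bh\<close> over that of \<open>b\<close> by

\<open>2 (u \<bullet> z) + 2 lam (|b| - |bh|) + u \<bullet> S u - 2 (u \<bullet> Sh u)\<close>, \<open>z = g - m + (S - Sh) b\<close>,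

with \<open>l1\<close> norms. If \<open>u \<bullet> Sh u\<close> is at least \<open>2/3\<close> of \<open>u \<bullet> S u\<close> and all coordinates of \<open>z\<close> are at most
\<open>lam / 2\<close>, the quadratic terms leave \<open>- (u \<bullet> S u) / 3\<close>, which absorbs \<open>3 lam\<close> times the \<open>l1\<close> norm of
\<open>u\<close> on \<open>J\<close> at the price of \<open>27/4 |S^-1| lam^2 |J|\<close> (\<open>restricted_oracle_inequality\<close>).

The vector \<open>z\<close> is small for a fixed \<open>b\<close> with \<open>b \<bullet> S b \<le> B_Y^2\<close>: Hoeffding's inequality handles
\<open>g - m\<close>, and a Bernstein bound handles \<open>(S - Sh) b\<close>, since the size condition on \<open>N\<close> tames the large
but rare values of \<open>X \<bullet> b\<close>. The restriction on \<open>b\<close> costs nothing, because shrinking a longer \<open>b\<close>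
towards \<open>0\<close> decreases the right-hand side of the bound (\<open>shrink_to_bounded_form\<close>).

The comparison of \<open>Sh\<close> with \<open>S\<close> is a lower-tail matrix Chernoff bound. After whitening the features
to vectors \<open>V i\<close> one controls the expected trace of \<open>exp (- A)\<close>, where \<open>A\<close> is the sum of the
\<open>V i (V i)^T\<close>, one summand at a time (\<open>exp_trace_rank_one_update\<close>): the traces before and after
the update are compared in the eigenbases \<open>e\<close> and \<open>d\<close> of the two maps, with weights \<open>(e \<bullet> d)^2\<close>. Since the update has rank one,
the first and second moments of the eigenvalue gaps under these weights are explicit, and one
inequality between scalar functions suffices.

On the exceptional event, comparison with the zero vector gives a crude bound on the \<open>l1\<close> norm of
\<open>bh\<close>, hence a deterministic bound on its risk. The two deviation probabilities carry decay beyond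
the order \<open>1 / N^2\<close>, and this surplus pays for the additional logarithm in the last remainder term.\<close>

section \<open>Spectral theorem for self-adjoint maps\<close>

definition orthonormal_basis :: "'a::euclidean_space set \<Rightarrow> bool" where
  "orthonormal_basis E \<longleftrightarrow>
     finite E \<and> pairwise orthogonal E \<and> (\<forall>e\<in>E. norm e = 1) \<and> span E = UNIV"

lemma orthonormal_basis_sum:
  assumes "orthonormal_basis E"
  shows "(\<Sum>e\<in>E. (e \<bullet> x) *\<^sub>R e) = x"
  using assms orthonormal_basis_expand[of E x]
  unfolding orthonormal_basis_def by (simp add: inner_commute)

lemma orthonormal_basis_parseval:
  assumes "orthonormal_basis E"
  shows "(\<Sum>e\<in>E. (e \<bullet> x) * (e \<bullet> y)) = x \<bullet> y"
proof -
  have "x \<bullet> y = (\<Sum>e\<in>E. (e \<bullet> x) *\<^sub>R e) \<bullet> y"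
    by (simp only: orthonormal_basis_sum[OF assms])
  then show ?thesis by (simp add: inner_sum_left)
qed

lemma orthonormal_basis_nonempty:
  fixes E :: "'a::euclidean_space set"
  assumes "orthonormal_basis E"
  shows "E \<noteq> {}"
proof
  assume "E = {}"
  then have "(UNIV :: 'a set) = {0}" using assms by (simp add: orthonormal_basis_def)
  moreover obtain b :: 'a where "b \<in> Basis" using nonempty_Basis by blast
  ultimately show False using nonzero_Basis[of b] by blast
qed

definition self_adjoint :: "('a::euclidean_space \<Rightarrow> 'a) \<Rightarrow> bool" where
  "self_adjoint A \<longleftrightarrow> linear A \<and> (\<forall>x y. A x \<bullet> y = x \<bullet> A y)"

definition eigenbasis :: "('a::euclidean_space \<Rightarrow> 'a) \<Rightarrow> 'a set \<Rightarrow> bool" where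
  "eigenbasis A E \<longleftrightarrow> orthonormal_basis E \<and> (\<forall>e\<in>E. A e = (e \<bullet> A e) *\<^sub>R e)"

text \<open>The first-order condition behind the variational characterization of eigenvectors: a linear term
cannot be dominated by a quadratic one unless it vanishes.\<close>

lemma quadratic_le_imp_zero:
  fixes a b :: real
  assumes "\<And>t. 2 * t * a \<le> t\<^sup>2 * b"
  shows "a = 0"
proof (rule ccontr)
  assume "a \<noteq> 0"
  have "0 \<le> b" using assms[of 1] assms[of "-1"] by simp
  define c where "c = b + 1"
  have "0 < c" "b = c - 1" using \<open>0 \<le> b\<close> by (auto simp: c_def)
  have "c\<^sup>2 * (2 * (a / c) * a) \<le> c\<^sup>2 * ((a / c)\<^sup>2 * b)"
    by (intro mult_left_mono assms) simp
  then have "2 * a\<^sup>2 * c \<le> a\<^sup>2 * b"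
    using \<open>0 < c\<close> by (simp add: power2_eq_square mult_ac)
  then have "a\<^sup>2 * (b + 2) \<le> 0" by (simp add: c_def algebra_simps)
  moreover have "0 < a\<^sup>2 * (b + 2)" using \<open>a \<noteq> 0\<close> \<open>0 \<le> b\<close> by simp
  ultimately show False by simp
qed

text \<open>Induction on the dimension. A maximizer of the Rayleigh quotient on the unit sphere of \<open>S\<close> is an
eigenvector, by stationarity along every direction orthogonal to it, and its orthogonal complement
in \<open>S\<close> is again invariant.\<close>

lemma spectral_subspace:
  fixes A :: "'a::euclidean_space \<Rightarrow> 'a"
  assumes A: "self_adjoint A" and S: "subspace S" and inv: "A ` S \<subseteq> S"
  shows "\<exists>E\<subseteq>S. finite E \<and> pairwise orthogonal E \<and> (\<forall>e\<in>E. norm e = 1)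
           \<and> span E = S \<and> (\<forall>e\<in>E. A e = (e \<bullet> A e) *\<^sub>R e)"
  using S inv
proof (induction "dim S" arbitrary: S rule: less_induct)
  case less
  have lin: "linear A" and sym: "A x \<bullet> y = x \<bullet> A y" for x y
    using A by (auto simp: self_adjoint_def)
  show ?case
  proof (cases "S = {0}")
    case True
    then show ?thesis by (intro exI[of _ "{}"]) auto
  next
    case False
    then obtain x where x: "x \<in> S" "x \<noteq> 0"
      using subspace_0[OF less.prems(1)] by auto
    let ?K = "S \<inter> sphere 0 1"
    have "compact ?K"
      using closed_Int_compact[OF closed_subspace[OF less.prems(1)] compact_sphere] .
    moreover have "x /\<^sub>R norm x \<in> ?K"
      using x less.prems(1) by (auto simp: subspace_scale)
    then have "?K \<noteq> {}" by blast
    moreover have "continuous_on ?K (\<lambda>v. v \<bullet> A v)"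
      using lin by (intro continuous_intros linear_continuous_on) (simp add: linear_conv_bounded_linear)
    ultimately obtain v where v: "v \<in> ?K" and vmax: "\<And>w. w \<in> ?K \<Longrightarrow> w \<bullet> A w \<le> v \<bullet> A v"
      using continuous_attains_sup[of ?K "\<lambda>v. v \<bullet> A v"] by blast
    have vS: "v \<in> S" and nv: "norm v = 1" and vv: "v \<bullet> v = 1"
      using v by (auto simp: norm_eq_1)
    define m where "m = v \<bullet> A v"
    have rayleigh: "w \<bullet> A w \<le> m * (norm w)\<^sup>2" if "w \<in> S" for w
    proof (cases "w = 0")
      case True then show ?thesis by simp
    next
      case False
      have "w /\<^sub>R norm w \<in> ?K" using that False less.prems(1) by (auto simp: subspace_scale)
      from vmax[OF this] have "(w \<bullet> A w) / (norm w)\<^sup>2 \<le> m"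
        by (simp add: linear_cmul[OF lin] m_def power2_eq_square divide_inverse mult_ac)
      then show ?thesis using False by (simp add: field_simps)
    qed
    have orth: "w \<bullet> A v = 0" if w: "w \<in> S" "w \<bullet> v = 0" for w
    proof (rule quadratic_le_imp_zero)
      fix t :: real
      have "v + t *\<^sub>R w \<in> S" using w vS less.prems(1) by (simp add: subspace_add subspace_scale)
      from rayleigh[OF this]
      have "m + 2 * t * (w \<bullet> A v) + t\<^sup>2 * (w \<bullet> A w) \<le> m * (norm (v + t *\<^sub>R w))\<^sup>2"
        using sym[of v w]
        by (simp add: linear_add[OF lin] linear_cmul[OF lin] inner_add_left inner_add_right m_def
            power2_eq_square algebra_simps inner_commute)
      also have "(norm (v + t *\<^sub>R w))\<^sup>2 = 1 + t\<^sup>2 * (w \<bullet> w)"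
        unfolding power2_norm_eq_inner using w
        by (simp add: inner_add_left inner_add_right vv inner_commute power2_eq_square)
      finally show "2 * t * (w \<bullet> A v) \<le> t\<^sup>2 * (m * (w \<bullet> w) - w \<bullet> A w)"
        by (simp add: algebra_simps)
    qed
    have Av: "A v = m *\<^sub>R v"
    proof -
      let ?r = "A v - m *\<^sub>R v"
      have "A v \<in> S" using less.prems(2) vS by blast
      then have rS: "?r \<in> S" using vS less.prems(1) by (simp add: subspace_diff subspace_scale)
      have rv: "?r \<bullet> v = 0" by (simp add: inner_diff_left vv m_def) (simp add: inner_commute)
      have "?r \<bullet> ?r = ?r \<bullet> A v - m * (?r \<bullet> v)" by (simp only: inner_diff_right inner_scaleR_right)
      then have "?r \<bullet> ?r = 0" using orth[OF rS rv] rv by simp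
      then show ?thesis by simp
    qed
    define S' where "S' = {w \<in> S. w \<bullet> v = 0}"
    have S': "subspace S'"
      using less.prems(1) by (auto simp: S'_def subspace_def inner_add_left)
    have inv': "A ` S' \<subseteq> S'"
      using less.prems(2) by (auto simp: S'_def sym Av)
    have "v \<notin> S'" using vv by (simp add: S'_def)
    then have "S' \<subset> S" using vS unfolding S'_def by blast
    then have "span S' \<subset> span S"
      by (simp only: span_eq_iff[THEN iffD2, OF S'] span_eq_iff[THEN iffD2, OF less.prems(1)])
    then have "dim S' < dim S" by (rule dim_psubset)
    from less.hyps[OF this S' inv'] obtain E where E: "E \<subseteq> S'" "finite E" "pairwise orthogonal E"
      "\<forall>e\<in>E. norm e = 1" "span E = S'" "\<forall>e\<in>E. A e = (e \<bullet> A e) *\<^sub>R e" by blast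
    show ?thesis
    proof (intro exI[of _ "insert v E"] conjI)
      show "insert v E \<subseteq> S" using E(1) vS by (auto simp: S'_def)
      show "finite (insert v E)" using E by simp
      show "pairwise orthogonal (insert v E)"
        using E(1,3) by (auto simp: pairwise_insert orthogonal_def S'_def inner_commute)
      show "\<forall>e\<in>insert v E. norm e = 1" using E nv by auto
      show "\<forall>e\<in>insert v E. A e = (e \<bullet> A e) *\<^sub>R e" using E Av by (auto simp: m_def)
      show "span (insert v E) = S"
      proof
        show "span (insert v E) \<subseteq> S"
          using \<open>insert v E \<subseteq> S\<close> less.prems(1) by (simp add: span_minimal)
        show "S \<subseteq> span (insert v E)"
        proof
          fix x assume "x \<in> S"
          then have "x - (x \<bullet> v) *\<^sub>R v \<in> S'"
            using vS less.prems(1) by (simp add: S'_def subspace_diff subspace_scale inner_diff_left vv)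
          then show "x \<in> span (insert v E)" using E(5) by (auto simp: span_insert)
        qed
      qed
    qed
  qed
qed

theorem self_adjoint_eigenbasis:
  assumes "self_adjoint A"
  obtains E where "eigenbasis A E"
  using spectral_subspace[OF assms, of UNIV]
  unfolding eigenbasis_def orthonormal_basis_def by auto

section \<open>Matrix Chernoff bound by rank-one updates\<close>

text \<open>The bilinear form of \<open>exp (- A)\<close>. It is given by the power series rather than through an
eigenbasis because measurability in \<open>A\<close> is then immediate, whereas eigenbases are chosen arbitrarily.\<close>

definition exp_form :: "('a::euclidean_space \<Rightarrow> 'a) \<Rightarrow> 'a \<Rightarrow> 'a \<Rightarrow> real" where
  "exp_form A x y = (\<Sum>k. (- 1) ^ k / fact k * (x \<bullet> (A ^^ k) y))"

definition exp_trace :: "('a::euclidean_space \<Rightarrow> 'a) \<Rightarrow> real" where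
  "exp_trace A = (\<Sum>b\<in>Basis. exp_form A b b)"

lemma eigenbasis_funpow:
  assumes "linear A" "eigenbasis A E"
  shows "(A ^^ k) y = (\<Sum>e\<in>E. ((e \<bullet> A e) ^ k * (e \<bullet> y)) *\<^sub>R e)"
proof (induction k)
  case 0
  then show ?case using orthonormal_basis_sum[of E y] assms by (simp add: eigenbasis_def)
next
  case (Suc k)
  have "(A ^^ Suc k) y = A (\<Sum>e\<in>E. ((e \<bullet> A e) ^ k * (e \<bullet> y)) *\<^sub>R e)" by (simp add: Suc)
  also have "\<dots> = (\<Sum>e\<in>E. ((e \<bullet> A e) ^ k * (e \<bullet> y)) *\<^sub>R A e)"
    by (simp add: linear_sum[OF assms(1)] linear_cmul[OF assms(1)])
  also have "\<dots> = (\<Sum>e\<in>E. ((e \<bullet> A e) ^ k * (e \<bullet> y)) *\<^sub>R ((e \<bullet> A e) *\<^sub>R e))"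
    using assms(2) by (intro sum.cong) (auto simp: eigenbasis_def)
  finally show ?case by (simp add: mult_ac)
qed

lemma exp_form_eigenbasis:
  assumes "linear A" "eigenbasis A E"
  shows "exp_form A x y = (\<Sum>e\<in>E. exp (- (e \<bullet> A e)) * (e \<bullet> x) * (e \<bullet> y))"
proof -
  have "(\<lambda>k. \<Sum>e\<in>E. (- (e \<bullet> A e)) ^ k /\<^sub>R fact k * ((e \<bullet> x) * (e \<bullet> y)))
          sums (\<Sum>e\<in>E. exp (- (e \<bullet> A e)) * ((e \<bullet> x) * (e \<bullet> y)))"
    by (intro sums_sum sums_mult2 exp_converges)
  moreover have "(\<Sum>e\<in>E. (- (e \<bullet> A e)) ^ k /\<^sub>R fact k * ((e \<bullet> x) * (e \<bullet> y)))
      = (- 1) ^ k / fact k * (x \<bullet> (A ^^ k) y)" for k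
    unfolding eigenbasis_funpow[OF assms] inner_sum_right sum_distrib_left
    by (intro sum.cong refl) (simp add: power_minus[of "_ \<bullet> _"] inner_commute divide_inverse)
  ultimately show ?thesis by (simp add: exp_form_def sums_iff mult.assoc)
qed

lemma exp_trace_eigenbasis:
  assumes "linear A" "eigenbasis A E"
  shows "exp_trace A = (\<Sum>e\<in>E. exp (- (e \<bullet> A e)))"
proof -
  have "exp_trace A = (\<Sum>e\<in>E. \<Sum>b\<in>Basis. exp (- (e \<bullet> A e)) * (e \<bullet> b) * (e \<bullet> b))"
    unfolding exp_trace_def exp_form_eigenbasis[OF assms] by (rule sum.swap)
  also have "\<dots> = (\<Sum>e\<in>E. exp (- (e \<bullet> A e)) * (e \<bullet> e))"
    by (simp only: mult.assoc flip: sum_distrib_left euclidean_inner)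
  also have "\<dots> = (\<Sum>e\<in>E. exp (- (e \<bullet> A e)))"
    using assms(2) by (intro sum.cong refl) (auto simp: eigenbasis_def orthonormal_basis_def norm_eq_1)
  finally show ?thesis .
qed

text \<open>The scalar inequality to which the rank-one update reduces; \<open>x\<close> is the gap between an eigenvalue
after and one before the update. Both sides vanish at \<open>0\<close> with the same slope. The factor \<open>41/50\<close> lies
just below \<open>(1 - exp (- 2/5)) / (2/5)\<close>, its supremum allowed by the zero of the right-hand side at
\<open>2/5\<close>, and the slopes at \<open>0\<close> agree because \<open>3/10\<close> and \<open>3/20\<close> add up to \<open>(1 - 41/50) / (2/5)\<close>. After
multiplication by \<open>exp x\<close> the difference of the two sides is concave.\<close>

lemma exp_neg_quadratic_bound:
  fixes x :: real
  shows "exp (- x) - 1 + 41/50 * x \<le> (3/10 + 3/20 * exp (- x)) * (x\<^sup>2 - 2/5 * x)"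
proof -
  define \<psi> where "\<psi> = (\<lambda>x::real. 1 - 3/20 * (x\<^sup>2 - 2/5 * x)
     - exp x * (1 - 41/50 * x + 3/10 * (x\<^sup>2 - 2/5 * x)))"
  define \<psi>' where "\<psi>' = (\<lambda>x::real. - 3/20 * (2 * x - 2/5)
     - exp x * (3/10 * x\<^sup>2 - 17/50 * x + 3/50))"
  have d: "(\<psi> has_real_derivative \<psi>' x) (at x)" for x
    unfolding \<psi>_def \<psi>'_def
    by (auto intro!: derivative_eq_intros simp: field_simps power2_eq_square)
  have d': "(\<psi>' has_real_derivative (- 3/10 - exp x * (3/10 * x\<^sup>2 + 13/50 * x - 7/25))) (at x)" for x
    unfolding \<psi>'_def
    by (auto intro!: derivative_eq_intros simp: field_simps power2_eq_square)
  have neg: "- 3/10 - exp x * (3/10 * x\<^sup>2 + 13/50 * x - 7/25) \<le> 0" for x :: real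
  proof -
    have "3/10 * (1 - x) \<le> 3/10 * exp (- x)" using exp_ge_add_one_self[of "- x"] by simp
    moreover have "0 \<le> 3/10 * (x - 1/15)\<^sup>2 + 1/100" by simp
    then have "0 \<le> 3/10 * x\<^sup>2 - 1/25 * x + 1/50" by (simp add: power2_eq_square algebra_simps)
    ultimately have "- (3/10 * x\<^sup>2 + 13/50 * x - 7/25) \<le> 3/10 * exp (- x)"
      by (simp add: field_simps)
    then have "exp x * - (3/10 * x\<^sup>2 + 13/50 * x - 7/25) \<le> exp x * (3/10 * exp (- x))"
      by (intro mult_left_mono) auto
    also have "\<dots> = 3/10" by (simp add: exp_minus)
    finally show ?thesis by (simp add: algebra_simps)
  qed
  have anti: "\<psi>' b \<le> \<psi>' a" if "a \<le> b" for a b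
    using that DERIV_nonpos_imp_nonincreasing[of a b \<psi>'] d' neg by blast
  have z: "\<psi>' 0 = 0" "\<psi> 0 = 0" by (simp_all add: \<psi>_def \<psi>'_def)
  have "\<psi> x \<le> 0"
  proof (cases "0 \<le> x")
    case True
    have "\<psi> x \<le> \<psi> 0"
      by (rule DERIV_nonpos_imp_nonincreasing[OF True]) (use d anti[of 0] z in force)
    then show ?thesis using z by simp
  next
    case False
    have "\<psi> x \<le> \<psi> 0"
      by (rule DERIV_nonneg_imp_nondecreasing) (use False d anti[of _ 0] z in force)+
    then show ?thesis using z by simp
  qed
  then have "exp (- x) * \<psi> x \<le> 0" by (simp add: mult_nonneg_nonpos)
  moreover have "exp (- x) * \<psi> x = exp (- x) * (1 - 3/20 * (x\<^sup>2 - 2/5 * x))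
      - (exp (- x) * exp x) * (1 - 41/50 * x + 3/10 * (x\<^sup>2 - 2/5 * x))"
    by (simp add: \<psi>_def algebra_simps)
  ultimately show ?thesis by (simp add: exp_minus algebra_simps)
qed

text \<open>Let \<open>s e\<close> and \<open>r d\<close> be the eigenvalues before and after the update, \<open>g e d = r d - s e\<close> the gaps, and
\<open>w e d = (e \<bullet> d)^2\<close> the overlaps, which sum to \<open>1\<close> in each variable. Because the perturbation is
\<open>v v^T\<close>, one has \<open>g e d * (e \<bullet> d) = (v \<bullet> d) * (v \<bullet> e)\<close>, so that the \<open>w\<close>-average of \<open>g\<close> for fixed \<open>e\<close> is
\<open>(v \<bullet> e)^2\<close> and that of \<open>g^2\<close> is \<open>|v|^2 (v \<bullet> e)^2\<close>, and symmetrically for fixed \<open>d\<close>. Averaging the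
scalar inequality multiplied by \<open>exp (- s e)\<close> turns its quadratic right-hand side into a multiple of
\<open>|v|^2 - 2/5\<close>, which is not positive.\<close>

lemma exp_trace_rank_one_update:
  fixes A :: "'a::euclidean_space \<Rightarrow> 'a"
  assumes A: "self_adjoint A" and v: "(norm v)\<^sup>2 \<le> 2/5"
  shows "exp_trace (\<lambda>x. A x + (v \<bullet> x) *\<^sub>R v) \<le> exp_trace A - 41/50 * exp_form A v v"
proof -
  let ?B = "\<lambda>x. A x + (v \<bullet> x) *\<^sub>R v"
  have linA: "linear A" and symA: "\<And>x y. A x \<bullet> y = x \<bullet> A y"
    using A by (auto simp: self_adjoint_def)
  have linB: "linear ?B"
    by (rule linearI) (simp_all add: linear_add[OF linA] linear_cmul[OF linA] algebra_simps inner_add_right)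
  have B: "self_adjoint ?B"
    unfolding self_adjoint_def using linB symA
    by (simp add: inner_add_left inner_add_right inner_commute)
  obtain E where E: "eigenbasis A E" using self_adjoint_eigenbasis[OF A] .
  obtain D where D: "eigenbasis ?B D" using self_adjoint_eigenbasis[OF B] .
  have oE: "orthonormal_basis E" and oD: "orthonormal_basis D" using E D by (auto simp: eigenbasis_def)
  define s where "s = (\<lambda>e. e \<bullet> A e)"
  define r where "r = (\<lambda>d. d \<bullet> ?B d)"
  define w where "w = (\<lambda>(e::'a) d. (e \<bullet> d)\<^sup>2)"
  define g where "g = (\<lambda>e d. r d - s e)"
  have key: "g e d * (e \<bullet> d) = (v \<bullet> d) * (v \<bullet> e)" if "e \<in> E" "d \<in> D" for e d
  proof -
    have "s e * (e \<bullet> d) = A e \<bullet> d" using E that by (metis eigenbasis_def inner_scaleR_left s_def)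
    moreover have "r d * (e \<bullet> d) = e \<bullet> ?B d"
      using D that unfolding eigenbasis_def r_def by (metis inner_scaleR_right)
    ultimately show ?thesis
      unfolding g_def left_diff_distrib using symA[of e d]
      by (simp add: inner_add_right inner_commute)
  qed
  have wsum: "(\<Sum>d\<in>D. w e d) = 1" "(\<Sum>e\<in>E. w e d) = 1" if "e \<in> E" "d \<in> D" for e d
  proof -
    have "(\<Sum>d\<in>D. w e d) = e \<bullet> e" using orthonormal_basis_parseval[OF oD, of e e]
      by (simp add: w_def power2_eq_square inner_commute)
    also have "\<dots> = 1" using oE that by (auto simp: orthonormal_basis_def norm_eq_1)
    finally show "(\<Sum>d\<in>D. w e d) = 1" .
    have "(\<Sum>e\<in>E. w e d) = d \<bullet> d" using orthonormal_basis_parseval[OF oE, of d d]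
      by (simp add: w_def power2_eq_square)
    also have "\<dots> = 1" using oD that by (auto simp: orthonormal_basis_def norm_eq_1)
    finally show "(\<Sum>e\<in>E. w e d) = 1" .
  qed
  have wg: "w e d * g e d = (d \<bullet> e) * (d \<bullet> v) * (v \<bullet> e)"
    and wg': "w e d * g e d = (e \<bullet> d) * (e \<bullet> v) * (v \<bullet> d)"
    and wg2: "w e d * (g e d)\<^sup>2 = (v \<bullet> d)\<^sup>2 * (v \<bullet> e)\<^sup>2" if "e \<in> E" "d \<in> D" for e d
  proof -
    have "w e d * g e d = (e \<bullet> d) * (g e d * (e \<bullet> d))" by (simp only: w_def power2_eq_square mult_ac)
    then have "w e d * g e d = (e \<bullet> d) * ((v \<bullet> d) * (v \<bullet> e))" by (simp only: key[OF that])
    then show "w e d * g e d = (d \<bullet> e) * (d \<bullet> v) * (v \<bullet> e)"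
      and "w e d * g e d = (e \<bullet> d) * (e \<bullet> v) * (v \<bullet> d)"
      by (simp_all add: inner_commute mult_ac)
    have "w e d * (g e d)\<^sup>2 = (g e d * (e \<bullet> d))\<^sup>2" by (simp add: w_def power_mult_distrib)
    then show "w e d * (g e d)\<^sup>2 = (v \<bullet> d)\<^sup>2 * (v \<bullet> e)\<^sup>2"
      using key[OF that] by (simp add: power_mult_distrib)
  qed
  have vv: "(\<Sum>d\<in>D. (v \<bullet> d)\<^sup>2) = (norm v)\<^sup>2" "(\<Sum>e\<in>E. (v \<bullet> e)\<^sup>2) = (norm v)\<^sup>2"
    using orthonormal_basis_parseval[OF oD, of v v] orthonormal_basis_parseval[OF oE, of v v]
    unfolding power2_norm_eq_inner by (simp_all add: power2_eq_square inner_commute)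
  have s1: "(\<Sum>d\<in>D. w e d * g e d) = (v \<bullet> e)\<^sup>2"
    and s2: "(\<Sum>d\<in>D. w e d * (g e d)\<^sup>2) = (norm v)\<^sup>2 * (v \<bullet> e)\<^sup>2" if e: "e \<in> E" for e
  proof -
    have "(\<Sum>d\<in>D. w e d * g e d) = (\<Sum>d\<in>D. (d \<bullet> e) * (d \<bullet> v)) * (v \<bullet> e)"
      using e by (simp add: wg sum_distrib_right)
    then show "(\<Sum>d\<in>D. w e d * g e d) = (v \<bullet> e)\<^sup>2"
      by (simp add: orthonormal_basis_parseval[OF oD] power2_eq_square inner_commute)
    show "(\<Sum>d\<in>D. w e d * (g e d)\<^sup>2) = (norm v)\<^sup>2 * (v \<bullet> e)\<^sup>2"
      using e by (simp add: wg2 vv flip: sum_distrib_right)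
  qed
  have t1: "(\<Sum>e\<in>E. w e d * g e d) = (v \<bullet> d)\<^sup>2"
    and t2: "(\<Sum>e\<in>E. w e d * (g e d)\<^sup>2) = (norm v)\<^sup>2 * (v \<bullet> d)\<^sup>2" if d: "d \<in> D" for d
  proof -
    have "(\<Sum>e\<in>E. w e d * g e d) = (\<Sum>e\<in>E. (e \<bullet> d) * (e \<bullet> v)) * (v \<bullet> d)"
      using d by (simp add: wg' sum_distrib_right)
    then show "(\<Sum>e\<in>E. w e d * g e d) = (v \<bullet> d)\<^sup>2"
      by (simp add: orthonormal_basis_parseval[OF oE] power2_eq_square inner_commute)
    show "(\<Sum>e\<in>E. w e d * (g e d)\<^sup>2) = (norm v)\<^sup>2 * (v \<bullet> d)\<^sup>2"
      using d by (simp add: wg2 vv mult.commute flip: sum_distrib_right)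
  qed
  \<comment> \<open>The scalar inequality, weighted by \<open>w e d * exp (- s e)\<close>.\<close>
  have pt: "w e d * exp (- r d) - exp (- s e) * w e d + 41/50 * (exp (- s e) * (w e d * g e d))
     \<le> 3/10 * exp (- s e) * (w e d * (g e d)\<^sup>2 - 2/5 * (w e d * g e d))
       + 3/20 * exp (- r d) * (w e d * (g e d)\<^sup>2 - 2/5 * (w e d * g e d))" for e d
  proof -
    have ex: "exp (- r d) = exp (- s e) * exp (- g e d)" by (simp add: g_def flip: exp_add)
    have "w e d * exp (- s e) * (exp (- g e d) - 1 + 41/50 * g e d)
      \<le> w e d * exp (- s e) * ((3/10 + 3/20 * exp (- g e d)) * ((g e d)\<^sup>2 - 2/5 * g e d))"
      by (intro mult_left_mono exp_neg_quadratic_bound) (simp add: w_def)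
    then show ?thesis unfolding ex by (simp add: algebra_simps)
  qed
  have nn: "(norm v)\<^sup>2 * a\<^sup>2 - 2/5 * a\<^sup>2 \<le> 0" for a :: real
    using mult_right_mono[OF v, of "a\<^sup>2"] by simp
  have "(\<Sum>e\<in>E. \<Sum>d\<in>D. w e d * exp (- r d) - exp (- s e) * w e d + 41/50 * (exp (- s e) * (w e d * g e d)))
     \<le> (\<Sum>e\<in>E. \<Sum>d\<in>D. 3/10 * exp (- s e) * (w e d * (g e d)\<^sup>2 - 2/5 * (w e d * g e d))
       + 3/20 * exp (- r d) * (w e d * (g e d)\<^sup>2 - 2/5 * (w e d * g e d)))"
    by (intro sum_mono pt)
  also have "\<dots> = (\<Sum>e\<in>E. 3/10 * exp (- s e) * (\<Sum>d\<in>D. w e d * (g e d)\<^sup>2 - 2/5 * (w e d * g e d)))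
     + (\<Sum>d\<in>D. 3/20 * exp (- r d) * (\<Sum>e\<in>E. w e d * (g e d)\<^sup>2 - 2/5 * (w e d * g e d)))"
    unfolding sum.distrib sum_distrib_left by (subst (2) sum.swap) simp
  also have "\<dots> = (\<Sum>e\<in>E. 3/10 * exp (- s e) * ((norm v)\<^sup>2 * (v \<bullet> e)\<^sup>2 - 2/5 * (v \<bullet> e)\<^sup>2))
     + (\<Sum>d\<in>D. 3/20 * exp (- r d) * ((norm v)\<^sup>2 * (v \<bullet> d)\<^sup>2 - 2/5 * (v \<bullet> d)\<^sup>2))"
    by (intro arg_cong2[of _ _ _ _ "(+)"] sum.cong refl)
      (simp_all only: sum_subtractf s1 s2 t1 t2 sum_distrib_left[symmetric])
  also have "\<dots> \<le> 0 + 0"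
    by (intro add_mono sum_nonpos mult_nonneg_nonpos nn) auto
  finally have "(\<Sum>e\<in>E. \<Sum>d\<in>D. w e d * exp (- r d))
     - (\<Sum>e\<in>E. exp (- s e) * (\<Sum>d\<in>D. w e d))
     + 41/50 * (\<Sum>e\<in>E. exp (- s e) * (\<Sum>d\<in>D. w e d * g e d)) \<le> 0"
    by (simp only: sum.distrib sum_subtractf sum_distrib_left add_0_left)
  \<comment> \<open>The overlaps sum to one, so only the two traces remain.\<close>
  moreover have "(\<Sum>e\<in>E. \<Sum>d\<in>D. w e d * exp (- r d)) = (\<Sum>d\<in>D. exp (- r d))"
  proof -
    have "(\<Sum>e\<in>E. \<Sum>d\<in>D. w e d * exp (- r d)) = (\<Sum>d\<in>D. (\<Sum>e\<in>E. w e d) * exp (- r d))"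
      by (subst sum.swap) (simp add: sum_distrib_right)
    then show ?thesis using orthonormal_basis_nonempty[OF oE] wsum(2) by (auto intro!: sum.cong)
  qed
  moreover have "(\<Sum>e\<in>E. exp (- s e) * (\<Sum>d\<in>D. w e d)) = (\<Sum>e\<in>E. exp (- s e))"
  proof -
    show ?thesis using orthonormal_basis_nonempty[OF oD] wsum(1) by (auto intro!: sum.cong)
  qed
  moreover have "(\<Sum>e\<in>E. exp (- s e) * (\<Sum>d\<in>D. w e d * g e d)) = exp_form A v v"
    unfolding exp_form_eigenbasis[OF linA E]
    by (intro sum.cong refl) (simp add: s1 s_def power2_eq_square inner_commute)
  ultimately show ?thesis
    unfolding exp_trace_eigenbasis[OF linA E] exp_trace_eigenbasis[OF linB D] s_def r_def by linarith
qed

text \<open>The map \<open>\<Sum>i\<in>I. (V i) (V i)^T\<close>.\<close>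

definition gram :: "('i \<Rightarrow> 'a::euclidean_space) \<Rightarrow> 'i set \<Rightarrow> 'a \<Rightarrow> 'a" where
  "gram V I x = (\<Sum>i\<in>I. (V i \<bullet> x) *\<^sub>R V i)"

lemma gram_quadratic: "x \<bullet> gram V I x = (\<Sum>i\<in>I. (V i \<bullet> x)\<^sup>2)"
  by (simp add: gram_def inner_sum_right power2_eq_square inner_commute)

lemma self_adjoint_gram: "self_adjoint (gram V I)"
  unfolding self_adjoint_def gram_def
  by (auto intro!: linearI simp: inner_add_right sum.distrib scaleR_add_left scaleR_sum_right
      inner_sum_left inner_sum_right inner_commute mult_ac)

text \<open>Expands the form in the standard basis, which separates \<open>A\<close> from \<open>v\<close>: with independent random
\<open>A\<close> and \<open>v\<close> the expectation of each summand factorizes.\<close>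

lemma exp_form_bilinear:
  assumes A: "self_adjoint A"
  shows "exp_form A v v = (\<Sum>b\<in>Basis. \<Sum>b'\<in>Basis. exp_form A b b' * ((v \<bullet> b) * (v \<bullet> b')))"
proof -
  obtain E where E: "eigenbasis A E" using self_adjoint_eigenbasis[OF A] .
  have lin: "linear A" using A by (simp add: self_adjoint_def)
  have "exp_form A v v = (\<Sum>e\<in>E. exp (- (e \<bullet> A e)) *
      ((\<Sum>b\<in>Basis. (e \<bullet> b) * (v \<bullet> b)) * (\<Sum>b'\<in>Basis. (e \<bullet> b') * (v \<bullet> b'))))"
    unfolding exp_form_eigenbasis[OF lin E]
    by (simp only: mult.assoc flip: euclidean_inner)
  also have "\<dots> = (\<Sum>e\<in>E. \<Sum>b\<in>Basis. \<Sum>b'\<in>Basis.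
      exp (- (e \<bullet> A e)) * (e \<bullet> b) * (e \<bullet> b') * ((v \<bullet> b) * (v \<bullet> b')))"
    by (simp add: sum_product sum_distrib_left mult_ac)
  also have "\<dots> = (\<Sum>b\<in>Basis. \<Sum>b'\<in>Basis. \<Sum>e\<in>E.
      exp (- (e \<bullet> A e)) * (e \<bullet> b) * (e \<bullet> b') * ((v \<bullet> b) * (v \<bullet> b')))"
    by (subst sum.swap, subst (2) sum.swap) simp
  finally show ?thesis
    by (simp add: exp_form_eigenbasis[OF lin E] sum_distrib_right)
qed

lemma abs_exp_form_le:
  assumes A: "self_adjoint A" and psd: "\<And>x. 0 \<le> x \<bullet> A x"
  shows "\<bar>exp_form A x y\<bar> \<le> norm x * norm y"
proof -
  obtain E where E: "eigenbasis A E" using self_adjoint_eigenbasis[OF A] .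
  have lin: "linear A" using A by (simp add: self_adjoint_def)
  have on: "orthonormal_basis E" using E by (simp add: eigenbasis_def)
  have n: "(L2_set (\<lambda>e. e \<bullet> x) E) = norm x" for x :: 'a
    using orthonormal_basis_parseval[OF on, of x x]
    by (simp add: L2_set_def power2_eq_square norm_eq_sqrt_inner)
  have "\<bar>exp_form A x y\<bar> \<le> (\<Sum>e\<in>E. \<bar>exp (- (e \<bullet> A e)) * (e \<bullet> x) * (e \<bullet> y)\<bar>)"
    unfolding exp_form_eigenbasis[OF lin E] by (rule sum_abs)
  also have "\<dots> \<le> (\<Sum>e\<in>E. \<bar>e \<bullet> x\<bar> * \<bar>e \<bullet> y\<bar>)"
    using psd by (intro sum_mono) (auto simp: abs_mult mult.assoc intro!: mult_left_le_one_le)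
  also have "\<dots> \<le> norm x * norm y"
    using L2_set_mult_ineq[of "\<lambda>e. e \<bullet> x" "\<lambda>e. e \<bullet> y" E] n by simp
  finally show ?thesis .
qed

lemma exp_trace_nonneg:
  assumes "self_adjoint A"
  shows "0 \<le> exp_trace A"
proof -
  obtain E where E: "eigenbasis A E" using self_adjoint_eigenbasis[OF assms] .
  then show ?thesis
    using assms by (subst exp_trace_eigenbasis[of A E]) (auto simp: self_adjoint_def intro: sum_nonneg)
qed

text \<open>The trace dominates \<open>exp (- s)\<close> for the smallest eigenvalue \<open>s\<close>, so a small trace forces all
eigenvalues above \<open>c\<close>.\<close>

lemma exp_trace_less_imp_form_ge:
  assumes A: "self_adjoint A" and less: "exp_trace A < exp (- c)"
  shows "c * (norm x)\<^sup>2 \<le> x \<bullet> A x"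
proof -
  obtain E where E: "eigenbasis A E" using self_adjoint_eigenbasis[OF A] .
  have lin: "linear A" using A by (simp add: self_adjoint_def)
  have on: "orthonormal_basis E" using E by (simp add: eigenbasis_def)
  have fin: "finite E" using on by (simp add: orthonormal_basis_def)
  have c: "c \<le> e \<bullet> A e" if "e \<in> E" for e
  proof -
    have "exp (- (e \<bullet> A e)) \<le> exp_trace A"
      unfolding exp_trace_eigenbasis[OF lin E] using that fin
      by (intro member_le_sum[of e E "\<lambda>e. exp (- (e \<bullet> A e))"]) auto
    then have "exp (- (e \<bullet> A e)) < exp (- c)" using less by linarith
    then show ?thesis by simp
  qed
  have "A x = (\<Sum>e\<in>E. ((e \<bullet> A e) * (e \<bullet> x)) *\<^sub>R e)"
    using eigenbasis_funpow[OF lin E, of 1 x] by simp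
  then have "x \<bullet> A x = (\<Sum>e\<in>E. (e \<bullet> A e) * (e \<bullet> x) * (x \<bullet> e))"
    by (simp add: inner_sum_right)
  also have "\<dots> \<ge> (\<Sum>e\<in>E. c * ((e \<bullet> x) * (e \<bullet> x)))"
    using c by (intro sum_mono) (auto simp: inner_commute mult.assoc intro!: mult_right_mono)
  finally show ?thesis
    using orthonormal_basis_parseval[OF on, of x x]
    by (simp only: power2_norm_eq_inner flip: sum_distrib_left)
qed

lemma measurable_exp_form_gram:
  fixes V :: "'i \<Rightarrow> 'w \<Rightarrow> 'a::euclidean_space"
  assumes V: "\<And>i. i \<in> I \<Longrightarrow> V i \<in> borel_measurable N"
  shows "(\<lambda>\<omega>. exp_form (gram (\<lambda>i. V i \<omega>) I) x y) \<in> borel_measurable N"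
proof -
  have "(\<lambda>\<omega>. (gram (\<lambda>i. V i \<omega>) I ^^ k) y) \<in> borel_measurable N" for k
  proof (induction k)
    case 0
    show ?case by simp
  next
    case (Suc k)
    note [measurable] = Suc V
    show ?case by (simp only: funpow.simps comp_apply gram_def[of _ _ "_ y"]) measurable
  qed
  note [measurable] = this
  show ?thesis unfolding exp_form_def by measurable
qed

text \<open>Each summand is independent of the previous ones and isotropic with second moment \<open>\<theta>\<close>, so in
expectation the term subtracted in the rank-one update is \<open>41/50 * \<theta>\<close> times the current trace, and
the expected trace contracts by the factor \<open>1 - 41/50 * \<theta>\<close>.\<close>

lemma (in prob_space) expectation_exp_trace_gram_le:
  fixes V :: "'i \<Rightarrow> 'a \<Rightarrow> 'b::euclidean_space"
  assumes fin: "finite I" and ind: "indep_vars (\<lambda>_. borel) V I"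
    and bnd: "\<And>i. i \<in> I \<Longrightarrow> AE \<omega> in M. (norm (V i \<omega>))\<^sup>2 \<le> 2/5"
    and cov: "\<And>i x y. i \<in> I \<Longrightarrow> expectation (\<lambda>\<omega>. (V i \<omega> \<bullet> x) * (V i \<omega> \<bullet> y)) = \<theta> * (x \<bullet> y)"
  shows "expectation (\<lambda>\<omega>. exp_trace (gram (\<lambda>i. V i \<omega>) I))
           \<le> DIM('b) * exp (- (41/50 * \<theta> * card I))"
  using assms
proof (induction I rule: finite_induct)
  case empty
  have "exp_form (gram (\<lambda>i. V i \<omega>) {}) b b = 1" if "b \<in> Basis" for b and \<omega>
  proof -
    have "(gram (\<lambda>i. V i \<omega>) {} ^^ k) b = (if k = 0 then b else 0)" for k
      by (cases k) (auto simp: gram_def)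
    then have "exp_form (gram (\<lambda>i. V i \<omega>) {}) b b = (\<Sum>k. if k = 0 then 1 else 0)"
      using that unfolding exp_form_def by (intro suminf_cong) auto
    also have "\<dots> = 1" using sums_single[of 0 "\<lambda>_. 1::real"] by (simp add: sums_iff)
    finally show ?thesis .
  qed
  then show ?case by (simp add: exp_trace_def prob_space)
next
  case (insert k I)
  have rv: "\<And>i. i \<in> insert k I \<Longrightarrow> random_variable borel (V i)"
    using insert.prems(1) unfolding indep_vars_def by blast
  let ?S = "\<lambda>\<omega>. gram (\<lambda>i. V i \<omega>) I"
  let ?S' = "\<lambda>\<omega>. gram (\<lambda>i. V i \<omega>) (insert k I)"
  have psd: "0 \<le> x \<bullet> gram W J x" for x :: 'b and W and J :: "'i set"
    unfolding gram_quadratic by (intro sum_nonneg) simp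
  have meas[measurable]: "(\<lambda>\<omega>. exp_form (?S \<omega>) x y) \<in> borel_measurable M"
    "(\<lambda>\<omega>. exp_form (?S' \<omega>) x y) \<in> borel_measurable M" for x y
    using rv by (intro measurable_exp_form_gram; simp)+
  have [measurable]: "random_variable borel (V k)" by (rule rv) simp
  have intF[intro]: "integrable M (\<lambda>\<omega>. exp_form (?S \<omega>) x y)"
    "integrable M (\<lambda>\<omega>. exp_form (?S' \<omega>) x y)" for x y
    by (rule integrable_const_bound[where B = "norm x * norm y"];
        auto intro!: abs_exp_form_le self_adjoint_gram psd)+
  have intT: "integrable M (\<lambda>\<omega>. exp_trace (?S \<omega>))" "integrable M (\<lambda>\<omega>. exp_trace (?S' \<omega>))"
    unfolding exp_trace_def by auto
  have intV: "integrable M (\<lambda>\<omega>. (V k \<omega> \<bullet> x) * (V k \<omega> \<bullet> y))" for x y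
  proof (rule integrable_const_bound[where B = "2/5 * (norm x * norm y)"])
    show "AE \<omega> in M. norm ((V k \<omega> \<bullet> x) * (V k \<omega> \<bullet> y)) \<le> 2/5 * (norm x * norm y)"
      using insert.prems(2)[OF insertI1]
    proof eventually_elim
      case (elim \<omega>)
      have "norm ((V k \<omega> \<bullet> x) * (V k \<omega> \<bullet> y)) \<le> (norm (V k \<omega>) * norm x) * (norm (V k \<omega>) * norm y)"
        unfolding norm_mult by (intro mult_mono) (auto simp: Cauchy_Schwarz_ineq2)
      also have "\<dots> = (norm (V k \<omega>))\<^sup>2 * (norm x * norm y)" by (simp add: power2_eq_square)
      also have "\<dots> \<le> 2/5 * (norm x * norm y)" by (intro mult_right_mono elim) auto
      finally show ?case .
    qed
  qed measurable
  have prod: "expectation (\<lambda>\<omega>. exp_form (?S \<omega>) x y * ((V k \<omega> \<bullet> x) * (V k \<omega> \<bullet> y)))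
       = expectation (\<lambda>\<omega>. exp_form (?S \<omega>) x y) * (\<theta> * (x \<bullet> y))" (is ?eq)
    and prod_int: "integrable M (\<lambda>\<omega>. exp_form (?S \<omega>) x y * ((V k \<omega> \<bullet> x) * (V k \<omega> \<bullet> y)))" (is ?int)
    for x y
  proof -
    have iv: "indep_var (PiM I (\<lambda>_. borel)) (\<lambda>\<omega>. restrict (\<lambda>i. V i \<omega>) I)
        (PiM {k} (\<lambda>_. borel)) (\<lambda>\<omega>. restrict (\<lambda>i. V i \<omega>) {k})"
      using insert.hyps(2) by (intro indep_var_restrict[OF insert.prems(1)]) auto
    have "indep_var borel ((\<lambda>f. exp_form (gram f I) x y) \<circ> (\<lambda>\<omega>. restrict (\<lambda>i. V i \<omega>) I))
        borel ((\<lambda>f. (f k \<bullet> x) * (f k \<bullet> y)) \<circ> (\<lambda>\<omega>. restrict (\<lambda>i. V i \<omega>) {k}))"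
    proof (rule indep_var_compose[OF iv])
      show "(\<lambda>f. exp_form (gram f I) x y) \<in> borel_measurable (PiM I (\<lambda>_. borel :: 'b measure))"
        using measurable_exp_form_gram[of I "\<lambda>i f. f i" "PiM I (\<lambda>_. borel :: 'b measure)" x y]
        by simp
    qed measurable
    also have "(\<lambda>f. exp_form (gram f I) x y) \<circ> (\<lambda>\<omega>. restrict (\<lambda>i. V i \<omega>) I) = (\<lambda>\<omega>. exp_form (?S \<omega>) x y)"
    proof -
      have "gram (restrict (\<lambda>i. V i \<omega>) I) I = ?S \<omega>" for \<omega>
        by (rule ext) (simp add: gram_def)
      then show ?thesis by (simp add: comp_def)
    qed
    also have "(\<lambda>f. (f k \<bullet> x) * (f k \<bullet> y)) \<circ> (\<lambda>\<omega>. restrict (\<lambda>i. V i \<omega>) {k})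
        = (\<lambda>\<omega>. (V k \<omega> \<bullet> x) * (V k \<omega> \<bullet> y))" by (simp add: comp_def)
    finally have iv': "indep_var borel (\<lambda>\<omega>. exp_form (?S \<omega>) x y) borel (\<lambda>\<omega>. (V k \<omega> \<bullet> x) * (V k \<omega> \<bullet> y))" .
    show ?eq using indep_var_lebesgue_integral[OF iv' intF(1) intV] insert.prems(3)[of k] by simp
    show ?int using indep_var_integrable[OF iv' intF(1) intV] .
  qed
  \<comment> \<open>Basis expansion of the rank-one update; the cross terms vanish in expectation by isotropy.\<close>
  have step: "AE \<omega> in M. exp_trace (?S' \<omega>) \<le> exp_trace (?S \<omega>) - 41/50 *
     (\<Sum>b\<in>Basis. \<Sum>b'\<in>Basis. exp_form (?S \<omega>) b b' * ((V k \<omega> \<bullet> b) * (V k \<omega> \<bullet> b')))"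
    using insert.prems(2)[OF insertI1]
  proof eventually_elim
    case (elim \<omega>)
    have "?S' \<omega> = (\<lambda>x. ?S \<omega> x + (V k \<omega> \<bullet> x) *\<^sub>R V k \<omega>)"
      using insert.hyps by (auto simp: gram_def fun_eq_iff)
    then show ?case
      using exp_trace_rank_one_update[OF self_adjoint_gram elim, of "\<lambda>i. V i \<omega>" I]
        exp_form_bilinear[OF self_adjoint_gram[of "\<lambda>i. V i \<omega>" I], of "V k \<omega>"]
      by simp
  qed
  have prod0: "expectation (\<lambda>\<omega>. exp_form (?S \<omega>) b b' * ((V k \<omega> \<bullet> b) * (V k \<omega> \<bullet> b')))
       = (if b = b' then \<theta> * expectation (\<lambda>\<omega>. exp_form (?S \<omega>) b b) else 0)"
    if "b \<in> Basis" "b' \<in> Basis" for b b'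
    using that by (auto simp: prod inner_Basis)
  have "expectation (\<lambda>\<omega>. exp_trace (?S' \<omega>)) \<le> expectation (\<lambda>\<omega>. exp_trace (?S \<omega>) - 41/50 *
     (\<Sum>b\<in>Basis. \<Sum>b'\<in>Basis. exp_form (?S \<omega>) b b' * ((V k \<omega> \<bullet> b) * (V k \<omega> \<bullet> b'))))"
    by (intro integral_mono_AE step intT Bochner_Integration.integrable_diff integrable_mult_right
        Bochner_Integration.integrable_sum prod_int)
  also have "\<dots> = expectation (\<lambda>\<omega>. exp_trace (?S \<omega>)) - 41/50 *
     (\<Sum>b\<in>Basis. \<Sum>b'\<in>Basis. expectation (\<lambda>\<omega>. exp_form (?S \<omega>) b b' * ((V k \<omega> \<bullet> b) * (V k \<omega> \<bullet> b'))))"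
    by (subst Bochner_Integration.integral_diff; (subst Bochner_Integration.integral_sum)?;
        auto intro!: intT prod_int simp: Bochner_Integration.integral_sum prod_int)
  also have "\<dots> = expectation (\<lambda>\<omega>. exp_trace (?S \<omega>)) * (1 - 41/50 * \<theta>)"
  proof -
    have "(\<Sum>b\<in>Basis. \<Sum>b'\<in>Basis. expectation (\<lambda>\<omega>. exp_form (?S \<omega>) b b' * ((V k \<omega> \<bullet> b) * (V k \<omega> \<bullet> b'))))
        = (\<Sum>b\<in>Basis. \<theta> * expectation (\<lambda>\<omega>. exp_form (?S \<omega>) b b))"
      by (intro sum.cong refl) (simp add: prod0 cong: sum.cong)
    also have "\<dots> = \<theta> * expectation (\<lambda>\<omega>. exp_trace (?S \<omega>))"
      by (simp add: exp_trace_def intF sum_distrib_left)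
    finally show ?thesis by (simp add: algebra_simps)
  qed
  also have "\<dots> \<le> expectation (\<lambda>\<omega>. exp_trace (?S \<omega>)) * exp (- (41/50 * \<theta>))"
    using exp_ge_add_one_self[of "- (41/50 * \<theta>)"]
    by (intro mult_left_mono Bochner_Integration.integral_nonneg) (auto intro!: exp_trace_nonneg self_adjoint_gram)
  also have "\<dots> \<le> (DIM('b) * exp (- (41/50 * \<theta> * card I))) * exp (- (41/50 * \<theta>))"
  proof (intro mult_right_mono insert.IH)
    show "indep_vars (\<lambda>_. borel) V I" by (rule indep_vars_subset[OF insert.prems(1)]) auto
  qed (use insert.prems in auto)
  also have "\<dots> = DIM('b) * exp (- (41/50 * \<theta> * card (insert k I)))"
    using insert.hyps by (simp add: algebra_simps flip: exp_add)
  finally show ?case .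
qed

section \<open>Scalar concentration inequalities\<close>

lemma exp_le_quadratic:
  fixes x :: real
  assumes "\<bar>x\<bar> \<le> 1"
  shows "exp x \<le> 1 + x + x\<^sup>2"
proof (cases "0 \<le> x")
  case True
  then show ?thesis using exp_bound[of x] assms by simp
next
  case False
  define y where "y = - x"
  have y: "0 \<le> y" "y \<le> 1" using False assms by (auto simp: y_def)
  have "1 \<le> 1 + (y\<^sup>2 + y ^ 3 + y ^ 4) / 2" using y by simp
  also have "\<dots> = (1 - y + y\<^sup>2) * (1 + y + y\<^sup>2 / 2)"
    by (simp add: field_simps power2_eq_square power3_eq_cube power4_eq_xxxx)
  also have "\<dots> \<le> (1 - y + y\<^sup>2) * exp y"
    using exp_lower_Taylor_quadratic[OF y(1)] y by (intro mult_left_mono) auto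
  finally have "exp (- y) \<le> ((1 - y + y\<^sup>2) * exp y) * exp (- y)" by simp
  also have "\<dots> = 1 - y + y\<^sup>2" by (simp add: exp_minus)
  finally show ?thesis by (simp add: y_def)
qed

text \<open>The Chernoff method with the second-moment bound of \<open>exp_le_quadratic\<close> on each moment generating
function. The parameter \<open>s\<close> is left free, so that it can be chosen where \<open>\<epsilon>\<close> is known.\<close>

lemma (in prob_space) bernstein_upper:
  fixes W :: "'i \<Rightarrow> 'a \<Rightarrow> real"
  assumes fin: "finite I" and ind: "indep_vars (\<lambda>_. borel) W I"
    and bnd: "\<And>i. i \<in> I \<Longrightarrow> AE \<omega> in M. \<bar>W i \<omega>\<bar> \<le> b"
    and var: "\<And>i. i \<in> I \<Longrightarrow> expectation (\<lambda>\<omega>. (W i \<omega>)\<^sup>2) \<le> v"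
    and s: "0 < s" "s * b \<le> 1"
  shows "prob {\<omega> \<in> space M. (\<Sum>i\<in>I. expectation (W i)) + \<epsilon> \<le> (\<Sum>i\<in>I. W i \<omega>)}
           \<le> exp (s\<^sup>2 * v * card I - s * \<epsilon>)"
proof -
  have rv: "random_variable borel (W i)" if "i \<in> I" for i
    using ind that unfolding indep_vars_def by blast
  have sb: "AE \<omega> in M. \<bar>s * W i \<omega>\<bar> \<le> 1" if "i \<in> I" for i
    using bnd[OF that]
  proof eventually_elim
    case (elim \<omega>)
    then have "s * \<bar>W i \<omega>\<bar> \<le> s * b" using s by (intro mult_left_mono) auto
    then have "s * \<bar>W i \<omega>\<bar> \<le> 1" using s(2) by linarith
    then show ?case using s(1) by (simp add: abs_mult)
  qed
  have intW: "integrable M (W i)" "integrable M (\<lambda>\<omega>. (W i \<omega>)\<^sup>2)"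
    and intE: "integrable M (\<lambda>\<omega>. exp (s * W i \<omega>))" if "i \<in> I" for i
  proof -
    note [measurable] = rv[OF that]
    show "integrable M (W i)"
      by (rule integrable_const_bound[where B = b]) (use bnd[OF that] in auto)
    have "AE \<omega> in M. norm ((W i \<omega>)\<^sup>2) \<le> b\<^sup>2"
      using bnd[OF that] by eventually_elim (simp add: abs_le_square_iff[symmetric])
    then show "integrable M (\<lambda>\<omega>. (W i \<omega>)\<^sup>2)"
      by (rule integrable_const_bound) measurable
    have "AE \<omega> in M. norm (exp (s * W i \<omega>)) \<le> exp 1"
      using sb[OF that] by eventually_elim auto
    then show "integrable M (\<lambda>\<omega>. exp (s * W i \<omega>))"
      by (rule integrable_const_bound) measurable
  qed
  have mgf: "expectation (\<lambda>\<omega>. exp (s * W i \<omega>)) \<le> exp (s * expectation (W i) + s\<^sup>2 * v)"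
    if "i \<in> I" for i
  proof -
    have "expectation (\<lambda>\<omega>. exp (s * W i \<omega>)) \<le> expectation (\<lambda>\<omega>. 1 + s * W i \<omega> + s\<^sup>2 * (W i \<omega>)\<^sup>2)"
    proof (intro integral_mono_AE intE that)
      show "AE \<omega> in M. exp (s * W i \<omega>) \<le> 1 + s * W i \<omega> + s\<^sup>2 * (W i \<omega>)\<^sup>2"
        using sb[OF that]
        by eventually_elim (metis exp_le_quadratic power_mult_distrib)
    qed (use intW[OF that] in simp)
    also have "\<dots> = 1 + s * expectation (W i) + s\<^sup>2 * expectation (\<lambda>\<omega>. (W i \<omega>)\<^sup>2)"
      using intW[OF that] by (simp add: prob_space)
    also have "\<dots> \<le> 1 + (s * expectation (W i) + s\<^sup>2 * v)"
      using var[OF that] by (simp add: mult_left_mono)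
    also have "\<dots> \<le> exp (s * expectation (W i) + s\<^sup>2 * v)" by (rule exp_ge_add_one_self)
    finally show ?thesis .
  qed
  have indE: "indep_vars (\<lambda>_. borel) (\<lambda>i \<omega>. exp (s * W i \<omega>)) I"
    by (rule indep_vars_compose2[OF ind]) measurable
  let ?m = "\<Sum>i\<in>I. expectation (W i)"
  let ?u = "\<lambda>\<omega>. \<Prod>i\<in>I. exp (s * W i \<omega>)"
  have intU: "integrable M ?u"
    by (rule indep_vars_integrable[OF fin indE intE])
  have "expectation ?u = (\<Prod>i\<in>I. expectation (\<lambda>\<omega>. exp (s * W i \<omega>)))"
    by (rule indep_vars_lebesgue_integral[OF fin indE intE])
  also have "\<dots> \<le> (\<Prod>i\<in>I. exp (s * expectation (W i) + s\<^sup>2 * v))"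
    by (intro prod_mono) (auto intro!: mgf)
  also have "\<dots> = exp (s * ?m + s\<^sup>2 * v * card I)"
    by (simp add: fin sum.distrib sum_distrib_left mult_ac flip: exp_sum)
  finally have Eu: "expectation ?u \<le> exp (s * ?m + s\<^sup>2 * v * card I)" .
  have set: "{\<omega> \<in> space M. ?m + \<epsilon> \<le> (\<Sum>i\<in>I. W i \<omega>)} = {\<omega> \<in> space M. exp (s * (?m + \<epsilon>)) \<le> ?u \<omega>}"
    using s fin by (simp flip: exp_sum sum_distrib_left)
  have "prob {\<omega> \<in> space M. exp (s * (?m + \<epsilon>)) \<le> ?u \<omega>} \<le> expectation ?u / exp (s * (?m + \<epsilon>))"
    using integral_Markov_inequality_measure[OF intU, of "space M" "exp (s * (?m + \<epsilon>))"]
    by (simp add: prod_nonneg)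
  also have "\<dots> \<le> exp (s * ?m + s\<^sup>2 * v * card I) / exp (s * (?m + \<epsilon>))"
    by (intro divide_right_mono Eu) simp
  also have "\<dots> = exp (s\<^sup>2 * v * card I - s * \<epsilon>)"
    by (simp add: algebra_simps flip: exp_diff)
  finally show ?thesis unfolding set .
qed

lemma (in prob_space) bernstein_two_sided:
  fixes W :: "'i \<Rightarrow> 'a \<Rightarrow> real"
  assumes fin: "finite I" and ind: "indep_vars (\<lambda>_. borel) W I"
    and bnd: "\<And>i. i \<in> I \<Longrightarrow> AE \<omega> in M. \<bar>W i \<omega>\<bar> \<le> b"
    and var: "\<And>i. i \<in> I \<Longrightarrow> expectation (\<lambda>\<omega>. (W i \<omega>)\<^sup>2) \<le> v"
    and s: "0 < s" "s * b \<le> 1"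
  shows "prob {\<omega> \<in> space M. \<epsilon> \<le> \<bar>(\<Sum>i\<in>I. W i \<omega>) - (\<Sum>i\<in>I. expectation (W i))\<bar>}
           \<le> 2 * exp (s\<^sup>2 * v * card I - s * \<epsilon>)"
proof -
  let ?U = "{\<omega> \<in> space M. (\<Sum>i\<in>I. expectation (W i)) + \<epsilon> \<le> (\<Sum>i\<in>I. W i \<omega>)}"
  let ?L = "{\<omega> \<in> space M. (\<Sum>i\<in>I. expectation (\<lambda>\<omega>. - W i \<omega>)) + \<epsilon> \<le> (\<Sum>i\<in>I. - W i \<omega>)}"
  have rv: "random_variable borel (W i)" if "i \<in> I" for i
    using ind that unfolding indep_vars_def by blast
  then have [measurable]: "(\<lambda>\<omega>. \<Sum>i\<in>I. W i \<omega>) \<in> borel_measurable M"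
    "(\<lambda>\<omega>. \<Sum>i\<in>I. - W i \<omega>) \<in> borel_measurable M" by measurable
  have "{\<omega> \<in> space M. \<epsilon> \<le> \<bar>(\<Sum>i\<in>I. W i \<omega>) - (\<Sum>i\<in>I. expectation (W i))\<bar>} \<subseteq> ?U \<union> ?L"
    by (auto simp: sum_negf)
  then have "prob {\<omega> \<in> space M. \<epsilon> \<le> \<bar>(\<Sum>i\<in>I. W i \<omega>) - (\<Sum>i\<in>I. expectation (W i))\<bar>} \<le> prob (?U \<union> ?L)"
    by (intro finite_measure_mono) measurable
  also have "\<dots> \<le> prob ?U + prob ?L" by (intro measure_Un_le) measurable
  also have "prob ?U \<le> exp (s\<^sup>2 * v * card I - s * \<epsilon>)"
    by (rule bernstein_upper[OF assms])
  also have "prob ?L \<le> exp (s\<^sup>2 * v * card I - s * \<epsilon>)"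
  proof (rule bernstein_upper[OF fin])
    show "indep_vars (\<lambda>_. borel) (\<lambda>i \<omega>. - W i \<omega>) I"
      by (rule indep_vars_compose2[OF ind]) measurable
  qed (use bnd var s in auto)
  finally show ?thesis by simp
qed

lemma (in prob_space) hoeffding_two_sided:
  fixes W :: "'i \<Rightarrow> 'a \<Rightarrow> real" and b :: real
  assumes fin: "finite I" and "I \<noteq> {}" and ind: "indep_vars (\<lambda>_. borel) W I"
    and bnd: "\<And>i. i \<in> I \<Longrightarrow> AE \<omega> in M. \<bar>W i \<omega>\<bar> \<le> b"
    and "0 < b" "0 \<le> \<epsilon>"
  shows "prob {\<omega> \<in> space M. \<epsilon> \<le> \<bar>(\<Sum>i\<in>I. W i \<omega>) - (\<Sum>i\<in>I. expectation (W i))\<bar>}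
           \<le> 2 * exp (- \<epsilon>\<^sup>2 / (2 * card I * b\<^sup>2))"
proof -
  interpret Hoeffding_ineq M I W "\<lambda>_. - b" "\<lambda>_. b" "\<Sum>i\<in>I. expectation (W i)"
  proof unfold_locales
    fix i assume "i \<in> I"
    show "AE x in M. W i x \<in> {- b..b}" using bnd[OF \<open>i \<in> I\<close>] by eventually_elim auto
  qed (use fin ind in auto)
  have card: "0 < card I" using fin \<open>I \<noteq> {}\<close> by (simp add: card_gt_0_iff)
  have S: "(\<Sum>i\<in>I. (b - - b)\<^sup>2) = 2 * (2 * card I * b\<^sup>2)" by (simp add: power2_eq_square)
  have "0 < (\<Sum>i\<in>I. (b - - b)\<^sup>2)" unfolding S using card \<open>0 < b\<close> by simp
  from Hoeffding_ineq_abs_ge[OF \<open>0 \<le> \<epsilon>\<close> this] show ?thesis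
    unfolding S by (simp add: field_simps)
qed

section \<open>Square roots and whitening\<close>

definition spectral_map :: "'a::euclidean_space set \<Rightarrow> ('a \<Rightarrow> real) \<Rightarrow> 'a \<Rightarrow> 'a" where
  "spectral_map E f x = (\<Sum>e\<in>E. (f e * (e \<bullet> x)) *\<^sub>R e)"

lemma inner_spectral_map: "x \<bullet> spectral_map E f y = (\<Sum>e\<in>E. f e * ((e \<bullet> x) * (e \<bullet> y)))"
  by (simp add: spectral_map_def inner_sum_right inner_commute mult_ac)

lemma self_adjoint_spectral_map: "self_adjoint (spectral_map E f)"
proof -
  have "spectral_map E f x \<bullet> y = x \<bullet> spectral_map E f y" for x y
    by (subst inner_commute) (simp add: inner_spectral_map mult_ac)
  then show ?thesis
    unfolding self_adjoint_def
    by (auto intro!: linearI simp: spectral_map_def inner_add_right sum.distrib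
        scaleR_add_left distrib_left scaleR_sum_right mult_ac)
qed

lemma inner_orthonormal_basis:
  assumes "orthonormal_basis E" "d \<in> E" "e \<in> E"
  shows "d \<bullet> e = (if d = e then 1 else 0)"
  using assms by (auto simp: orthonormal_basis_def pairwise_def orthogonal_def norm_eq_1)

lemma spectral_map_compose:
  assumes "orthonormal_basis E"
  shows "spectral_map E f (spectral_map E g x) = spectral_map E (\<lambda>e. f e * g e) x"
proof -
  have fin: "finite E" using assms by (simp add: orthonormal_basis_def)
  have "e \<bullet> spectral_map E g x = g e * (e \<bullet> x)" if "e \<in> E" for e
  proof -
    have "e \<bullet> spectral_map E g x = (\<Sum>d\<in>E. if d = e then g e * (e \<bullet> x) else 0)"
      unfolding inner_spectral_map using assms that
      by (intro sum.cong refl) (simp add: inner_orthonormal_basis[OF assms])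
    then show ?thesis using fin that by simp
  qed
  then show ?thesis
    unfolding spectral_map_def[of E f] spectral_map_def[of E "\<lambda>e. f e * g e"]
    by (intro sum.cong refl) (simp add: mult.assoc)
qed

lemma spectral_map_one:
  "orthonormal_basis E \<Longrightarrow> spectral_map E (\<lambda>_. 1) x = x"
  by (simp add: spectral_map_def orthonormal_basis_sum)

lemma eigenbasis_spectral_map:
  assumes "linear A" "eigenbasis A E"
  shows "A x = spectral_map E (\<lambda>e. e \<bullet> A e) x"
  using eigenbasis_funpow[OF assms, of 1 x] by (simp add: spectral_map_def)

lemma spectral_map_cong:
  "(\<And>e. e \<in> E \<Longrightarrow> f e = g e) \<Longrightarrow> spectral_map E f x = spectral_map E g x"
  by (simp add: spectral_map_def)

text \<open>The map \<open>T\<close> is the inverse square root of \<open>A\<close>. Surjectivity allows every coefficient vector to be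
written in whitened coordinates.\<close>

lemma whitening_map:
  fixes A :: "'a::euclidean_space \<Rightarrow> 'a"
  assumes A: "self_adjoint A" and psd: "\<And>x. 0 \<le> x \<bullet> A x" and inj: "inj A"
  obtains T where "self_adjoint T" "surj T" "\<And>x y. T x \<bullet> A (T y) = x \<bullet> y" "\<And>x. T (A (T x)) = x"
    "\<And>x. A (T (T x)) = x"
proof -
  have lin: "linear A" using A by (simp add: self_adjoint_def)
  obtain E where E: "eigenbasis A E" using self_adjoint_eigenbasis[OF A] .
  have on: "orthonormal_basis E" using E by (simp add: eigenbasis_def)
  define s where "s = (\<lambda>e. e \<bullet> A e)"
  have pos: "0 < s e" if "e \<in> E" for e
  proof (rule ccontr)
    assume "\<not> 0 < s e"
    then have "s e = 0" using psd[of e] by (simp add: s_def)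
    then have "A e = A 0" using E that linear_0[OF lin] unfolding eigenbasis_def s_def by force
    then have "e = 0" using inj by (simp add: inj_def)
    then show False using inner_orthonormal_basis[OF on that that] by simp
  qed
  define T where "T = spectral_map E (\<lambda>e. 1 / sqrt (s e))"
  define W where "W = spectral_map E (\<lambda>e. sqrt (s e))"
  have AT: "A x = spectral_map E s x" for x unfolding s_def by (rule eigenbasis_spectral_map[OF lin E])
  have id: "spectral_map E f x = x" if "\<And>e. e \<in> E \<Longrightarrow> f e = 1" for f x
    using that spectral_map_cong[of E f "\<lambda>_. 1" x] spectral_map_one[OF on] by simp
  have r: "sqrt (s e) * sqrt (s e) = s e" "sqrt (s e) \<noteq> 0" "s e \<noteq> 0" if "e \<in> E" for e
    using pos[OF that] by auto
  have TW: "T (W x) = x" for x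
    unfolding T_def W_def spectral_map_compose[OF on] by (rule id) (use r in simp)
  have TAT: "T (A (T x)) = x" for x
    unfolding T_def AT spectral_map_compose[OF on] by (rule id) (use r in \<open>simp add: divide_simps\<close>)
  have ATT: "A (T (T x)) = x" for x
    unfolding T_def AT spectral_map_compose[OF on] by (rule id) (use r in \<open>simp add: divide_simps\<close>)
  have sT: "self_adjoint T" unfolding T_def by (rule self_adjoint_spectral_map)
  show ?thesis
  proof (rule that[OF sT _ _ TAT ATT])
    show "surj T" using TW by (metis surjI)
    show "T x \<bullet> A (T y) = x \<bullet> y" for x y using sT TAT[of y] by (simp add: self_adjoint_def)
  qed
qed

lemma self_adjoint_matrix:
  fixes A :: "real ^ 'n ^ 'n"
  assumes "transpose A = A"
  shows "self_adjoint ((*v) A)"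
  unfolding self_adjoint_def using assms
  by (metis dot_lmul_matrix matrix_vector_mul_linear transpose_matrix_vector)

lemma matrix_self_adjoint:
  fixes f :: "real ^ 'n \<Rightarrow> real ^ 'n"
  assumes "self_adjoint f"
  shows "transpose (matrix f) = matrix f" "matrix f *v x = f x"
proof -
  have lin: "linear f" and sym: "\<And>x y. f x \<bullet> y = x \<bullet> f y" using assms by (auto simp: self_adjoint_def)
  show "matrix f *v x = f x" for x using matrix_works[of f x] lin by (simp add: linear_matrix_vector_mul_eq)
  show "transpose (matrix f) = matrix f"
  proof (vector, simp add: matrix_def transpose_def, intro allI)
    fix i j
    show "f (axis i 1) $ j = f (axis j 1) $ i"
      using sym[of "axis i 1" "axis j 1"] by (simp add: inner_axis inner_axis' )
  qed
qed

lemma matrix_eqI_vector: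
  fixes A B :: "real ^ 'n ^ 'n"
  assumes "\<And>x. A *v x = B *v x"
  shows "A = B"
  using assms by (simp add: matrix_eq)

text \<open>On an eigenvector \<open>e\<close> of \<open>B\<close> with eigenvalue \<open>b > 0\<close>, the vector \<open>C e - b e\<close> would be an eigenvector
of \<open>C\<close> for the negative eigenvalue \<open>- b\<close>, hence vanishes; for \<open>b = 0\<close>, \<open>|C e|^2 = e \<bullet> C (C e) = 0\<close>.\<close>

lemma positive_semidefinite_sqrt_unique:
  fixes B C :: "real ^ 'n ^ 'n"
  assumes B: "positive_semidefinite B" and C: "positive_semidefinite C" and eq: "B ** B = C ** C"
  shows "B = C"
proof -
  have sB: "self_adjoint ((*v) B)" and sC: "self_adjoint ((*v) C)"
    using B C by (auto simp: positive_semidefinite_def intro: self_adjoint_matrix)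
  obtain E where E: "eigenbasis ((*v) B) E" using self_adjoint_eigenbasis[OF sB] .
  have on: "orthonormal_basis E" using E by (simp add: eigenbasis_def)
  have "C *v e = B *v e" if e: "e \<in> E" for e
  proof -
    define b where "b = e \<bullet> (B *v e)"
    have b0: "0 \<le> b" using B by (simp add: b_def positive_semidefinite_def)
    have Be: "B *v e = b *\<^sub>R e" using E e by (simp add: eigenbasis_def b_def)
    have "C *v (C *v e) = B *v (B *v e)" using eq by (simp add: matrix_vector_mul_assoc)
    also have "\<dots> = (b * b) *\<^sub>R e" by (simp add: Be matrix_vector_mult_scaleR)
    finally have CC: "C *v (C *v e) = (b * b) *\<^sub>R e" .
    have symC: "(C *v x) \<bullet> y = x \<bullet> (C *v y)" for x y using sC by (simp add: self_adjoint_def)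
    show ?thesis
    proof (cases "b = 0")
      case True
      then have "(C *v e) \<bullet> (C *v e) = 0" using CC symC[of e "C *v e"] by simp
      then show ?thesis using Be True by simp
    next
      case False
      let ?w = "C *v e - b *\<^sub>R e"
      have "C *v ?w = - b *\<^sub>R ?w"
        by (simp add: matrix_vector_mult_diff_distrib matrix_vector_mult_scaleR CC algebra_simps)
      then have "?w \<bullet> (C *v ?w) = - b * (?w \<bullet> ?w)" by simp
      moreover have "0 \<le> ?w \<bullet> (C *v ?w)" using C by (simp add: positive_semidefinite_def)
      ultimately have "b * (?w \<bullet> ?w) \<le> 0" by simp
      then have "?w \<bullet> ?w \<le> 0" using b0 False by (simp add: mult_le_0_iff)
      then have "?w \<bullet> ?w = 0" using inner_ge_zero[of ?w] by (rule antisym)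
      then show ?thesis using Be by simp
    qed
  qed
  then have "C *v x = B *v x" for x
  proof -
    assume *: "\<And>e. e \<in> E \<Longrightarrow> C *v e = B *v e"
    have "C *v (\<Sum>e\<in>E. (e \<bullet> x) *\<^sub>R e) = B *v (\<Sum>e\<in>E. (e \<bullet> x) *\<^sub>R e)"
      by (simp add: linear_sum[OF matrix_vector_mul_linear] matrix_vector_mult_scaleR *)
    then show ?thesis by (simp add: orthonormal_basis_sum[OF on])
  qed
  then show ?thesis by (intro matrix_eqI_vector) simp
qed

lemma norm_psd_sqrt:
  fixes A :: "real ^ 'n ^ 'n"
  assumes A: "positive_semidefinite A"
  shows "(norm (psd_sqrt A *v b))\<^sup>2 = b \<bullet> (A *v b)"
proof -
  have sA: "self_adjoint ((*v) A)"
    using A by (auto simp: positive_semidefinite_def intro: self_adjoint_matrix)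
  then have lin: "linear ((*v) A)" by (simp add: self_adjoint_def)
  obtain E where E: "eigenbasis ((*v) A) E" using self_adjoint_eigenbasis[OF sA] .
  have on: "orthonormal_basis E" using E by (simp add: eigenbasis_def)
  let ?s = "\<lambda>e. e \<bullet> (A *v e)"
  have s0: "0 \<le> ?s e" for e using A by (simp add: positive_semidefinite_def)
  define W where "W = spectral_map E (\<lambda>e. sqrt (?s e))"
  have sW: "self_adjoint W" unfolding W_def by (rule self_adjoint_spectral_map)
  note mW = matrix_self_adjoint[OF sW]
  have "0 \<le> v \<bullet> W v" for v
    unfolding W_def inner_spectral_map by (intro sum_nonneg mult_nonneg_nonneg[OF _ zero_le_square]) (simp add: s0)
  then have "positive_semidefinite (matrix W)"
    by (simp add: positive_semidefinite_def mW)
  moreover have "matrix W ** matrix W = A"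
  proof (rule matrix_eqI_vector)
    fix x
    have "W (W x) = spectral_map E ?s x"
      unfolding W_def spectral_map_compose[OF on] by (rule spectral_map_cong) (simp add: s0)
    then show "(matrix W ** matrix W) *v x = A *v x"
      using eigenbasis_spectral_map[OF lin E, of x] by (simp add: mW flip: matrix_vector_mul_assoc)
  qed
  ultimately have ex: "positive_semidefinite (psd_sqrt A) \<and> psd_sqrt A ** psd_sqrt A = A"
    unfolding psd_sqrt_def
    by (intro theI[of "\<lambda>B. positive_semidefinite B \<and> B ** B = A" "matrix W"])
      (auto intro: positive_semidefinite_sqrt_unique)
  then have "self_adjoint ((*v) (psd_sqrt A))"
    by (auto simp: positive_semidefinite_def intro: self_adjoint_matrix)
  then have "(norm (psd_sqrt A *v b))\<^sup>2 = b \<bullet> (psd_sqrt A *v (psd_sqrt A *v b))"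
    by (simp add: self_adjoint_def power2_norm_eq_inner)
  also have "\<dots> = b \<bullet> (A *v b)" using ex by (simp add: matrix_vector_mul_assoc)
  finally show ?thesis .
qed

section \<open>Excess risk of linear predictors\<close>

lemma l1_norm_nonneg: "0 \<le> l1_norm v"
  by (simp add: l1_norm_def sum_nonneg)

lemma l1_norm_scaleR: "l1_norm (c *\<^sub>R v) = \<bar>c\<bar> * l1_norm v"
  by (simp add: l1_norm_def abs_mult sum_distrib_left)

lemma l1_norm_triangle: "l1_norm (v + w) \<le> l1_norm v + l1_norm w"
  unfolding l1_norm_def sum.distrib[symmetric] by (intro sum_mono) simp

lemma l1_norm_restrict_scaleR:
  "l1_norm (restrict_vec J (t *\<^sub>R b)) = \<bar>t\<bar> * l1_norm (restrict_vec J b)"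
proof -
  have "restrict_vec J (t *\<^sub>R b) = t *\<^sub>R restrict_vec J b"
    by (simp add: restrict_vec_def vec_eq_iff)
  then show ?thesis by (simp add: l1_norm_scaleR)
qed

lemma abs_inner_le_l1:
  fixes x b :: "real ^ 'p"
  assumes "\<And>j. \<bar>x $ j\<bar> \<le> c"
  shows "\<bar>x \<bullet> b\<bar> \<le> c * l1_norm b"
proof -
  have "\<bar>x \<bullet> b\<bar> \<le> (\<Sum>j\<in>UNIV. \<bar>x $ j * b $ j\<bar>)"
    unfolding inner_vec_def by simp
  also have "\<dots> \<le> (\<Sum>j\<in>UNIV. c * \<bar>b $ j\<bar>)"
    using assms by (intro sum_mono) (simp add: abs_mult mult_right_mono)
  finally show ?thesis by (simp add: l1_norm_def sum_distrib_left)
qed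

lemma norm_le_of_components:
  fixes x :: "real ^ 'p"
  assumes "\<And>j. \<bar>x $ j\<bar> \<le> c"
  shows "(norm x)\<^sup>2 \<le> c\<^sup>2 * real CARD('p)"
proof -
  have "(norm x)\<^sup>2 = (\<Sum>j\<in>UNIV. (x $ j)\<^sup>2)"
    unfolding power2_norm_eq_inner by (simp add: inner_vec_def power2_eq_square)
  also have "\<dots> \<le> (\<Sum>j\<in>(UNIV :: 'p set). c\<^sup>2)"
  proof (intro sum_mono)
    fix j
    show "(x $ j)\<^sup>2 \<le> c\<^sup>2" using power_mono[OF assms[of j], of 2] by simp
  qed
  finally show ?thesis by (simp add: mult.commute)
qed

text \<open>Everything here concerns one pair of features and label: the risk as a quadratic function of the
coefficient vector, and bounds on its coefficients.\<close>

locale bounded_population = prob_space P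
  for P :: "((real ^ 'p) \<times> real) measure" +
  fixes fstar :: "real ^ 'p \<Rightarrow> real" and B_Y B_X :: real
  assumes sets_P: "sets P = sets borel"
    and regression: "regression_function P fstar"
    and normalized: "centered_normalized P"
    and bounded: "almost_surely_bounded P B_Y B_X"
begin

abbreviation "Sig \<equiv> second_moment_matrix P"
abbreviation "risk b \<equiv> excess_risk P fstar (linear_predictor b)"

definition cross_moment :: "real ^ 'p" where
  "cross_moment = (\<chi> j. \<integral>z. fst z $ j * snd z \<partial>P)"

lemma measurable_fst_P [measurable]: "fst \<in> borel_measurable P"
  and measurable_snd_P [measurable]: "snd \<in> borel_measurable P"
  and measurable_fstar [measurable]: "fstar \<in> borel_measurable borel"
proof -
  have "fst \<in> borel_measurable (borel :: ((real ^ 'p) \<times> real) measure)"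
    "snd \<in> borel_measurable (borel :: ((real ^ 'p) \<times> real) measure)"
    by (intro borel_measurable_continuous_onI continuous_intros)+
  then show "fst \<in> borel_measurable P" "snd \<in> borel_measurable P"
    using measurable_cong_sets[OF sets_P refl] by blast+
  show "fstar \<in> borel_measurable borel" using regression by (simp add: regression_function_def)
qed

lemma measurable_component_P [measurable]: "(\<lambda>z. fst z $ j) \<in> borel_measurable P"
  and measurable_inner_P [measurable]: "(\<lambda>z. fst z \<bullet> b) \<in> borel_measurable P"
  and measurable_fstar_P [measurable]: "(\<lambda>z. fstar (fst z)) \<in> borel_measurable P"
  by (simp_all add: cart_eq_inner_axis)

lemma AE_bounds: "AE z in P. \<bar>snd z\<bar> \<le> B_Y \<and> (\<forall>j. \<bar>fst z $ j\<bar> \<le> B_X)"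
  using bounded unfolding almost_surely_bounded_def
  by eventually_elim (auto intro: order_trans[OF Max_ge])

lemma integrable_of_AE_bounded:
  assumes "f \<in> borel_measurable P"
    and "\<And>z. \<bar>snd z\<bar> \<le> B_Y \<Longrightarrow> (\<And>j. \<bar>fst z $ j\<bar> \<le> B_X) \<Longrightarrow> \<bar>f z\<bar> \<le> (c :: real)"
  shows "integrable P f"
  by (rule integrable_const_bound[where B = c]) (use AE_bounds assms in auto)

lemma B_X_ge_1: "1 \<le> B_X" and B_Y_nonneg: "0 \<le> B_Y"
proof -
  fix j :: 'p
  have "\<exists>z :: (real ^ 'p) \<times> real. \<bar>snd z\<bar> \<le> B_Y \<and> (\<forall>j. \<bar>fst z $ j\<bar> \<le> B_X)"
  proof (rule ccontr)
    assume no: "\<not> ?thesis"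
    from AE_bounds have "AE z in P. False"
      by (rule eventually_mono) (use no in blast)
    then show False by simp
  qed
  then obtain z :: "(real ^ 'p) \<times> real" where z: "\<bar>snd z\<bar> \<le> B_Y" "\<bar>fst z $ j\<bar> \<le> B_X" by blast
  then show "0 \<le> B_Y" by linarith
  have BX: "0 \<le> B_X" using z(2) by linarith
  have "1 = (\<integral>z. (fst z $ j)\<^sup>2 \<partial>P)" using normalized by (simp add: centered_normalized_def)
  also have "\<dots> \<le> (\<integral>z. B_X\<^sup>2 \<partial>P)"
  proof (rule integral_mono_AE)
    show "integrable P (\<lambda>z. (fst z $ j)\<^sup>2)" using normalized by (simp add: centered_normalized_def)
    show "AE z in P. (fst z $ j)\<^sup>2 \<le> B_X\<^sup>2"
      using AE_bounds by eventually_elim (metis BX abs_le_square_iff abs_of_nonneg)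
  qed simp
  finally have "1 \<le> B_X\<^sup>2" by (simp add: prob_space)
  then show "1 \<le> B_X" using BX by (metis abs_le_square_iff abs_of_nonneg abs_one one_power2)
qed

lemma integrable_inner_products [intro, simp]:
  "integrable P (\<lambda>z. (fst z \<bullet> b) * (fst z \<bullet> c))"
  "integrable P (\<lambda>z. (fst z \<bullet> b) * snd z)"
  "integrable P (\<lambda>z. fst z \<bullet> b)"
proof -
  show "integrable P (\<lambda>z. (fst z \<bullet> b) * (fst z \<bullet> c))"
  proof (rule integrable_of_AE_bounded)
    fix z :: "(real ^ 'p) \<times> real" assume *: "\<And>j. \<bar>fst z $ j\<bar> \<le> B_X"
    have "0 \<le> B_X * l1_norm b" using B_X_ge_1 by (simp add: l1_norm_def sum_nonneg)
    then show "\<bar>(fst z \<bullet> b) * (fst z \<bullet> c)\<bar> \<le> (B_X * l1_norm b) * (B_X * l1_norm c)"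
      unfolding abs_mult by (intro mult_mono abs_inner_le_l1 *) auto
  qed measurable
  show "integrable P (\<lambda>z. (fst z \<bullet> b) * snd z)"
  proof (rule integrable_of_AE_bounded)
    fix z :: "(real ^ 'p) \<times> real" assume *: "\<And>j. \<bar>fst z $ j\<bar> \<le> B_X" and y: "\<bar>snd z\<bar> \<le> B_Y"
    have "0 \<le> B_X * l1_norm b" using B_X_ge_1 by (simp add: l1_norm_def sum_nonneg)
    then show "\<bar>(fst z \<bullet> b) * snd z\<bar> \<le> (B_X * l1_norm b) * B_Y"
      unfolding abs_mult by (intro mult_mono abs_inner_le_l1 * y) auto
  qed measurable
  show "integrable P (\<lambda>z. fst z \<bullet> b)"
    by (rule integrable_of_AE_bounded) (auto intro: abs_inner_le_l1)
qed

lemma integrable_component_products [intro, simp]: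
  "integrable P (\<lambda>z. fst z $ j * fst z $ k)" "integrable P (\<lambda>z. fst z $ j * snd z)"
  using integrable_inner_products(1)[of "axis j 1" "axis k 1"] integrable_inner_products(2)[of "axis j 1"]
  by (simp_all add: cart_eq_inner_axis)

lemma second_moment_form: "b \<bullet> (Sig *v c) = (\<integral>z. (fst z \<bullet> b) * (fst z \<bullet> c) \<partial>P)"
proof -
  have "(\<integral>z. (fst z \<bullet> b) * (fst z \<bullet> c) \<partial>P)
      = (\<integral>z. (\<Sum>j\<in>UNIV. \<Sum>k\<in>UNIV. b $ j * c $ k * (fst z $ j * fst z $ k)) \<partial>P)"
    unfolding inner_vec_def sum_product
    by (intro Bochner_Integration.integral_cong sum.cong refl) (simp add: mult_ac)
  also have "\<dots> = (\<Sum>j\<in>UNIV. \<Sum>k\<in>UNIV. b $ j * c $ k * (\<integral>z. fst z $ j * fst z $ k \<partial>P))"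
    by (simp add: Bochner_Integration.integral_sum)
  also have "\<dots> = b \<bullet> (Sig *v c)"
    unfolding inner_vec_def matrix_vector_mult_def second_moment_matrix_def sum_distrib_left vec_lambda_beta
    by (intro sum.cong refl) (simp add: sum_distrib_left mult_ac)
  finally show ?thesis by simp
qed

lemma second_moment_component: "(Sig *v c) $ j = (\<integral>z. fst z $ j * (fst z \<bullet> c) \<partial>P)"
  using second_moment_form[of "axis j 1" c] by (simp add: inner_axis inner_axis')

lemma cross_moment_form: "b \<bullet> cross_moment = (\<integral>z. (fst z \<bullet> b) * snd z \<partial>P)"
proof -
  have "(\<integral>z. (fst z \<bullet> b) * snd z \<partial>P) = (\<integral>z. (\<Sum>j\<in>UNIV. b $ j * (fst z $ j * snd z)) \<partial>P)"
    unfolding inner_vec_def sum_distrib_right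
    by (intro Bochner_Integration.integral_cong sum.cong refl) (simp add: mult_ac)
  also have "\<dots> = (\<Sum>j\<in>UNIV. b $ j * (\<integral>z. fst z $ j * snd z \<partial>P))"
    by (simp add: Bochner_Integration.integral_sum)
  finally show ?thesis by (simp add: inner_vec_def cross_moment_def)
qed

lemma transpose_second_moment: "transpose Sig = Sig"
  by (simp add: second_moment_matrix_def transpose_def mult.commute)

lemma second_moment_nonneg: "0 \<le> b \<bullet> (Sig *v b)"
  unfolding second_moment_form by (intro Bochner_Integration.integral_nonneg) simp

text \<open>By Hoelder, \<open>X \<bullet> b\<close> is bounded by \<open>B_X\<close> times the \<open>l1\<close> norm of \<open>b\<close>.\<close>

lemma second_moment_le_l1: "b \<bullet> (Sig *v b) \<le> (B_X * l1_norm b)\<^sup>2"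
proof -
  have "b \<bullet> (Sig *v b) \<le> (\<integral>z. (B_X * l1_norm b)\<^sup>2 \<partial>P)"
    unfolding second_moment_form
  proof (intro integral_mono_AE)
    show "AE z in P. (fst z \<bullet> b) * (fst z \<bullet> b) \<le> (B_X * l1_norm b)\<^sup>2"
      using AE_bounds
    proof eventually_elim
      case (elim z)
      then have "\<bar>fst z \<bullet> b\<bar>\<^sup>2 \<le> (B_X * l1_norm b)\<^sup>2"
        by (intro power_mono abs_inner_le_l1) auto
      then show ?case by (simp add: power2_eq_square)
    qed
  qed auto
  then show ?thesis by (simp add: prob_space)
qed

text \<open>The mean of \<open>Y (X \<bullet> b)\<close> is at most \<open>B_Y\<close> times the mean of \<open>|X \<bullet> b|\<close>, and that is at most the
root mean square.\<close>

lemma cross_moment_le: "b \<bullet> cross_moment \<le> B_Y * sqrt (b \<bullet> (Sig *v b))"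
proof -
  define r where "r = sqrt (b \<bullet> (Sig *v b))"
  have r2: "r\<^sup>2 = b \<bullet> (Sig *v b)" and r0: "0 \<le> r"
    using second_moment_nonneg by (auto simp: r_def)
  have int: "integrable P (\<lambda>z. \<bar>fst z \<bullet> b\<bar>)" by simp
  have abs_le: "(\<integral>z. \<bar>fst z \<bullet> b\<bar> \<partial>P) \<le> r"
  proof -
    have "(\<integral>z. \<bar>fst z \<bullet> b\<bar> \<partial>P)\<^sup>2 \<le> (\<integral>z. \<bar>fst z \<bullet> b\<bar>\<^sup>2 \<partial>P)"
    proof -
      have "integrable P (\<lambda>z. \<bar>fst z \<bullet> b\<bar>\<^sup>2)"
        using integrable_inner_products(1)[of b b] by (simp add: power2_eq_square)
      from variance_eq[OF int this] variance_positive[of "\<lambda>z. \<bar>fst z \<bullet> b\<bar>"]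
      show ?thesis by linarith
    qed
    also have "\<dots> = r\<^sup>2" unfolding r2 second_moment_form by (simp add: power2_eq_square)
    finally show ?thesis using r0 by (rule power2_le_imp_le)
  qed
  have "b \<bullet> cross_moment \<le> (\<integral>z. B_Y * \<bar>fst z \<bullet> b\<bar> \<partial>P)"
    unfolding cross_moment_form
  proof (intro integral_mono_AE)
    show "AE z in P. (fst z \<bullet> b) * snd z \<le> B_Y * \<bar>fst z \<bullet> b\<bar>"
      using AE_bounds
    proof eventually_elim
      case (elim z)
      have "(fst z \<bullet> b) * snd z \<le> \<bar>snd z\<bar> * \<bar>fst z \<bullet> b\<bar>"
        by (metis abs_ge_self abs_mult mult.commute)
      also have "\<dots> \<le> B_Y * \<bar>fst z \<bullet> b\<bar>" using elim by (intro mult_right_mono) auto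
      finally show ?case .
    qed
  qed auto
  also have "\<dots> = B_Y * (\<integral>z. \<bar>fst z \<bullet> b\<bar> \<partial>P)" by simp
  also have "\<dots> \<le> B_Y * r" by (intro mult_left_mono abs_le B_Y_nonneg)
  finally show ?thesis by (simp add: r_def)
qed

text \<open>The two properties of the regression function that the risk depends on: as a conditional
expectation it inherits the bound on the label, and it can be replaced by the label under the
integral against a function of the features.\<close>

lemma AE_fstar_bound: "AE z in P. \<bar>fstar (fst z)\<bar> \<le> B_Y"
  and integral_inner_fstar: "(\<integral>z. (fst z \<bullet> b) * fstar (fst z) \<partial>P) = b \<bullet> cross_moment"
proof -
  let ?F = "vimage_algebra (space P) fst (borel :: (real ^ 'p) measure)"
  have fstF [measurable]: "fst \<in> borel_measurable ?F"
    by (rule measurable_vimage_algebra1) simp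
  have "subalgebra P ?F"
    unfolding subalgebra_def using sets_image_in_sets[OF refl measurable_fst_P] by simp
  then interpret finite_measure_subalgebra P ?F
    by unfold_locales
  have int: "integrable P snd" using normalized by (simp add: centered_normalized_def)
  have reg: "AE z in P. fstar (fst z) = real_cond_exp P ?F snd z"
    using regression by (simp add: regression_function_def)
  have "AE z in P. real_cond_exp P ?F snd z \<le> B_Y"
    by (rule real_cond_exp_le_c[OF int]) (use AE_bounds in auto)
  moreover have "AE z in P. - B_Y \<le> real_cond_exp P ?F snd z"
  proof (rule real_cond_exp_ge_c[OF int])
    show "AE z in P. - B_Y \<le> snd z" using AE_bounds by eventually_elim (auto simp: abs_le_iff)
  qed
  ultimately show "AE z in P. \<bar>fstar (fst z)\<bar> \<le> B_Y"
    using reg by eventually_elim auto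
  have "(\<integral>z. (fst z \<bullet> b) * fstar (fst z) \<partial>P) = (\<integral>z. (fst z \<bullet> b) * real_cond_exp P ?F snd z \<partial>P)"
  proof (rule integral_cong_AE)
    show "AE z in P. fst z \<bullet> b * fstar (fst z) = fst z \<bullet> b * real_cond_exp P ?F snd z"
      using reg by eventually_elim simp
  qed measurable
  also have "\<dots> = (\<integral>z. (fst z \<bullet> b) * snd z \<partial>P)"
    by (rule real_cond_exp_intg(2)) auto
  finally show "(\<integral>z. (fst z \<bullet> b) * fstar (fst z) \<partial>P) = b \<bullet> cross_moment"
    by (simp add: cross_moment_form)
qed

lemma risk_integral: "risk b = (\<integral>z. (fst z \<bullet> b - fstar (fst z))\<^sup>2 \<partial>P)"
  unfolding excess_risk_def marginal_def linear_predictor_def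
  by (subst integral_distr) auto

lemma integrable_fstar [simp]:
  "integrable P (\<lambda>z. (fstar (fst z))\<^sup>2)" "integrable P (\<lambda>z. (fst z \<bullet> b) * fstar (fst z))"
proof -
  have "AE z in P. norm ((fstar (fst z))\<^sup>2) \<le> B_Y\<^sup>2"
    using AE_fstar_bound by eventually_elim (metis abs_le_square_iff abs_of_nonneg B_Y_nonneg real_norm_def zero_le_power2 abs_power2)
  then show "integrable P (\<lambda>z. (fstar (fst z))\<^sup>2)"
    by (rule integrable_const_bound) measurable
  have "AE z in P. norm ((fst z \<bullet> b) * fstar (fst z)) \<le> (B_X * l1_norm b) * B_Y"
    using AE_fstar_bound AE_bounds
  proof eventually_elim
    case (elim z)
    have "0 \<le> B_X * l1_norm b" using B_X_ge_1 by (simp add: l1_norm_def sum_nonneg)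
    then show ?case
      unfolding real_norm_def abs_mult using elim by (intro mult_mono abs_inner_le_l1) auto
  qed
  then show "integrable P (\<lambda>z. (fst z \<bullet> b) * fstar (fst z))"
    by (rule integrable_const_bound) measurable
qed

text \<open>The constant term is the same for all \<open>b\<close>, so differences of risks involve only the second moment
matrix and the cross moment.\<close>

lemma risk_quadratic:
  "risk b = b \<bullet> (Sig *v b) - 2 * (b \<bullet> cross_moment) + (\<integral>z. (fstar (fst z))\<^sup>2 \<partial>P)"
proof -
  have "risk b = (\<integral>z. (fst z \<bullet> b) * (fst z \<bullet> b) - 2 * ((fst z \<bullet> b) * fstar (fst z)) + (fstar (fst z))\<^sup>2 \<partial>P)"
    unfolding risk_integral
    by (intro Bochner_Integration.integral_cong refl) (simp add: power2_eq_square algebra_simps)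
  then show ?thesis by (simp add: integral_inner_fstar second_moment_form)
qed

lemma risk_nonneg: "0 \<le> risk b"
  unfolding risk_integral by (intro Bochner_Integration.integral_nonneg) simp

lemma risk_le_l1: "risk b \<le> 2 * (B_X * l1_norm b)\<^sup>2 + 2 * B_Y\<^sup>2"
proof -
  have int: "integrable P (\<lambda>z. 2 * ((fst z \<bullet> b) * (fst z \<bullet> b)) + 2 * (fstar (fst z))\<^sup>2)" by simp
  have "risk b \<le> (\<integral>z. 2 * ((fst z \<bullet> b) * (fst z \<bullet> b)) + 2 * (fstar (fst z))\<^sup>2 \<partial>P)"
    unfolding risk_integral
  proof (rule integral_mono_AE[OF _ int])
    show "integrable P (\<lambda>z. (fst z \<bullet> b - fstar (fst z))\<^sup>2)"
    proof -
      have *: "(\<lambda>z. (fst z \<bullet> b - fstar (fst z))\<^sup>2)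
          = (\<lambda>z. (fst z \<bullet> b) * (fst z \<bullet> b) - 2 * ((fst z \<bullet> b) * fstar (fst z)) + (fstar (fst z))\<^sup>2)"
        by (simp add: fun_eq_iff power2_eq_square algebra_simps)
      show ?thesis unfolding * by simp
    qed
    show "AE z in P. (fst z \<bullet> b - fstar (fst z))\<^sup>2 \<le> 2 * ((fst z \<bullet> b) * (fst z \<bullet> b)) + 2 * (fstar (fst z))\<^sup>2"
    proof (rule AE_I2)
      fix z
      have "0 \<le> (fst z \<bullet> b + fstar (fst z))\<^sup>2" by simp
      then show "(fst z \<bullet> b - fstar (fst z))\<^sup>2 \<le> 2 * ((fst z \<bullet> b) * (fst z \<bullet> b)) + 2 * (fstar (fst z))\<^sup>2"
        by (simp add: power2_eq_square algebra_simps)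
    qed
  qed
  also have "\<dots> = 2 * (b \<bullet> (Sig *v b)) + 2 * (\<integral>z. (fstar (fst z))\<^sup>2 \<partial>P)"
    by (simp add: second_moment_form)
  also have "(\<integral>z. (fstar (fst z))\<^sup>2 \<partial>P) \<le> (\<integral>z. B_Y\<^sup>2 \<partial>P)"
  proof (rule integral_mono_AE)
    show "AE z in P. (fstar (fst z))\<^sup>2 \<le> B_Y\<^sup>2"
      using AE_fstar_bound by eventually_elim (metis abs_le_square_iff abs_of_nonneg B_Y_nonneg)
  qed auto
  finally show ?thesis using second_moment_le_l1[of b] by (simp add: prob_space)
qed

end

section \<open>Deterministic analysis of the lasso\<close>

text \<open>Extracts the directional derivative from an inequality along a segment, without taking limits.\<close>

lemma nonneg_of_linear_perturbation:
  fixes c d :: real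
  assumes "\<And>s. 0 < s \<Longrightarrow> s \<le> 1 \<Longrightarrow> 0 \<le> 2 * c + s * d"
  shows "0 \<le> c"
proof (rule ccontr)
  assume "\<not> 0 \<le> c"
  define s where "s = min 1 (- c / (\<bar>d\<bar> + 1))"
  have s: "0 < s" "s \<le> 1" using \<open>\<not> 0 \<le> c\<close> by (auto simp: s_def divide_neg_pos)
  have "s * d \<le> s * (\<bar>d\<bar> + 1)" using s by (intro mult_left_mono) auto
  also have "\<dots> \<le> (- c / (\<bar>d\<bar> + 1)) * (\<bar>d\<bar> + 1)"
    by (intro mult_right_mono) (auto simp: s_def)
  also have "\<dots> = - c" by simp
  finally show False using assms[OF s] \<open>\<not> 0 \<le> c\<close> by linarith
qed

lemma symmetric_matrix_form:
  fixes A :: "real ^ 'p ^ 'p"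
  assumes "transpose A = A"
  shows "x \<bullet> (A *v y) = y \<bullet> (A *v x)"
proof -
  have "x \<bullet> (A *v y) = (transpose A *v x) \<bullet> y"
    by (simp only: transpose_matrix_vector dot_lmul_matrix)
  then show ?thesis by (simp only: assms inner_commute)
qed

text \<open>Minimality along the segment from \<open>bh\<close> to \<open>b\<close>, with the penalty bounded by convexity. Keeping only
the first order in the step size gives more than comparing the objective at \<open>bh\<close> and \<open>b\<close>: it
doubles the coefficient of the quadratic form in \<open>bh - b\<close>.\<close>

lemma lasso_first_order:
  fixes A :: "real ^ 'p ^ 'p"
  assumes sym: "transpose A = A" and "0 \<le> lam"
    and min: "\<And>b. bh \<bullet> (A *v bh) - 2 * (g \<bullet> bh) + 2 * lam * l1_norm bh
                  \<le> b \<bullet> (A *v b) - 2 * (g \<bullet> b) + 2 * lam * l1_norm b"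
  shows "(bh - b) \<bullet> (A *v bh) - g \<bullet> (bh - b) \<le> lam * (l1_norm b - l1_norm bh)"
proof -
  have symA: "x \<bullet> (A *v y) = y \<bullet> (A *v x)" for x y
    by (rule symmetric_matrix_form[OF sym])
  let ?w = "b - bh"
  have "0 \<le> ?w \<bullet> (A *v bh) - g \<bullet> ?w + lam * (l1_norm b - l1_norm bh)"
  proof (rule nonneg_of_linear_perturbation)
    fix s :: real assume s: "0 < s" "s \<le> 1"
    have e: "bh + s *\<^sub>R ?w = (1 - s) *\<^sub>R bh + s *\<^sub>R b" by (simp add: algebra_simps)
    have l1: "l1_norm (bh + s *\<^sub>R ?w) \<le> (1 - s) * l1_norm bh + s * l1_norm b"
      unfolding e using l1_norm_triangle[of "(1 - s) *\<^sub>R bh" "s *\<^sub>R b"] s by (simp add: l1_norm_scaleR)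
    have quad: "(bh + s *\<^sub>R ?w) \<bullet> (A *v (bh + s *\<^sub>R ?w))
        = bh \<bullet> (A *v bh) + 2 * s * (?w \<bullet> (A *v bh)) + s * s * (?w \<bullet> (A *v ?w))"
      using symA[of bh ?w]
      by (simp only: matrix_vector_right_distrib matrix_vector_mult_scaleR inner_add_left inner_add_right
          inner_scaleR_left inner_scaleR_right) (simp add: algebra_simps)
    have "lam * l1_norm (bh + s *\<^sub>R ?w) \<le> lam * ((1 - s) * l1_norm bh + s * l1_norm b)"
      by (intro mult_left_mono l1 assms)
    with min[of "bh + s *\<^sub>R ?w"]
    have "0 \<le> 2 * s * (?w \<bullet> (A *v bh)) + s * s * (?w \<bullet> (A *v ?w)) - 2 * s * (g \<bullet> ?w)
        + 2 * lam * (s * l1_norm b - s * l1_norm bh)"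
      unfolding quad inner_add_right[of g] inner_scaleR_right by (simp add: algebra_simps)
    also have "\<dots> = s * (2 * (?w \<bullet> (A *v bh) - g \<bullet> ?w + lam * (l1_norm b - l1_norm bh))
        + s * (?w \<bullet> (A *v ?w)))" by (simp add: algebra_simps)
    finally show "0 \<le> 2 * (?w \<bullet> (A *v bh) - g \<bullet> ?w + lam * (l1_norm b - l1_norm bh))
        + s * (?w \<bullet> (A *v ?w))" using s by (simp add: zero_le_mult_iff)
  qed
  then show ?thesis by (simp add: inner_diff_left inner_diff_right algebra_simps)
qed

lemma empirical_second_moment_form:
  "b \<bullet> (empirical_second_moment N x *v c) = (\<Sum>i=1..N. (x i \<bullet> b) * (x i \<bullet> c)) / real N"
proof -
  have "(\<Sum>i=1..N. (x i \<bullet> b) * (x i \<bullet> c)) / real N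
      = (\<Sum>i=1..N. \<Sum>j\<in>UNIV. \<Sum>k\<in>UNIV. b $ j * c $ k * (x i $ j * x i $ k) / real N)"
    unfolding inner_vec_def sum_product sum_divide_distrib
    by (intro sum.cong refl) (simp add: mult_ac)
  also have "\<dots> = (\<Sum>j\<in>UNIV. \<Sum>k\<in>UNIV. \<Sum>i=1..N. b $ j * c $ k * (x i $ j * x i $ k) / real N)"
    by (subst sum.swap, subst (2) sum.swap) simp
  also have "\<dots> = b \<bullet> (empirical_second_moment N x *v c)"
    unfolding inner_vec_def matrix_vector_mult_def empirical_second_moment_def sum_distrib_left vec_lambda_beta
    by (intro sum.cong refl) (simp add: sum_distrib_left sum_divide_distrib mult_ac)
  finally show ?thesis by simp
qed

lemma transpose_empirical_second_moment:
  "transpose (empirical_second_moment N x) = empirical_second_moment N x"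
  by (simp add: empirical_second_moment_def transpose_def mult.commute)

lemma positive_semidefinite_empirical:
  "positive_semidefinite (empirical_second_moment N x)"
  unfolding positive_semidefinite_def
  by (auto simp: transpose_empirical_second_moment empirical_second_moment_form intro!: divide_nonneg_nonneg sum_nonneg)

definition empirical_cross_moment :: "nat \<Rightarrow> (nat \<Rightarrow> real ^ 'p) \<Rightarrow> (nat \<Rightarrow> real) \<Rightarrow> real ^ 'p" where
  "empirical_cross_moment n x y = (1 / real n) *\<^sub>R (\<Sum>i=1..n. y i *\<^sub>R x i)"

lemma empirical_cross_moment_inner:
  "empirical_cross_moment n x y \<bullet> b = (\<Sum>i=1..n. y i * (x i \<bullet> b)) / real n"
  by (simp add: empirical_cross_moment_def inner_sum_left)

text \<open>The hypothesis \<open>foc\<close> is the first-order condition against the zero vector. The labeled data form a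
part of all the data, so for each labeled observation its cross term is compensated by its own
share of the quadratic form.\<close>

lemma lasso_crude_bound:
  fixes x :: "nat \<Rightarrow> real ^ 'p"
  assumes n: "1 \<le> n" "n < N" and y: "\<And>i. i \<in> {1..n} \<Longrightarrow> \<bar>y i\<bar> \<le> B"
    and foc: "bh \<bullet> (empirical_second_moment N x *v bh) - empirical_cross_moment n x y \<bullet> bh
                \<le> - lam * l1_norm bh"
  shows "lam * l1_norm bh \<le> real N * B\<^sup>2 / (4 * real n)"
proof -
  have N0: "0 < real N" "0 < real n" using n by auto
  have pt: "y i * (x i \<bullet> bh) / n - (x i \<bullet> bh)\<^sup>2 / N \<le> N * B\<^sup>2 / (4 * n\<^sup>2)" if "i \<in> {1..n}" for i
  proof -
    have "0 \<le> (N * y i / (2 * n) - x i \<bullet> bh)\<^sup>2 / N" using N0 by simp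
    also have "\<dots> = N * (y i)\<^sup>2 / (4 * n\<^sup>2) - y i * (x i \<bullet> bh) / n + (x i \<bullet> bh)\<^sup>2 / N"
      using N0 by (simp add: power2_eq_square field_simps)
    finally have "y i * (x i \<bullet> bh) / n - (x i \<bullet> bh)\<^sup>2 / N \<le> N * (y i)\<^sup>2 / (4 * n\<^sup>2)" by linarith
    also have "(y i)\<^sup>2 \<le> B\<^sup>2" using y[OF that] by (rule abs_le_square_iff[THEN iffD1, OF order_trans]) simp
    then have "N * (y i)\<^sup>2 / (4 * n\<^sup>2) \<le> N * B\<^sup>2 / (4 * n\<^sup>2)"
      by (intro divide_right_mono mult_left_mono) auto
    finally show ?thesis .
  qed
  have "lam * l1_norm bh \<le> (\<Sum>i=1..n. y i * (x i \<bullet> bh)) / n - (\<Sum>i=1..N. (x i \<bullet> bh)\<^sup>2) / N"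
    using foc unfolding empirical_second_moment_form empirical_cross_moment_inner by (simp add: power2_eq_square)
  also have "\<dots> \<le> (\<Sum>i=1..n. y i * (x i \<bullet> bh)) / n - (\<Sum>i=1..n. (x i \<bullet> bh)\<^sup>2) / N"
    using n by (intro diff_left_mono divide_right_mono sum_mono2) auto
  also have "\<dots> = (\<Sum>i=1..n. y i * (x i \<bullet> bh) / n - (x i \<bullet> bh)\<^sup>2 / N)"
    by (simp add: sum_subtractf sum_divide_distrib)
  also have "\<dots> \<le> (\<Sum>i=1..n. N * B\<^sup>2 / (4 * n\<^sup>2))" by (intro sum_mono pt)
  also have "\<dots> = real N * B\<^sup>2 / (4 * real n)" using N0 by (simp add: power2_eq_square)
  finally show ?thesis .
qed

text \<open>Coordinatewise: on \<open>J\<close> use \<open>|b| - |bh| \<le> |bh - b|\<close>, off \<open>J\<close> use \<open>|bh - b| \<le> |bh| + |b|\<close>.\<close>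

lemma lasso_l1_compare:
  fixes b bh :: "real ^ 'p" and J :: "'p set"
  shows "l1_norm (bh - b) + 2 * (l1_norm b - l1_norm bh)
     \<le> 3 * (\<Sum>j\<in>J. \<bar>(bh - b) $ j\<bar>) + 4 * l1_norm (restrict_vec (- J) b)"
proof -
  have "l1_norm (bh - b) + 2 * (l1_norm b - l1_norm bh)
      = (\<Sum>j\<in>UNIV. \<bar>(bh - b) $ j\<bar> + 2 * (\<bar>b $ j\<bar> - \<bar>bh $ j\<bar>))"
    by (simp add: l1_norm_def sum.distrib sum_subtractf sum_distrib_left)
  also have "\<dots> \<le> (\<Sum>j\<in>UNIV. 3 * (if j \<in> J then \<bar>(bh - b) $ j\<bar> else 0) + 4 * \<bar>restrict_vec (- J) b $ j\<bar>)"
    by (intro sum_mono) (auto simp: restrict_vec_def abs_if)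
  also have "\<dots> = 3 * (\<Sum>j\<in>J. \<bar>(bh - b) $ j\<bar>) + 4 * l1_norm (restrict_vec (- J) b)"
    by (simp add: sum.distrib l1_norm_def sum.If_cases flip: sum_distrib_left)
  finally show ?thesis .
qed

lemma sum_abs_subset_le:
  fixes u :: "real ^ 'p"
  shows "(\<Sum>j\<in>J. \<bar>u $ j\<bar>)\<^sup>2 \<le> card J * (norm u)\<^sup>2"
proof -
  have "(\<Sum>j\<in>J. \<bar>u $ j\<bar>)\<^sup>2 \<le> card J * (\<Sum>j\<in>J. \<bar>u $ j\<bar>\<^sup>2)"
    using Cauchy_Schwarz_ineq_sum[of "\<lambda>_. 1" "\<lambda>j. \<bar>u $ j\<bar>" J] by simp
  also have "\<dots> \<le> card J * (\<Sum>j\<in>UNIV. \<bar>u $ j\<bar>\<^sup>2)"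
    by (intro mult_left_mono sum_mono2) auto
  also have "(\<Sum>j\<in>UNIV. \<bar>u $ j\<bar>\<^sup>2) = (norm u)\<^sup>2"
    unfolding power2_norm_eq_inner by (simp add: inner_vec_def power2_eq_square)
  finally show ?thesis .
qed

lemma quadratic_tradeoff:
  fixes S Q m lam :: real
  assumes "S\<^sup>2 \<le> m * Q" "0 \<le> Q" "0 \<le> m"
  shows "3 * lam * S \<le> Q / 3 + 27 / 4 * lam\<^sup>2 * m"
proof -
  have "(3 * lam * S)\<^sup>2 = 9 * lam\<^sup>2 * S\<^sup>2" by (simp add: power_mult_distrib)
  also have "\<dots> \<le> 9 * lam\<^sup>2 * (m * Q)" using assms by (intro mult_left_mono) auto
  also have "\<dots> \<le> (Q / 3 + 27 / 4 * lam\<^sup>2 * m)\<^sup>2"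
  proof -
    have "0 \<le> (Q / 3 - 27 / 4 * lam\<^sup>2 * m)\<^sup>2" by simp
    then show ?thesis by (simp add: power2_eq_square field_simps)
  qed
  finally have "(3 * lam * S)\<^sup>2 \<le> (Q / 3 + 27 / 4 * lam\<^sup>2 * m)\<^sup>2" .
  moreover have "0 \<le> Q / 3 + 27 / 4 * lam\<^sup>2 * m" using assms(2,3) by simp
  ultimately show ?thesis by (rule power2_le_imp_le)
qed

text \<open>The deterministic core, for any symmetric \<open>Sg\<close> and any \<open>Sh\<close>. Of the factor \<open>2\<close> in front of the
quadratic form of \<open>Sh\<close>, hypothesis \<open>gram\<close> turns the whole into \<open>4/3\<close> of the form of \<open>Sg\<close>; one copy
cancels and a third is left to absorb the \<open>l1\<close> norm of \<open>bh - b\<close> on \<open>J\<close>.\<close>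

lemma restricted_oracle_inequality:
  fixes Sg Sh :: "real ^ 'p ^ 'p" and J :: "'p set"
  assumes symS: "transpose Sg = Sg"
    and foc: "(bh - b) \<bullet> (Sh *v bh) - g \<bullet> (bh - b) \<le> lam * (l1_norm b - l1_norm bh)"
    and gram: "2 / 3 * ((bh - b) \<bullet> (Sg *v (bh - b))) \<le> (bh - b) \<bullet> (Sh *v (bh - b))"
    and noise: "\<And>j. \<bar>(g - m + (Sg *v b - Sh *v b)) $ j\<bar> \<le> lam / 2"
    and eig: "(norm (bh - b))\<^sup>2 \<le> K * ((bh - b) \<bullet> (Sg *v (bh - b)))"
    and K: "0 \<le> K" and lam: "0 \<le> lam" and psd: "0 \<le> (bh - b) \<bullet> (Sg *v (bh - b))"
  shows "(bh \<bullet> (Sg *v bh) - 2 * (bh \<bullet> m))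
       \<le> (b \<bullet> (Sg *v b) - 2 * (b \<bullet> m)) + 4 * lam * l1_norm (restrict_vec (- J) b)
         + 27 * K / 4 * lam\<^sup>2 * card J"
proof -
  define u where "u = bh - b"
  define z where "z = g - m + (Sg *v b - Sh *v b)"
  define Q where "Q = u \<bullet> (Sg *v u)"
  have bh: "bh = b + u" by (simp add: u_def)
  have symA: "x \<bullet> (Sg *v y) = y \<bullet> (Sg *v x)" for x y
    by (rule symmetric_matrix_form[OF symS])
  have "(bh \<bullet> (Sg *v bh) - 2 * (bh \<bullet> m)) - (b \<bullet> (Sg *v b) - 2 * (b \<bullet> m))
      = 2 * (u \<bullet> (Sg *v b)) + Q - 2 * (u \<bullet> m)"
    using symA[of b u] by (simp add: bh Q_def matrix_vector_right_distrib inner_add_left inner_add_right)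
  also have "\<dots> = 2 * (u \<bullet> z) + 2 * (u \<bullet> (Sh *v b)) - 2 * (g \<bullet> u) + Q"
    by (simp add: z_def inner_add_right inner_diff_right inner_commute)
  also have "\<dots> \<le> 2 * (u \<bullet> z) + 2 * (lam * (l1_norm b - l1_norm bh)) - Q / 3"
  proof -
    have "u \<bullet> (Sh *v bh) = u \<bullet> (Sh *v b) + u \<bullet> (Sh *v u)"
      by (simp add: bh matrix_vector_right_distrib inner_add_right)
    then show ?thesis using foc gram unfolding u_def[symmetric] Q_def[symmetric] by linarith
  qed
  also have "2 * (u \<bullet> z) \<le> lam * l1_norm u"
  proof -
    have "u \<bullet> z \<le> (\<Sum>j\<in>UNIV. \<bar>u $ j\<bar> * (lam / 2))"
      unfolding inner_vec_def
    proof (intro sum_mono)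
      fix j
      have "(u $ j) \<bullet> (z $ j) \<le> \<bar>u $ j\<bar> * \<bar>z $ j\<bar>" by (simp add: flip: abs_mult)
      also have "\<dots> \<le> \<bar>u $ j\<bar> * (lam / 2)" using noise[of j] by (intro mult_left_mono) (auto simp: z_def)
      finally show "(u $ j) \<bullet> (z $ j) \<le> \<bar>u $ j\<bar> * (lam / 2)" .
    qed
    also have "\<dots> = l1_norm u * (lam / 2)" by (simp only: l1_norm_def sum_distrib_right)
    finally show ?thesis by (simp add: algebra_simps)
  qed
  also have "lam * l1_norm u + 2 * (lam * (l1_norm b - l1_norm bh)) - Q / 3
      = lam * (l1_norm u + 2 * (l1_norm b - l1_norm bh)) - Q / 3" by (simp add: algebra_simps)
  also have "\<dots> \<le> lam * (3 * (\<Sum>j\<in>J. \<bar>u $ j\<bar>) + 4 * l1_norm (restrict_vec (- J) b)) - Q / 3"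
    unfolding u_def by (intro diff_right_mono mult_left_mono lasso_l1_compare lam)
  also have "\<dots> = 3 * lam * (\<Sum>j\<in>J. \<bar>u $ j\<bar>) + 4 * lam * l1_norm (restrict_vec (- J) b) - Q / 3"
    by (simp add: algebra_simps)
  also have "3 * lam * (\<Sum>j\<in>J. \<bar>u $ j\<bar>) \<le> Q / 3 + 27 / 4 * lam\<^sup>2 * (card J * K)"
  proof (rule quadratic_tradeoff)
    have "(\<Sum>j\<in>J. \<bar>u $ j\<bar>)\<^sup>2 \<le> card J * (norm u)\<^sup>2" by (rule sum_abs_subset_le)
    also have "\<dots> \<le> card J * (K * Q)" using eig by (intro mult_left_mono) (auto simp: u_def Q_def)
    finally show "(\<Sum>j\<in>J. \<bar>u $ j\<bar>)\<^sup>2 \<le> card J * K * Q" by simp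
  qed (use K psd in \<open>auto simp: Q_def u_def\<close>)
  finally show ?thesis by (simp add: algebra_simps)
qed

text \<open>For \<open>q = b \<bullet> S b\<close> and \<open>c = b \<bullet> m\<close> this compares \<open>t b\<close> with \<open>b\<close>, where \<open>pen\<close> is the penalty. As a function
of \<open>t\<close>, the quadratic \<open>t^2 q - 2 t c\<close> has its minimum at \<open>c / q \<le> B / sqrt q\<close>, so it increases from
\<open>t = B / sqrt q\<close> to \<open>1\<close>.\<close>

lemma shrink_to_bounded_form:
  fixes q c B pen :: real
  assumes "0 \<le> q" "c \<le> B * sqrt q" "0 \<le> B" "0 \<le> pen"
  obtains t where "0 \<le> t" "t \<le> 1" "t\<^sup>2 * q \<le> B\<^sup>2" "t\<^sup>2 * q - 2 * (t * c) + t * pen \<le> q - 2 * c + pen"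
proof (cases "q \<le> B\<^sup>2")
  case True
  then show ?thesis using that[of 1] by simp
next
  case False
  define r where "r = sqrt q"
  have r: "q = r\<^sup>2" "0 \<le> r" unfolding r_def using assms(1) by simp_all
  have Br: "B < r" using False assms(3) r by (simp add: power2_less_imp_less)
  then have r0: "0 < r" using assms by linarith
  define t where "t = B / r"
  have t: "0 \<le> t" "t \<le> 1" "B = t * r" unfolding t_def using Br r0 assms(3) by simp_all
  show ?thesis
  proof (rule that[OF t(1,2)])
    show "t\<^sup>2 * q \<le> B\<^sup>2" unfolding r(1) by (subst t(3)) (simp add: power_mult_distrib)
    have "c \<le> t * r * r" using assms(2) unfolding r_def[symmetric] by (subst (asm) t(3))
    then have "(1 - t) * (2 * c) \<le> (1 - t) * (2 * (t * r * r))" using t by (intro mult_left_mono) auto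
    moreover have "t * pen \<le> pen" using t assms by (simp add: mult_left_le_one_le)
    moreover have "0 \<le> ((1 - t) * r)\<^sup>2" by simp
    ultimately show "t\<^sup>2 * q - 2 * (t * c) + t * pen \<le> q - 2 * c + pen"
      unfolding r(1) by (simp add: power2_eq_square algebra_simps)
  qed
qed

section \<open>Numerical estimates\<close>

lemma two_mult_le_exp: "2 * x \<le> exp (x :: real)"
proof -
  have "x \<le> exp (x - 1)" using exp_ge_add_one_self[of "x - 1"] by simp
  then have "exp 1 * x \<le> exp 1 * exp (x - 1)" by simp
  also have "\<dots> = exp x" by (simp flip: exp_add)
  finally have *: "exp 1 * x \<le> exp x" .
  show ?thesis
  proof (cases "0 \<le> x")
    case True
    have "2 \<le> exp (1 :: real)" using exp_ge_add_one_self[of 1] by simp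
    then have "2 * x \<le> exp 1 * x" using True by (rule mult_right_mono)
    then show ?thesis using * by linarith
  next
    case False
    then have "2 * x \<le> 0" by simp
    then show ?thesis using exp_ge_zero[of x] by linarith
  qed
qed

lemma log_factor_facts:
  fixes p N :: real
  assumes "1 \<le> p" "2 \<le> N"
  defines "L \<equiv> ln (6 * p * N\<^sup>2)" and "L' \<equiv> ln (3 * p * N\<^sup>2)"
  shows "1 \<le> L'" "L' \<le> L" "L \<le> L' + 1"
    "exp (- L) = 1 / (6 * p * N\<^sup>2)" "exp (- L') = 1 / (3 * p * N\<^sup>2)"
proof -
  have "2 * 2 \<le> N * N" using assms(2) by (intro mult_mono) auto
  then have N4: "4 \<le> N\<^sup>2" by (simp add: power2_eq_square)
  then have "1 * 4 \<le> p * N\<^sup>2" using assms(1) by (intro mult_mono) auto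
  then have pN: "12 \<le> 3 * p * N\<^sup>2" by simp
  have e3: "exp 1 \<le> (3 :: real)" using exp_le by simp
  show "exp (- L) = 1 / (6 * p * N\<^sup>2)" "exp (- L') = 1 / (3 * p * N\<^sup>2)"
    using pN by (simp_all add: L_def L'_def exp_minus exp_ln inverse_eq_divide)
  have "exp 1 \<le> 3 * p * N\<^sup>2" using e3 pN by linarith
  then have "ln (exp 1) \<le> L'" unfolding L'_def by (intro ln_mono) auto
  then show "1 \<le> L'" by simp
  show "L' \<le> L" unfolding L_def L'_def using pN by (intro ln_mono) auto
  have "2 \<le> exp (1 :: real)" using exp_ge_add_one_self[of 1] by simp
  then have "6 * p * N\<^sup>2 \<le> exp 1 * (3 * p * N\<^sup>2)"
    using pN mult_right_mono[of 2 "exp 1" "3 * p * N\<^sup>2"] by simp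
  also have "\<dots> = exp (L' + 1)" using pN by (simp add: L'_def exp_add exp_ln mult.commute)
  finally have "ln (6 * p * N\<^sup>2) \<le> ln (exp (L' + 1))" using pN by (intro ln_mono) auto
  then show "L \<le> L' + 1" by (simp add: L_def)
qed

text \<open>With \<open>N \<ge> 18 R L'\<close> for \<open>L' = ln (3 p N^2)\<close>, the exponent is at least \<open>18 * 46/750 = 1.104\<close> times \<open>L'\<close>. One copy of
\<open>L'\<close> yields \<open>1 / (3 p N^2)\<close>; the surplus, rounded down to \<open>L' / 10\<close>, is needed in \<open>bad_event_numeric\<close>.\<close>

lemma gram_tail_numeric:
  fixes p N R :: real
  assumes pN: "1 \<le> p" "2 \<le> N" and R: "0 < R" "18 * R * ln (3 * p * N\<^sup>2) \<le> N"
  shows "p * exp (- (41/50 - 2/3) * (2 / (5 * R)) * N) \<le> exp (- ln (3 * p * N\<^sup>2) / 10) / (3 * N\<^sup>2)"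
proof -
  define L' where "L' = ln (3 * p * N\<^sup>2)"
  have L': "1 \<le> L'" "exp (- L') = 1 / (3 * p * N\<^sup>2)"
    using log_factor_facts[OF pN] by (auto simp: L'_def)
  have "18 * L' \<le> N / R" using R by (simp add: L'_def field_simps)
  then have "- (46/750) * (N / R) \<le> - (46/750) * (18 * L')" by simp
  also have "\<dots> \<le> - L' + - L' / 10" using L' by simp
  finally have "- (41/50 - 2/3) * (2 / (5 * R)) * N \<le> - L' + - L' / 10" by simp
  then have "p * exp (- (41/50 - 2/3) * (2 / (5 * R)) * N) \<le> p * (exp (- L') * exp (- L' / 10))"
    using pN by (simp flip: exp_add)
  also have "\<dots> = exp (- L' / 10) / (3 * N\<^sup>2)" using pN L' by (simp add: field_simps)
  finally show ?thesis by (simp add: L'_def)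
qed

text \<open>The exceptional risk exceeds the target by a factor of order \<open>L = ln (6 p N^2)\<close>, and the surplus
exponential factors in the probability \<open>q\<close> absorb it: \<open>L * (q N^2) \<le> 4\<close>.\<close>

lemma bad_event_numeric:
  fixes p N n B q :: real
  assumes pN: "1 \<le> p" "2 \<le> N" and n: "0 < n" and q0: "0 \<le> q"
    and q: "q \<le> exp (- ln (3 * p * N\<^sup>2) / 10) / (3 * N\<^sup>2) + 2 * exp (- ln (6 * p * N\<^sup>2) / 3) / (3 * N\<^sup>2)"
  shows "q * (2 * B\<^sup>2 + B\<^sup>2 * N\<^sup>2 / (2 ^ 9 * n * ln (6 * p * N\<^sup>2)))
         \<le> 2 * B\<^sup>2 / N\<^sup>2 + B\<^sup>2 / (2 ^ 7 * n * (ln (6 * p * N\<^sup>2))\<^sup>2)"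
proof -
  define L where "L = ln (6 * p * N\<^sup>2)"
  define L' where "L' = ln (3 * p * N\<^sup>2)"
  have L: "1 \<le> L'" "L' \<le> L" "L \<le> L' + 1" using log_factor_facts[OF pN] by (auto simp: L_def L'_def)
  have N0: "0 < N\<^sup>2" using pN by simp
  have qN: "q * N\<^sup>2 \<le> exp (- L' / 10) / 3 + 2 * exp (- L / 3) / 3"
    using mult_right_mono[OF q, of "N\<^sup>2"] N0 by (simp add: L_def L'_def distrib_right)
  have "exp (- L' / 10) \<le> 1" "exp (- L / 3) \<le> 1" using L by auto
  then have q1: "q * N\<^sup>2 \<le> 1" using qN by linarith
  have a: "L * exp (- L' / 10) \<le> 6"
  proof -
    have "exp (1 / 10 :: real) \<le> 6 / 5" using exp_bound[of "1/10"] by (simp add: power2_eq_square)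
    have "L \<le> 5 * exp (L / 10)" using two_mult_le_exp[of "L / 10"] by simp
    also have "\<dots> \<le> 5 * exp (1 / 10 + L' / 10)" using L by simp
    also have "\<dots> = 5 * exp (1 / 10) * exp (L' / 10)" by (simp add: exp_add)
    also have "\<dots> \<le> 6 * exp (L' / 10)"
      using \<open>exp (1 / 10 :: real) \<le> 6 / 5\<close> by (intro mult_right_mono) auto
    finally have "L * exp (- L' / 10) \<le> (6 * exp (L' / 10)) * exp (- L' / 10)"
      by (intro mult_right_mono) auto
    also have "\<dots> = 6" by (simp flip: exp_add)
    finally show ?thesis .
  qed
  have b: "L * exp (- L / 3) \<le> 3 / 2"
  proof -
    have "L \<le> 3 / 2 * exp (L / 3)" using two_mult_le_exp[of "L / 3"] by simp
    then have "L * exp (- L / 3) \<le> (3 / 2 * exp (L / 3)) * exp (- L / 3)"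
      by (intro mult_right_mono) auto
    also have "\<dots> = 3 / 2" by (simp flip: exp_add)
    finally show ?thesis .
  qed
  have "L * (q * N\<^sup>2) \<le> L * (exp (- L' / 10) / 3 + 2 * exp (- L / 3) / 3)"
    using L by (intro mult_left_mono qN) auto
  also have "\<dots> = L * exp (- L' / 10) / 3 + 2 * (L * exp (- L / 3)) / 3" by (simp add: algebra_simps)
  also have "\<dots> \<le> 4" using a b by linarith
  finally have q2: "L * (q * N\<^sup>2) \<le> 4" .
  have "q * (2 * B\<^sup>2) = (q * N\<^sup>2) * (2 * B\<^sup>2 / N\<^sup>2)" using N0 by simp
  also have "\<dots> \<le> 1 * (2 * B\<^sup>2 / N\<^sup>2)" using q1 by (intro mult_right_mono) auto
  finally have t1: "q * (2 * B\<^sup>2) \<le> 2 * B\<^sup>2 / N\<^sup>2" by simp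
  have "q * (B\<^sup>2 * N\<^sup>2 / (2 ^ 9 * n * L)) = (L * (q * N\<^sup>2)) * (B\<^sup>2 / (2 ^ 9 * n * L\<^sup>2))"
    using L n by (simp add: power2_eq_square field_simps)
  also have "\<dots> \<le> 4 * (B\<^sup>2 / (2 ^ 9 * n * L\<^sup>2))"
    using q2 n by (intro mult_right_mono) auto
  also have "\<dots> = B\<^sup>2 / (2 ^ 7 * n * L\<^sup>2)" by simp
  finally show ?thesis using t1 by (simp add: L_def distrib_left)
qed

text \<open>The constants are \<open>sqrt (8/3) + 2 sqrt (4/3) < 4\<close>. This slack is what permits deviations at level
\<open>4 L / 3\<close> rather than \<open>L\<close>.\<close>

lemma noise_level_numeric:
  fixes B L n N lam :: real
  assumes "0 < n" "n \<le> N" "0 \<le> L" "0 \<le> B" and lam: "8 * B * sqrt (L / n) \<le> lam"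
  shows "B * sqrt (8 * L / (3 * n)) + 2 * B * sqrt (4 * L / (3 * N)) \<le> lam / 2"
proof -
  have "4 * L / (3 * N) \<le> 4 * L / (3 * n)" using assms by (intro divide_left_mono) auto
  then have "sqrt (4 * L / (3 * N)) \<le> sqrt (4/3) * sqrt (L / n)" by (simp flip: real_sqrt_mult)
  moreover have "sqrt (4/3) \<le> (29 / 25 :: real)" by (rule real_le_lsqrt) (auto simp: power2_eq_square)
  moreover have s0: "0 \<le> sqrt (L / n)" using assms by simp
  ultimately have a: "sqrt (4 * L / (3 * N)) \<le> 29 / 25 * sqrt (L / n)"
    by (meson mult_right_mono order_trans)
  have "sqrt (8 * L / (3 * n)) = sqrt (8/3) * sqrt (L / n)" by (simp flip: real_sqrt_mult)
  moreover have "sqrt (8/3) \<le> (41 / 25 :: real)" by (rule real_le_lsqrt) (auto simp: power2_eq_square)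
  ultimately have b: "sqrt (8 * L / (3 * n)) \<le> 41 / 25 * sqrt (L / n)"
    using s0 by (metis mult_right_mono)
  have "B * sqrt (8 * L / (3 * n)) + 2 * B * sqrt (4 * L / (3 * N))
      \<le> B * (41 / 25 * sqrt (L / n)) + 2 * B * (29 / 25 * sqrt (L / n))"
    using assms by (intro add_mono mult_left_mono a b) auto
  also have "\<dots> = 99 / 25 * (B * sqrt (L / n))" by simp
  also have "\<dots> \<le> 4 * (B * sqrt (L / n))" using assms s0 by (intro mult_right_mono mult_nonneg_nonneg) auto
  finally show ?thesis using lam by simp
qed

section \<open>Exceptional event and expected risk\<close>

text \<open>The quantity \<open>R\<close> introduced below bounds the squared norm of the whitened feature vector: the
factor \<open>B_X^2 p\<close> bounds the squared norm of the features, and \<open>K\<close> the effect of whitening.\<close>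

locale semi_supervised_setting = bounded_population P fstar B_Y B_X
  for P :: "((real ^ 'p) \<times> real) measure" and fstar B_Y B_X +
  fixes M :: "'w measure" and X :: "nat \<Rightarrow> 'w \<Rightarrow> real ^ 'p" and Y :: "nat \<Rightarrow> 'w \<Rightarrow> real"
    and n N :: nat
  assumes prob_M: "prob_space M"
    and sizes: "1 \<le> n" "n < N"
    and sample: "semi_supervised_sample M P n N X Y"
    and nonsingular: "invertible (second_moment_matrix P)"
begin

sublocale S: prob_space M by (rule prob_M)

abbreviation "K \<equiv> spectral_norm (matrix_inv Sig)"
abbreviation "R \<equiv> B_X\<^sup>2 * real CARD('p) * K"
abbreviation "Sh \<omega> \<equiv> empirical_second_moment N (\<lambda>i. X i \<omega>)"
abbreviation "gh \<omega> \<equiv> empirical_cross_moment n (\<lambda>i. X i \<omega>) (\<lambda>i. Y i \<omega>)"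

lemma measurable_fst_snd_borel [measurable]:
  "fst \<in> borel_measurable (borel :: ((real ^ 'p) \<times> real) measure)"
  "snd \<in> borel_measurable (borel :: ((real ^ 'p) \<times> real) measure)"
  by (intro borel_measurable_continuous_onI continuous_intros)+

lemma indep_pairs:
  "S.indep_vars (\<lambda>_. borel) (\<lambda>i \<omega>. (X i \<omega>, if i \<le> n then Y i \<omega> else 0)) {1..N}"
  using sample by (simp add: semi_supervised_sample_def)

lemma indep_X: "S.indep_vars (\<lambda>_. borel) X {1..N}"
  using S.indep_vars_compose2[OF indep_pairs, of "\<lambda>_. fst" "\<lambda>_. borel"] by simp

lemma measurable_X [measurable]: "i \<in> {1..N} \<Longrightarrow> X i \<in> borel_measurable M"
  using indep_X unfolding S.indep_vars_def by blast

lemma measurable_pair: "i \<in> {1..n} \<Longrightarrow> (\<lambda>\<omega>. (X i \<omega>, Y i \<omega>)) \<in> borel_measurable M"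
proof -
  assume i: "i \<in> {1..n}"
  then have "i \<in> {1..N}" using sizes by simp
  then have "(\<lambda>\<omega>. (X i \<omega>, if i \<le> n then Y i \<omega> else 0)) \<in> borel_measurable M"
    using indep_pairs unfolding S.indep_vars_def by blast
  then show ?thesis using i by simp
qed

lemma measurable_Y [measurable]: "i \<in> {1..n} \<Longrightarrow> Y i \<in> borel_measurable M"
  using measurable_compose[OF measurable_pair measurable_fst_snd_borel(2)] by simp

lemma distr_pair: "i \<in> {1..n} \<Longrightarrow> distr M borel (\<lambda>\<omega>. (X i \<omega>, Y i \<omega>)) = P"
  using sample by (simp add: semi_supervised_sample_def)

lemma distr_X: "i \<in> {1..N} \<Longrightarrow> distr M borel (X i) = marginal P"
proof (cases "i \<le> n")
  case True
  assume "i \<in> {1..N}"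
  with True have i: "i \<in> {1..n}" by simp
  have "marginal P = distr (distr M borel (\<lambda>\<omega>. (X i \<omega>, Y i \<omega>))) borel fst"
    by (simp add: marginal_def distr_pair[OF i])
  also have "\<dots> = distr M borel (X i)"
    by (subst distr_distr) (auto simp: comp_def measurable_pair[OF i])
  finally show ?thesis by simp
next
  case False
  assume "i \<in> {1..N}"
  with False have "i \<in> {n+1..N}" by simp
  then show ?thesis using sample by (simp add: semi_supervised_sample_def)
qed

lemma expectation_X:
  fixes f :: "real ^ 'p \<Rightarrow> real"
  assumes i: "i \<in> {1..N}" and [measurable]: "f \<in> borel_measurable borel"
  shows "S.expectation (\<lambda>\<omega>. f (X i \<omega>)) = (\<integral>z. f (fst z) \<partial>P)"
proof -
  have "S.expectation (\<lambda>\<omega>. f (X i \<omega>)) = (\<integral>x. f x \<partial>distr M borel (X i))"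
    using i by (subst integral_distr) auto
  also have "\<dots> = (\<integral>z. f (fst z) \<partial>P)"
    unfolding distr_X[OF i] marginal_def by (subst integral_distr) auto
  finally show ?thesis .
qed

lemma expectation_pair:
  fixes f :: "(real ^ 'p) \<times> real \<Rightarrow> real"
  assumes i: "i \<in> {1..n}" and f: "f \<in> borel_measurable borel"
  shows "S.expectation (\<lambda>\<omega>. f (X i \<omega>, Y i \<omega>)) = (\<integral>z. f z \<partial>P)"
  using integral_distr[OF measurable_pair[OF i] f] by (simp add: distr_pair[OF i])

lemma AE_X_bound:
  assumes i: "i \<in> {1..N}"
  shows "AE \<omega> in M. \<forall>j. \<bar>X i \<omega> $ j\<bar> \<le> B_X"
proof -
  have m: "{x \<in> space borel. \<forall>j. \<bar>x $ j\<bar> \<le> B_X} \<in> sets (borel :: (real ^ 'p) measure)" by measurable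
  have "AE z in P. \<forall>j. \<bar>fst z $ j\<bar> \<le> B_X" using AE_bounds by eventually_elim simp
  then have "AE x in marginal P. \<forall>j. \<bar>x $ j\<bar> \<le> B_X"
    unfolding marginal_def by (subst AE_distr_iff[OF measurable_fst_P m])
  then show ?thesis
    unfolding distr_X[OF i, symmetric] by (subst (asm) AE_distr_iff[OF measurable_X[OF i] m])
qed

lemma AE_Y_bound:
  assumes i: "i \<in> {1..n}"
  shows "AE \<omega> in M. \<bar>Y i \<omega>\<bar> \<le> B_Y"
proof -
  have m: "{z \<in> space borel. \<bar>snd z\<bar> \<le> B_Y} \<in> sets (borel :: ((real ^ 'p) \<times> real) measure)" by measurable
  have "AE z in P. \<bar>snd z\<bar> \<le> B_Y" using AE_bounds by eventually_elim simp
  then have "AE \<omega> in M. \<bar>snd (X i \<omega>, Y i \<omega>)\<bar> \<le> B_Y"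
    unfolding distr_pair[OF i, symmetric] by (subst (asm) AE_distr_iff[OF measurable_pair[OF i] m])
  then show ?thesis by simp
qed

lemma AE_Y_bounds: "AE \<omega> in M. \<forall>i\<in>{1..n}. \<bar>Y i \<omega>\<bar> \<le> B_Y"
  by (auto simp: AE_finite_all AE_Y_bound simp del: atLeastAtMost_iff)

lemma K_nonneg: "0 \<le> K"
  unfolding spectral_norm_def by (rule onorm_pos_le) simp

lemma whitening:
  obtains T where "self_adjoint T" "surj T" "\<And>x y. T x \<bullet> (Sig *v T y) = x \<bullet> y"
    "\<And>x. (norm (T x))\<^sup>2 \<le> K * (norm x)\<^sup>2"
proof -
  have inv: "matrix_inv Sig ** Sig = mat 1"
    using nonsingular unfolding matrix_inv_def invertible_def by (rule someI2_ex) blast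
  have "inj ((*v) Sig)"
  proof (rule injI)
    fix x y assume "Sig *v x = Sig *v y"
    then have "matrix_inv Sig *v (Sig *v x) = matrix_inv Sig *v (Sig *v y)" by simp
    then show "x = y" by (simp add: matrix_vector_mul_assoc inv)
  qed
  then obtain T where T: "self_adjoint T" "surj T" "\<And>x y. T x \<bullet> (Sig *v T y) = x \<bullet> y"
    "\<And>x. Sig *v T (T x) = x"
    using whitening_map[OF self_adjoint_matrix[OF transpose_second_moment] second_moment_nonneg] by metis
  have "(norm (T x))\<^sup>2 \<le> K * (norm x)\<^sup>2" for x
  proof -
    have "T (T x) = matrix_inv Sig *v (Sig *v T (T x))"
      by (simp only: matrix_vector_mul_assoc inv matrix_vector_mul_lid)
    then have TT: "T (T x) = matrix_inv Sig *v x" by (simp only: T(4))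
    have "(norm (T x))\<^sup>2 = x \<bullet> T (T x)"
      using T(1) by (simp add: power2_norm_eq_inner self_adjoint_def)
    also have "\<dots> \<le> norm x * norm (T (T x))" by (rule norm_cauchy_schwarz)
    also have "\<dots> \<le> norm x * (K * norm x)"
      unfolding TT spectral_norm_def by (intro mult_left_mono onorm) auto
    finally show ?thesis by (simp add: power2_eq_square mult_ac)
  qed
  then show ?thesis using that T by blast
qed

text \<open>The reciprocal of the spectral norm of the inverse is the smallest eigenvalue.\<close>

lemma norm_le_K_form: "(norm u)\<^sup>2 \<le> K * (u \<bullet> (Sig *v u))"
proof -
  obtain T where T: "self_adjoint T" "surj T" "\<And>x y. T x \<bullet> (Sig *v T y) = x \<bullet> y"
    "\<And>x. (norm (T x))\<^sup>2 \<le> K * (norm x)\<^sup>2" using whitening by blast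
  obtain w where u: "u = T w" using T(2) by (metis surjD)
  show ?thesis using T(4)[of w] by (simp add: u T(3) power2_norm_eq_inner)
qed

lemma K_pos: "0 < K"
proof -
  define u :: "real ^ 'p" where "u = axis undefined 1"
  have "u \<noteq> 0" by (simp add: u_def axis_eq_0_iff)
  then have "0 < (norm u)\<^sup>2" by simp
  then have "0 < K * (u \<bullet> (Sig *v u))" using norm_le_K_form[of u] by linarith
  then show ?thesis using second_moment_nonneg[of u] K_nonneg by (metis less_eq_real_def mult_zero_left)
qed

lemma R_pos: "0 < R" using K_pos B_X_ge_1 by simp

text \<open>Rescaling by \<open>sqrt \<theta>\<close> with \<open>\<theta> = 2 / (5 R)\<close> makes the squared norms of the whitened features at most \<open>2/5\<close>, as the
rank-one update requires. Markov's inequality then bounds the probability that the trace reaches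
\<open>exp (- 2/3 * \<theta> * N)\<close>.\<close>

lemma gram_event:
  obtains G where "G \<in> S.events"
    "S.prob G \<le> real CARD('p) * exp (- (41/50 - 2/3) * (2 / (5 * R)) * N)"
    "\<And>\<omega> u. \<omega> \<in> space M - G \<Longrightarrow> 2 / 3 * (u \<bullet> (Sig *v u)) \<le> u \<bullet> (Sh \<omega> *v u)"
proof -
  obtain T where T: "self_adjoint T" "surj T" "\<And>x y. T x \<bullet> (Sig *v T y) = x \<bullet> y"
    "\<And>x. (norm (T x))\<^sup>2 \<le> K * (norm x)\<^sup>2" using whitening by blast
  have symT: "T x \<bullet> y = x \<bullet> T y" and linT: "linear T" for x y using T(1) by (auto simp: self_adjoint_def)
  have mT [measurable]: "T \<in> borel_measurable borel"
    using linT by (intro borel_measurable_continuous_onI linear_continuous_on) (simp add: linear_conv_bounded_linear)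
  define \<theta> where "\<theta> = 2 / (5 * R)"
  have \<theta>: "0 < \<theta>" using R_pos by (simp add: \<theta>_def)
  define V where "V = (\<lambda>i \<omega>. sqrt \<theta> *\<^sub>R T (X i \<omega>))"
  define t where "t = (\<lambda>\<omega>. exp_trace (gram (\<lambda>i. V i \<omega>) {1..N}))"
  have mV [measurable]: "i \<in> {1..N} \<Longrightarrow> V i \<in> borel_measurable M" for i unfolding V_def by measurable
  have indV: "S.indep_vars (\<lambda>_. borel) V {1..N}"
    unfolding V_def by (rule S.indep_vars_compose2[OF indep_X]) measurable
  have psd: "0 \<le> x \<bullet> gram W J x" for x :: "real ^ 'p" and W and J :: "nat set"
    unfolding gram_quadratic by (intro sum_nonneg) simp
  have mt [measurable]: "t \<in> borel_measurable M"
    unfolding t_def exp_trace_def by (intro borel_measurable_sum measurable_exp_form_gram mV)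
  have intt: "integrable M t"
    unfolding t_def exp_trace_def
    by (intro Bochner_Integration.integrable_sum S.integrable_const_bound[where B = 1] AE_I2)
      (auto intro!: order_trans[OF abs_exp_form_le] self_adjoint_gram psd measurable_exp_form_gram mV)
  have Et: "S.expectation t \<le> real DIM(real ^ 'p) * exp (- (41/50 * \<theta> * card {1..N}))"
    unfolding t_def
  proof (rule S.expectation_exp_trace_gram_le[OF _ indV])
    fix i assume i: "i \<in> {1..N}"
    show "AE \<omega> in M. (norm (V i \<omega>))\<^sup>2 \<le> 2 / 5"
      using AE_X_bound[OF i]
    proof eventually_elim
      case (elim \<omega>)
      have "(norm (V i \<omega>))\<^sup>2 = \<theta> * (norm (T (X i \<omega>)))\<^sup>2"
        using \<theta> by (simp add: V_def power_mult_distrib)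
      also have "\<dots> \<le> \<theta> * (K * (B_X\<^sup>2 * real CARD('p)))"
        using elim \<theta> K_nonneg by (intro mult_left_mono order_trans[OF T(4)] norm_le_of_components) auto
      also have "\<dots> = 2 / 5" using K_pos B_X_ge_1 by (simp add: \<theta>_def)
      finally show ?case .
    qed
    fix x y :: "real ^ 'p"
    have "S.expectation (\<lambda>\<omega>. (V i \<omega> \<bullet> x) * (V i \<omega> \<bullet> y))
        = S.expectation (\<lambda>\<omega>. \<theta> * ((X i \<omega> \<bullet> T x) * (X i \<omega> \<bullet> T y)))"
      using \<theta> by (intro Bochner_Integration.integral_cong refl) (simp add: V_def symT mult_ac)
    also have "\<dots> = \<theta> * (\<integral>z. (fst z \<bullet> T x) * (fst z \<bullet> T y) \<partial>P)"
      using expectation_X[OF i, of "\<lambda>v. (v \<bullet> T x) * (v \<bullet> T y)"] by simp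
    also have "\<dots> = \<theta> * (x \<bullet> y)" by (simp add: T(3) flip: second_moment_form)
    finally show "S.expectation (\<lambda>\<omega>. (V i \<omega> \<bullet> x) * (V i \<omega> \<bullet> y)) = \<theta> * (x \<bullet> y)" .
  qed simp
  define c where "c = 2 / 3 * \<theta> * N"
  define G where "G = {\<omega> \<in> space M. exp (- c) \<le> t \<omega>}"
  show ?thesis
  proof (rule that)
    show "G \<in> S.events" unfolding G_def by measurable
    have "S.prob G \<le> S.expectation t / exp (- c)"
      unfolding G_def
      by (rule integral_Markov_inequality_measure[OF intt])
        (auto simp: t_def intro!: exp_trace_nonneg self_adjoint_gram)
    also have "\<dots> \<le> (real CARD('p) * exp (- (41/50 * \<theta> * N))) / exp (- c)"
      using Et by (intro divide_right_mono) auto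
    also have "\<dots> = real CARD('p) * exp (- (41/50 - 2/3) * \<theta> * N)"
    proof -
      have "exp (- (41/50 * \<theta> * N)) / exp (- c) = exp (- (41/50 - 2/3) * \<theta> * N)"
        by (subst exp_diff[symmetric]) (simp add: c_def algebra_simps)
      then show ?thesis by (simp only: times_divide_eq_right[symmetric])
    qed
    finally show "S.prob G \<le> real CARD('p) * exp (- (41/50 - 2/3) * (2 / (5 * R)) * N)"
      by (simp add: \<theta>_def)
    fix \<omega> u assume "\<omega> \<in> space M - G"
    then have less: "t \<omega> < exp (- c)" by (auto simp: G_def not_le)
    obtain w where u: "u = T w" using T(2) by (metis surjD)
    have "c * (norm w)\<^sup>2 \<le> w \<bullet> gram (\<lambda>i. V i \<omega>) {1..N} w"
      by (rule exp_trace_less_imp_form_ge[OF self_adjoint_gram]) (use less in \<open>simp add: t_def\<close>)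
    also have "\<dots> = (\<Sum>i=1..N. \<theta> * ((X i \<omega> \<bullet> u) * (X i \<omega> \<bullet> u)))"
      unfolding gram_quadratic using \<theta>
      by (intro sum.cong refl) (simp add: V_def symT u power_mult_distrib power2_eq_square[of "_ \<bullet> _"])
    also have "\<dots> = \<theta> * N * (u \<bullet> (Sh \<omega> *v u))"
      using sizes by (simp add: empirical_second_moment_form flip: sum_distrib_left)
    also have "(norm w)\<^sup>2 = u \<bullet> (Sig *v u)" by (simp add: u T(3) power2_norm_eq_inner)
    finally have "\<theta> * N * (2 / 3 * (u \<bullet> (Sig *v u))) \<le> \<theta> * N * (u \<bullet> (Sh \<omega> *v u))"
      by (simp add: c_def mult_ac)
    then show "2 / 3 * (u \<bullet> (Sig *v u)) \<le> u \<bullet> (Sh \<omega> *v u)"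
      using \<theta> sizes by (simp add: mult_le_cancel_left_pos)
  qed
qed

lemma cross_moment_deviation:
  assumes "0 < B_Y" "0 \<le> t"
  shows "S.prob {\<omega> \<in> space M. B_X * B_Y * sqrt (2 * t / n) \<le> \<bar>(gh \<omega> - cross_moment) $ j\<bar>} \<le> 2 * exp (- t)"
proof -
  define B where "B = B_X * B_Y"
  have B: "0 < B" using assms B_X_ge_1 by (simp add: B_def)
  have n0: "0 < real n" using sizes by simp
  define W where "W = (\<lambda>i \<omega>. X i \<omega> $ j * Y i \<omega>)"
  define \<epsilon> where "\<epsilon> = n * (B * sqrt (2 * t / n))"
  have "S.indep_vars (\<lambda>_. borel) (\<lambda>i \<omega>. (X i \<omega>, if i \<le> n then Y i \<omega> else 0)) {1..n}"
    using sizes by (intro S.indep_vars_subset[OF indep_pairs]) auto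
  then have "S.indep_vars (\<lambda>_. borel) (\<lambda>i \<omega>. fst (X i \<omega>, if i \<le> n then Y i \<omega> else 0) $ j
      * snd (X i \<omega>, if i \<le> n then Y i \<omega> else 0)) {1..n}"
    by (rule S.indep_vars_compose2) (simp add: cart_eq_inner_axis)
  then have ind: "S.indep_vars (\<lambda>_. borel) W {1..n}"
    by (rule S.indep_vars_cong[THEN iffD1, rotated -1]) (auto simp: W_def)
  have EW: "S.expectation (W i) = cross_moment $ j" if "i \<in> {1..n}" for i
  proof -
    have "(\<lambda>z. fst z $ j * snd z) \<in> borel_measurable (borel :: ((real ^ 'p) \<times> real) measure)"
      by (simp add: cart_eq_inner_axis)
    from expectation_pair[OF that this] show ?thesis by (simp add: W_def cross_moment_def)
  qed
  have "S.prob {\<omega> \<in> space M. \<epsilon> \<le> \<bar>(\<Sum>i=1..n. W i \<omega>) - (\<Sum>i=1..n. S.expectation (W i))\<bar>}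
       \<le> 2 * exp (- \<epsilon>\<^sup>2 / (2 * card {1..n} * B\<^sup>2))"
  proof (rule S.hoeffding_two_sided[OF _ _ ind _ B])
    fix i assume i: "i \<in> {1..n}"
    then have i': "i \<in> {1..N}" using sizes by simp
    show "AE \<omega> in M. \<bar>W i \<omega>\<bar> \<le> B"
      using AE_X_bound[OF i'] AE_Y_bound[OF i]
      by eventually_elim (use B_X_ge_1 in \<open>auto simp: W_def B_def abs_mult intro!: mult_mono\<close>)
  qed (use sizes B assms in \<open>auto simp: \<epsilon>_def\<close>)
  also have "- \<epsilon>\<^sup>2 / (2 * card {1..n} * B\<^sup>2) = - t"
    using B n0 assms by (simp add: \<epsilon>_def power_mult_distrib power2_eq_square[of "real n"])
  also have "{\<omega> \<in> space M. \<epsilon> \<le> \<bar>(\<Sum>i=1..n. W i \<omega>) - (\<Sum>i=1..n. S.expectation (W i))\<bar>}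
      = {\<omega> \<in> space M. B_X * B_Y * sqrt (2 * t / n) \<le> \<bar>(gh \<omega> - cross_moment) $ j\<bar>}"
  proof -
    have "(\<Sum>i=1..n. S.expectation (W i)) = (\<Sum>i=1..n. cross_moment $ j)"
      by (intro sum.cong refl EW)
    then have "(\<Sum>i=1..n. W i \<omega>) - (\<Sum>i=1..n. S.expectation (W i)) = n * ((gh \<omega> - cross_moment) $ j)" for \<omega>
      using n0 by (simp add: empirical_cross_moment_def W_def right_diff_distrib mult.commute)
    then show ?thesis
      using n0 by (simp add: \<epsilon>_def abs_mult B_def[symmetric] mult_le_cancel_left_pos)
  qed
  finally show ?thesis .
qed

text \<open>The summands \<open>X i $ j * (X i \<bullet> b)\<close> have second moment at most \<open>(B_X B_Y)^2\<close>, but they are only bounded by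
\<open>B_X B_Y sqrt R\<close>, so Hoeffding's inequality would lose a factor \<open>sqrt R\<close>. The condition \<open>t R \<le> N\<close>
keeps the optimal exponent \<open>s = sqrt (t / N) / (B_X B_Y)\<close> admissible in the Bernstein bound.\<close>

lemma design_deviation:
  assumes "0 < B_Y" "0 < t" "t * R \<le> N" and b: "b \<bullet> (Sig *v b) \<le> B_Y\<^sup>2"
  shows "S.prob {\<omega> \<in> space M. 2 * (B_X * B_Y) * sqrt (t / N) \<le> \<bar>(Sig *v b - Sh \<omega> *v b) $ j\<bar>} \<le> 2 * exp (- t)"
proof -
  define B where "B = B_X * B_Y"
  have B: "0 < B" using assms B_X_ge_1 by (simp add: B_def)
  have N0: "0 < real N" using sizes by simp
  define W where "W = (\<lambda>i \<omega>. X i \<omega> $ j * (X i \<omega> \<bullet> b))"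
  define \<epsilon> where "\<epsilon> = N * (2 * B * sqrt (t / N))"
  define s where "s = sqrt (t / N) / B"
  have ind: "S.indep_vars (\<lambda>_. borel) W {1..N}"
    unfolding W_def by (rule S.indep_vars_compose2[OF indep_X]) (simp add: cart_eq_inner_axis)
  have EW: "S.expectation (W i) = (Sig *v b) $ j" if "i \<in> {1..N}" for i
  proof -
    have "(\<lambda>x. x $ j * (x \<bullet> b)) \<in> borel_measurable (borel :: (real ^ 'p) measure)"
      by (simp add: cart_eq_inner_axis)
    from expectation_X[OF that this] show ?thesis by (simp add: W_def second_moment_component)
  qed
  obtain T where T: "self_adjoint T" "surj T" "\<And>x y. T x \<bullet> (Sig *v T y) = x \<bullet> y"
    "\<And>x. (norm (T x))\<^sup>2 \<le> K * (norm x)\<^sup>2" using whitening by blast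
  obtain w where w: "b = T w" using T(2) by (metis surjD)
  have nw: "norm w \<le> B_Y"
    using b assms(1) by (intro power2_le_imp_le[of "norm w" B_Y]) (simp_all add: w T(3) power2_norm_eq_inner)
  have xb: "\<bar>x \<bullet> b\<bar> \<le> sqrt R * B_Y" if "\<And>j. \<bar>x $ j\<bar> \<le> B_X" for x :: "real ^ 'p"
  proof -
    have "(norm (T x))\<^sup>2 \<le> K * (B_X\<^sup>2 * real CARD('p))"
      using that K_nonneg by (intro order_trans[OF T(4)] mult_left_mono norm_le_of_components)
    then have nT: "norm (T x) \<le> sqrt R" by (intro real_le_rsqrt) (simp add: mult_ac)
    have "x \<bullet> b = T x \<bullet> w" using T(1) by (simp add: w self_adjoint_def)
    then have "\<bar>x \<bullet> b\<bar> \<le> norm (T x) * norm w" by (simp add: Cauchy_Schwarz_ineq2)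
    also have "\<dots> \<le> sqrt R * B_Y" using R_pos by (intro mult_mono nT nw) auto
    finally show ?thesis .
  qed
  have "S.prob {\<omega> \<in> space M. \<epsilon> \<le> \<bar>(\<Sum>i=1..N. W i \<omega>) - (\<Sum>i=1..N. S.expectation (W i))\<bar>}
       \<le> 2 * exp (s\<^sup>2 * B\<^sup>2 * card {1..N} - s * \<epsilon>)"
  proof (rule S.bernstein_two_sided[OF _ ind])
    fix i assume i: "i \<in> {1..N}"
    show "AE \<omega> in M. \<bar>W i \<omega>\<bar> \<le> B_X * (sqrt R * B_Y)"
      using AE_X_bound[OF i]
      by eventually_elim (use B_X_ge_1 xb in \<open>auto simp: W_def abs_mult intro!: mult_mono\<close>)
    have "S.expectation (\<lambda>\<omega>. (W i \<omega>)\<^sup>2) = (\<integral>z. (fst z $ j)\<^sup>2 * ((fst z \<bullet> b) * (fst z \<bullet> b)) \<partial>P)"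
      using expectation_X[OF i, of "\<lambda>x. (x $ j * (x \<bullet> b))\<^sup>2"]
      by (simp add: W_def cart_eq_inner_axis power2_eq_square mult_ac)
    also have "\<dots> \<le> (\<integral>z. B_X\<^sup>2 * ((fst z \<bullet> b) * (fst z \<bullet> b)) \<partial>P)"
    proof (rule integral_mono_AE')
      show "AE z in P. (fst z $ j)\<^sup>2 * ((fst z \<bullet> b) * (fst z \<bullet> b)) \<le> B_X\<^sup>2 * ((fst z \<bullet> b) * (fst z \<bullet> b))"
        using AE_bounds
      proof eventually_elim
        case (elim z)
        then have "\<bar>fst z $ j\<bar>\<^sup>2 \<le> B_X\<^sup>2" by (intro power_mono) auto
        then show ?case by (intro mult_right_mono) auto
      qed
    qed auto
    also have "\<dots> = B_X\<^sup>2 * (b \<bullet> (Sig *v b))" by (simp add: second_moment_form)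
    also have "\<dots> \<le> B\<^sup>2" using b by (simp add: B_def power_mult_distrib mult_left_mono)
    finally show "S.expectation (\<lambda>\<omega>. (W i \<omega>)\<^sup>2) \<le> B\<^sup>2" .
  next
    show "0 < s" using B N0 assms by (simp add: s_def)
    have "s * (B_X * (sqrt R * B_Y)) = sqrt (t / N) * sqrt R" using assms(1) B_X_ge_1 by (simp add: s_def B_def)
    also have "\<dots> = sqrt (t * R / N)" by (simp flip: real_sqrt_mult)
    also have "\<dots> \<le> 1" using assms N0 by simp
    finally show "s * (B_X * (sqrt R * B_Y)) \<le> 1" .
  qed auto
  also have "s\<^sup>2 * B\<^sup>2 * card {1..N} - s * \<epsilon> = - t"
  proof -
    define a where "a = sqrt (t / N)"
    have a: "a\<^sup>2 = t / N" using assms N0 by (simp add: a_def)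
    have "s\<^sup>2 * B\<^sup>2 = a\<^sup>2" "s * \<epsilon> = 2 * N * a\<^sup>2"
      using B unfolding s_def \<epsilon>_def a_def[symmetric] by (simp_all add: power_divide power2_eq_square)
    then show ?thesis using N0 by (simp add: a)
  qed
  also have "{\<omega> \<in> space M. \<epsilon> \<le> \<bar>(\<Sum>i=1..N. W i \<omega>) - (\<Sum>i=1..N. S.expectation (W i))\<bar>}
      = {\<omega> \<in> space M. 2 * (B_X * B_Y) * sqrt (t / N) \<le> \<bar>(Sig *v b - Sh \<omega> *v b) $ j\<bar>}"
  proof -
    have "(Sh \<omega> *v b) $ j = (\<Sum>i=1..N. W i \<omega>) / N" for \<omega>
      using empirical_second_moment_form[of "axis j 1" N "\<lambda>i. X i \<omega>" b]
      by (simp add: W_def inner_axis inner_axis')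
    moreover have "(\<Sum>i=1..N. S.expectation (W i)) = (\<Sum>i=1..N. (Sig *v b) $ j)"
      by (intro sum.cong refl EW)
    ultimately have "(\<Sum>i=1..N. W i \<omega>) - (\<Sum>i=1..N. S.expectation (W i))
        = - (N * ((Sig *v b - Sh \<omega> *v b) $ j))" for \<omega>
      using N0 by (simp add: right_diff_distrib)
    then have "\<bar>(\<Sum>i=1..N. W i \<omega>) - (\<Sum>i=1..N. S.expectation (W i))\<bar> = N * \<bar>(Sig *v b - Sh \<omega> *v b) $ j\<bar>" for \<omega>
      by (simp add: abs_mult)
    then show ?thesis
      using N0 by (simp add: \<epsilon>_def B_def[symmetric] mult_le_cancel_left_pos)
  qed
  finally show ?thesis .
qed

end

lemma ss_lasso_objective_eq:
  "ss_lasso_objective n N x y lam b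
     = b \<bullet> (empirical_second_moment N x *v b) - 2 * (empirical_cross_moment n x y \<bullet> b) + 2 * lam * l1_norm b"
  by (simp add: ss_lasso_objective_def norm_psd_sqrt[OF positive_semidefinite_empirical]
      empirical_cross_moment_inner)

abbreviation (input) log_level :: "real \<Rightarrow> nat \<Rightarrow> nat \<Rightarrow> real" where
  "log_level a d N \<equiv> ln (a * real d * (real N)\<^sup>2)"

context semi_supervised_setting
begin

lemma card_ge_1: "1 \<le> real CARD('p)" and N_ge_2: "2 \<le> real N"
proof -
  have "CARD('p) \<noteq> 0" by simp
  then show "1 \<le> real CARD('p)" by linarith
  show "2 \<le> real N" using sizes by linarith
qed

lemmas log_facts = log_factor_facts[OF card_ge_1 N_ge_2]

lemma log_level_pos: "0 < log_level 6 CARD('p) N"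
  using log_facts(1,2) by linarith

lemma measurable_gh: "(\<lambda>\<omega>. (gh \<omega> - cross_moment) $ j) \<in> borel_measurable M"
proof -
  have c: "(\<lambda>\<omega>. X i \<omega> $ j) \<in> borel_measurable M" if "i \<in> {1..n}" for i
    using measurable_X[of i] that sizes by (simp add: cart_eq_inner_axis)
  have "(\<lambda>\<omega>. Y i \<omega> * X i \<omega> $ j) \<in> borel_measurable M" if "i \<in> {1..n}" for i
    by (rule borel_measurable_times[OF measurable_Y[OF that] c[OF that]])
  then have "(\<lambda>\<omega>. \<Sum>i=1..n. Y i \<omega> * X i \<omega> $ j) \<in> borel_measurable M"
    by (rule borel_measurable_sum)
  then have "(\<lambda>\<omega>. 1 / n * (\<Sum>i=1..n. Y i \<omega> * X i \<omega> $ j) - cross_moment $ j) \<in> borel_measurable M"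
    by (rule borel_measurable_diff[OF borel_measurable_times[OF borel_measurable_const] borel_measurable_const])
  then show ?thesis by (simp add: empirical_cross_moment_def)
qed

lemma measurable_Sh: "(\<lambda>\<omega>. (Sig *v b - Sh \<omega> *v b) $ j) \<in> borel_measurable M"
proof -
  have "(Sh \<omega> *v b) $ j = (\<Sum>i=1..N. (X i \<omega> \<bullet> axis j 1) * (X i \<omega> \<bullet> b)) / N" for \<omega>
    using empirical_second_moment_form[of "axis j 1" N "\<lambda>i. X i \<omega>" b] by (simp add: inner_axis')
  then show ?thesis by (auto intro!: borel_measurable_diff borel_measurable_divide borel_measurable_sum
        borel_measurable_times borel_measurable_inner measurable_X)
qed

lemma measurable_risk: "(\<lambda>b. risk b) \<in> borel_measurable borel"
  unfolding risk_quadratic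
  by (intro borel_measurable_continuous_onI continuous_intros linear_continuous_on) simp

text \<open>The union of the exceptional sets of the matrix bound and of the two coordinatewise deviation bounds,
the latter at level \<open>t = 4 L / 3\<close>. It depends on \<open>b\<close>, which is harmless since the risk bound is
proved for each \<open>b\<close> separately before the infimum is taken.\<close>

lemma bad_event:
  assumes size: "18 * R * log_level 3 CARD('p) N \<le> N" and BY: "0 < B_Y"
    and lam: "8 * (B_X * B_Y) * sqrt (log_level 6 CARD('p) N / n) \<le> lam"
    and b: "b \<bullet> (Sig *v b) \<le> B_Y\<^sup>2"
  obtains F where "F \<in> S.events"
    "S.prob F \<le> exp (- log_level 3 CARD('p) N / 10) / (3 * (real N)\<^sup>2)
        + 2 * exp (- log_level 6 CARD('p) N / 3) / (3 * (real N)\<^sup>2)"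
    "\<And>\<omega> u. \<omega> \<in> space M - F \<Longrightarrow> 2 / 3 * (u \<bullet> (Sig *v u)) \<le> u \<bullet> (Sh \<omega> *v u)"
    "\<And>\<omega> j. \<omega> \<in> space M - F \<Longrightarrow> \<bar>(gh \<omega> - cross_moment + (Sig *v b - Sh \<omega> *v b)) $ j\<bar> \<le> lam / 2"
proof -
  obtain G where G: "G \<in> S.events"
    "S.prob G \<le> real CARD('p) * exp (- (41/50 - 2/3) * (2 / (5 * R)) * N)"
    "\<And>\<omega> u. \<omega> \<in> space M - G \<Longrightarrow> 2 / 3 * (u \<bullet> (Sig *v u)) \<le> u \<bullet> (Sh \<omega> *v u)"
    using gram_event by blast
  define t where "t = 4 * log_level 6 CARD('p) N / 3"
  have t: "0 < t" using log_level_pos by (simp add: t_def)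
  have tR: "t * R \<le> N"
  proof -
    have "t \<le> 18 * log_level 3 CARD('p) N" using log_facts by (simp add: t_def)
    then have "t * R \<le> 18 * log_level 3 CARD('p) N * R" using R_pos by (intro mult_right_mono) auto
    also have "\<dots> = 18 * R * log_level 3 CARD('p) N" by simp
    also note size
    finally show ?thesis .
  qed
  define D where "D = (\<lambda>j. {\<omega> \<in> space M. B_X * B_Y * sqrt (2 * t / n) \<le> \<bar>(gh \<omega> - cross_moment) $ j\<bar>})"
  define E where "E = (\<lambda>j. {\<omega> \<in> space M. 2 * (B_X * B_Y) * sqrt (t / N) \<le> \<bar>(Sig *v b - Sh \<omega> *v b) $ j\<bar>})"
  have mD: "D j \<in> S.events" and mE: "E j \<in> S.events" for j
    using borel_measurable_le[OF borel_measurable_const borel_measurable_abs[OF measurable_gh]]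
      borel_measurable_le[OF borel_measurable_const borel_measurable_abs[OF measurable_Sh]]
    unfolding D_def E_def by blast+
  have mDE: "D j \<union> E j \<in> S.events" for j by (rule sets.Un[OF mD mE])
  have mU: "(\<Union>j\<in>UNIV. D j \<union> E j) \<in> S.events" by (rule sets.finite_UN) (use mDE in auto)
  have pDE: "S.prob (D j \<union> E j) \<le> 2 * exp (- t) + 2 * exp (- t)" for j
    using measure_Un_le[OF mD[of j] mE[of j]] cross_moment_deviation[OF BY less_imp_le[OF t], of j]
      design_deviation[OF BY t tR b, of j] unfolding D_def E_def by linarith
  define F where "F = G \<union> (\<Union>j\<in>UNIV. D j \<union> E j)"
  have mF: "F \<in> S.events" unfolding F_def by (rule sets.Un[OF G(1) mU])
  have "S.prob (\<Union>j\<in>UNIV. D j \<union> E j) \<le> (\<Sum>j\<in>UNIV. S.prob (D j \<union> E j))"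
    by (rule S.finite_measure_subadditive_finite) (use mDE in auto)
  also have "\<dots> \<le> (\<Sum>j\<in>(UNIV :: 'p set). 2 * exp (- t) + 2 * exp (- t))"
    by (intro sum_mono pDE)
  also have "\<dots> = real CARD('p) * (4 * (exp (- log_level 6 CARD('p) N) * exp (- log_level 6 CARD('p) N / 3)))"
    by (simp add: t_def flip: exp_add)
  also have "\<dots> = 2 * exp (- log_level 6 CARD('p) N / 3) / (3 * (real N)\<^sup>2)"
    unfolding log_facts(4) using card_ge_1 by (simp add: field_simps)
  finally have "S.prob (\<Union>j\<in>UNIV. D j \<union> E j) \<le> 2 * exp (- log_level 6 CARD('p) N / 3) / (3 * (real N)\<^sup>2)" .
  moreover have "S.prob G \<le> exp (- log_level 3 CARD('p) N / 10) / (3 * (real N)\<^sup>2)"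
    using G(2) gram_tail_numeric[OF card_ge_1 N_ge_2 R_pos size] by linarith
  moreover have "S.prob F \<le> S.prob G + S.prob (\<Union>j\<in>UNIV. D j \<union> E j)"
    unfolding F_def by (rule measure_Un_le[OF G(1) mU])
  ultimately have pF: "S.prob F \<le> exp (- log_level 3 CARD('p) N / 10) / (3 * (real N)\<^sup>2)
        + 2 * exp (- log_level 6 CARD('p) N / 3) / (3 * (real N)\<^sup>2)"
    by linarith
  show ?thesis
  proof (rule that[OF mF pF])
    fix \<omega> assume \<omega>: "\<omega> \<in> space M - F"
    then show "2 / 3 * (u \<bullet> (Sig *v u)) \<le> u \<bullet> (Sh \<omega> *v u)" for u
      using G(3) by (auto simp: F_def)
    fix j
    have d: "\<bar>(gh \<omega> - cross_moment) $ j\<bar> < B_X * B_Y * sqrt (8 * log_level 6 CARD('p) N / (3 * real n))"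
      and e: "\<bar>(Sig *v b - Sh \<omega> *v b) $ j\<bar> < 2 * (B_X * B_Y) * sqrt (4 * log_level 6 CARD('p) N / (3 * real N))"
      using \<omega> by (auto simp: F_def D_def E_def t_def not_le)
    have "\<bar>(gh \<omega> - cross_moment + (Sig *v b - Sh \<omega> *v b)) $ j\<bar>
        \<le> \<bar>(gh \<omega> - cross_moment) $ j\<bar> + \<bar>(Sig *v b - Sh \<omega> *v b) $ j\<bar>"
      unfolding vector_add_component by (rule abs_triangle_ineq)
    also have "\<dots> \<le> B_X * B_Y * sqrt (8 * log_level 6 CARD('p) N / (3 * real n))
        + 2 * (B_X * B_Y) * sqrt (4 * log_level 6 CARD('p) N / (3 * real N))"
      using d e by linarith
    also have "\<dots> \<le> lam / 2"
      by (rule noise_level_numeric) (use sizes log_level_pos B_X_ge_1 B_Y_nonneg lam in auto)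
    finally show "\<bar>(gh \<omega> - cross_moment + (Sig *v b - Sh \<omega> *v b)) $ j\<bar> \<le> lam / 2" .
  qed
qed

text \<open>Dividing the hypothesis by \<open>lam\<close> bounds the \<open>l1\<close> norm, which enters the risk squared; as \<open>lam^2\<close> is at
least of order \<open>L / n\<close>, a factor \<open>n L\<close> remains in the denominator.\<close>

lemma crude_risk_bound:
  assumes BY: "0 < B_Y" and lam: "8 * (B_X * B_Y) * sqrt (log_level 6 CARD('p) N / n) \<le> lam"
    and l1: "lam * l1_norm v \<le> real N * B_Y\<^sup>2 / (4 * real n)"
  shows "risk v \<le> 2 * B_Y\<^sup>2 + B_Y\<^sup>2 * (real N)\<^sup>2 / (2 ^ 9 * real n * log_level 6 CARD('p) N)"
proof -
  have n0: "0 < real n" and L0: "0 < log_level 6 CARD('p) N" using sizes log_level_pos by auto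
  define r where "r = sqrt (log_level 6 CARD('p) N / n)"
  have r: "0 < r" "r\<^sup>2 = log_level 6 CARD('p) N / n" using n0 L0 by (simp_all add: r_def)
  have "(8 * (B_X * B_Y) * r) * l1_norm v \<le> lam * l1_norm v"
    using lam l1_norm_nonneg by (intro mult_right_mono) (auto simp: r_def)
  then have "(8 * B_Y * r) * (B_X * l1_norm v) \<le> (8 * B_Y * r) * (N * B_Y / (32 * n * r))"
    using l1 r n0 BY by (simp add: power2_eq_square mult_ac)
  then have "B_X * l1_norm v \<le> N * B_Y / (32 * n * r)"
    by (rule mult_left_le_imp_le) (use BY r in simp)
  then have "(B_X * l1_norm v)\<^sup>2 \<le> (N * B_Y / (32 * n * r))\<^sup>2"
    using B_X_ge_1 l1_norm_nonneg[of v] by (intro power_mono) auto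
  also have "\<dots> = B_Y\<^sup>2 * (real N)\<^sup>2 / (2 ^ 10 * real n * log_level 6 CARD('p) N)"
    using n0 L0 by (simp add: power_divide power_mult_distrib r(2)) (simp add: power2_eq_square mult_ac)
  finally have "2 * (B_X * l1_norm v)\<^sup>2 \<le> B_Y\<^sup>2 * (real N)\<^sup>2 / (2 ^ 9 * real n * log_level 6 CARD('p) N)" by simp
  then show ?thesis using risk_le_l1[of v] by linarith
qed

text \<open>The competitor \<open>b\<close> is first replaced by its shrinkage \<open>c\<close>, and the exceptional event is taken for
\<open>c\<close>.\<close>

theorem expected_oracle_inequality:
  fixes bhat :: "'w \<Rightarrow> real ^ 'p"
  assumes size: "18 * R * log_level 3 CARD('p) N \<le> N"
    and lam: "8 * (B_X * B_Y) * sqrt (log_level 6 CARD('p) N / n) \<le> lam" and BY: "0 < B_Y"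
    and est: "ss_lasso_estimator M n N X Y lam bhat"
  shows "integrable M (\<lambda>\<omega>. risk (bhat \<omega>))"
    "S.expectation (\<lambda>\<omega>. risk (bhat \<omega>))
      \<le> risk b + 4 * lam * l1_norm (restrict_vec (- J) b) + 27 * K / 4 * lam\<^sup>2 * real (card J)
        + (2 * B_Y\<^sup>2 / (real N)\<^sup>2 + B_Y\<^sup>2 / (2 ^ 7 * real n * (log_level 6 CARD('p) N)\<^sup>2))"
proof -
  have L0: "0 < log_level 6 CARD('p) N" by (rule log_level_pos)
  have lam0: "0 \<le> lam"
  proof -
    have "0 \<le> 8 * (B_X * B_Y) * sqrt (log_level 6 CARD('p) N / n)" using B_X_ge_1 BY L0 by simp
    then show ?thesis using lam by linarith
  qed
  have meas: "bhat \<in> borel_measurable M" using est by (simp add: ss_lasso_estimator_def)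
  have min: "ss_lasso_objective n N (\<lambda>i. X i \<omega>) (\<lambda>i. Y i \<omega>) lam (bhat \<omega>)
      \<le> ss_lasso_objective n N (\<lambda>i. X i \<omega>) (\<lambda>i. Y i \<omega>) lam c" if "\<omega> \<in> space M" for \<omega> c
    using est that by (auto simp: ss_lasso_estimator_def is_arg_min_def not_less)
  have foc: "(bhat \<omega> - c) \<bullet> (Sh \<omega> *v bhat \<omega>) - gh \<omega> \<bullet> (bhat \<omega> - c) \<le> lam * (l1_norm c - l1_norm (bhat \<omega>))"
    if "\<omega> \<in> space M" for \<omega> c
    by (rule lasso_first_order[OF transpose_empirical_second_moment lam0])
      (use min[OF that] in \<open>simp add: ss_lasso_objective_eq\<close>)
  define pen where "pen = 4 * lam * l1_norm (restrict_vec (- J) b)"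
  have pen0: "0 \<le> pen" using lam0 l1_norm_nonneg[of "restrict_vec (- J) b"] by (simp add: pen_def)
  obtain t where t: "0 \<le> t" "t \<le> 1" "t\<^sup>2 * (b \<bullet> (Sig *v b)) \<le> B_Y\<^sup>2"
    "t\<^sup>2 * (b \<bullet> (Sig *v b)) - 2 * (t * (b \<bullet> cross_moment)) + t * pen
       \<le> b \<bullet> (Sig *v b) - 2 * (b \<bullet> cross_moment) + pen"
    using shrink_to_bounded_form[OF second_moment_nonneg cross_moment_le B_Y_nonneg pen0] by blast
  define c where "c = t *\<^sub>R b"
  have cq: "c \<bullet> (Sig *v c) \<le> B_Y\<^sup>2"
    using t(3) by (simp add: c_def matrix_vector_mult_scaleR power2_eq_square mult.assoc)
  have cpen: "4 * lam * l1_norm (restrict_vec (- J) c) = t * pen"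
    using t(1) by (simp add: c_def pen_def l1_norm_restrict_scaleR)
  have crisk: "risk c + t * pen \<le> risk b + pen"
    using t(4) unfolding risk_quadratic
    by (simp add: c_def matrix_vector_mult_scaleR power2_eq_square mult.assoc)
  define U where "U = risk b + pen + 27 * K / 4 * lam\<^sup>2 * real (card J)"
  define C where "C = 2 * B_Y\<^sup>2 + B_Y\<^sup>2 * (real N)\<^sup>2 / (2 ^ 9 * real n * log_level 6 CARD('p) N)"
  have U0: "0 \<le> U" unfolding U_def using risk_nonneg pen0 K_nonneg by simp
  have C0: "0 \<le> C" unfolding C_def using L0 by simp
  obtain F where F: "F \<in> S.events"
    "S.prob F \<le> exp (- log_level 3 CARD('p) N / 10) / (3 * (real N)\<^sup>2)
        + 2 * exp (- log_level 6 CARD('p) N / 3) / (3 * (real N)\<^sup>2)"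
    "\<And>\<omega> u. \<omega> \<in> space M - F \<Longrightarrow> 2 / 3 * (u \<bullet> (Sig *v u)) \<le> u \<bullet> (Sh \<omega> *v u)"
    "\<And>\<omega> j. \<omega> \<in> space M - F \<Longrightarrow> \<bar>(gh \<omega> - cross_moment + (Sig *v c - Sh \<omega> *v c)) $ j\<bar> \<le> lam / 2"
    using bad_event[OF size BY lam cq] by blast
  have good: "risk (bhat \<omega>) \<le> U" if \<omega>: "\<omega> \<in> space M - F" for \<omega>
  proof -
    have "\<omega> \<in> space M" using \<omega> by simp
    from restricted_oracle_inequality[OF transpose_second_moment foc[OF this] F(3)[OF \<omega>] F(4)[OF \<omega>]
        norm_le_K_form K_nonneg lam0 second_moment_nonneg, of J]
    have "risk (bhat \<omega>) \<le> risk c + t * pen + 27 * K / 4 * lam\<^sup>2 * real (card J)"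
      unfolding risk_quadratic cpen by linarith
    then show ?thesis using crisk by (simp add: U_def)
  qed
  have bound: "AE \<omega> in M. risk (bhat \<omega>) \<le> U + C * indicator F \<omega>"
    using AE_Y_bounds AE_space
  proof eventually_elim
    case (elim \<omega>)
    have "lam * l1_norm (bhat \<omega>) \<le> real N * B_Y\<^sup>2 / (4 * real n)"
      by (rule lasso_crude_bound[OF sizes])
        (use elim foc[of \<omega> 0] in \<open>auto simp: l1_norm_def\<close>)
    then have "risk (bhat \<omega>) \<le> C" unfolding C_def by (rule crude_risk_bound[OF BY lam])
    then show ?case using good[of \<omega>] elim U0 by (cases "\<omega> \<in> F") auto
  qed
  have intF: "integrable M (\<lambda>\<omega>. C * indicator F \<omega>)"
    using F(1)
    by (intro integrable_mult_right integrable_real_indicator) (auto simp: S.emeasure_eq_measure)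
  have intB: "integrable M (\<lambda>\<omega>. U + C * indicator F \<omega>)"
    by (intro Bochner_Integration.integrable_add intF) simp
  have mr: "(\<lambda>\<omega>. risk (bhat \<omega>)) \<in> borel_measurable M"
    by (rule measurable_compose[OF meas measurable_risk])
  show int: "integrable M (\<lambda>\<omega>. risk (bhat \<omega>))"
    by (rule Bochner_Integration.integrable_bound[OF intB mr])
      (use bound in eventually_elim, use risk_nonneg in \<open>auto intro: order_trans\<close>)
  have "S.expectation (\<lambda>\<omega>. risk (bhat \<omega>)) \<le> S.expectation (\<lambda>\<omega>. U + C * indicator F \<omega>)"
    by (rule integral_mono_AE[OF int intB bound])
  also have "\<dots> = U + S.prob F * C" 
    using F(1) by (subst Bochner_Integration.integral_add[OF _ intF]) (simp_all add: S.prob_space Int_absorb2 sets.sets_into_space mult.commute)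
  also have "S.prob F * C \<le> 2 * B_Y\<^sup>2 / (real N)\<^sup>2 + B_Y\<^sup>2 / (2 ^ 7 * real n * (log_level 6 CARD('p) N)\<^sup>2)"
    unfolding C_def
    by (rule bad_event_numeric[OF card_ge_1 N_ge_2 _ _ F(2)]) (use sizes in auto)
  finally show "S.expectation (\<lambda>\<omega>. risk (bhat \<omega>))
      \<le> risk b + 4 * lam * l1_norm (restrict_vec (- J) b) + 27 * K / 4 * lam\<^sup>2 * real (card J)
        + (2 * B_Y\<^sup>2 / (real N)\<^sup>2 + B_Y\<^sup>2 / (2 ^ 7 * real n * (log_level 6 CARD('p) N)\<^sup>2))"
    by (simp add: U_def pen_def)
qed

end

theorem theorem8:
  fixes M :: "'w measure"
    and P :: "((real ^ 'p) \<times> real) measure"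
    and X :: "nat \<Rightarrow> 'w \<Rightarrow> real ^ 'p"
    and Y :: "nat \<Rightarrow> 'w \<Rightarrow> real"
    and fstar :: "real ^ 'p \<Rightarrow> real"
    and bhat :: "'w \<Rightarrow> real ^ 'p"
    and n N :: nat
    and B_X B_Y lam :: real
  assumes "prob_space M"
    and "prob_space P" and "sets P = sets borel"
    and "1 \<le> n" and "n < N"
    and "semi_supervised_sample M P n N X Y"
    and "regression_function P fstar"
    and "centered_normalized P"
    and "almost_surely_bounded P B_Y B_X"
    and "invertible (second_moment_matrix P)"
    and "real N \<ge> 18 * B_X\<^sup>2 * real CARD('p)
           * spectral_norm (matrix_inv (second_moment_matrix P))
           * ln (3 * real CARD('p) * (real N)\<^sup>2)"
    and "lam = 8 * B_X * B_Y * sqrt (ln (6 * real CARD('p) * (real N)\<^sup>2) / real n)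
           * (1 + B_X / 3 * sqrt (ln (6 * real CARD('p) * (real N)\<^sup>2) / real n))"
    and "lam > 0"
    and "ss_lasso_estimator M n N X Y lam bhat"
  shows "integrable M (\<lambda>\<omega>. excess_risk P fstar (linear_predictor (bhat \<omega>))) \<and>
    (\<integral>\<omega>. excess_risk P fstar (linear_predictor (bhat \<omega>)) \<partial>M)
      \<le> (INF J :: 'p set. INF b :: real ^ 'p.
            excess_risk P fstar (linear_predictor b)
            + 4 * lam * l1_norm (restrict_vec (- J) b)
            + 27 * spectral_norm (matrix_inv (second_moment_matrix P)) / 4 * lam\<^sup>2 * real (card J))
        + 2 * B_Y\<^sup>2 / (real N)\<^sup>2
        + B_Y\<^sup>2 / (2 ^ 7 * real n * (ln (6 * real CARD('p) * (real N)\<^sup>2))\<^sup>2)"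
proof -
  interpret semi_supervised_setting P fstar B_Y B_X M X Y n N
    by (intro semi_supervised_setting.intro bounded_population.intro bounded_population_axioms.intro
        semi_supervised_setting_axioms.intro; fact assms)
  define r where "r = sqrt (log_level 6 CARD('p) N / n)"
  have r0: "0 \<le> r" using log_level_pos by (simp add: r_def)
  have lam_eq: "lam = (8 * (B_X * B_Y) * r) * (1 + B_X / 3 * r)"
    using assms(12) by (simp add: r_def)
  have BY: "0 < B_Y"
  proof (rule ccontr)
    assume "\<not> 0 < B_Y"
    then have "B_Y = 0" using B_Y_nonneg by simp
    then show False using lam_eq assms(13) by simp
  qed
  have "(8 * (B_X * B_Y) * r) * 1 \<le> lam"
    unfolding lam_eq using B_X_ge_1 BY r0 by (intro mult_left_mono) auto
  then have lam: "8 * (B_X * B_Y) * sqrt (log_level 6 CARD('p) N / n) \<le> lam" by (simp add: r_def)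
  have size: "18 * R * log_level 3 CARD('p) N \<le> N" using assms(11) by (simp add: mult_ac)
  note bound = expected_oracle_inequality[OF size lam BY assms(14)]
  let ?rest = "2 * B_Y\<^sup>2 / (real N)\<^sup>2 + B_Y\<^sup>2 / (2 ^ 7 * real n * (log_level 6 CARD('p) N)\<^sup>2)"
  have "S.expectation (\<lambda>\<omega>. risk (bhat \<omega>)) - ?rest
     \<le> (INF J :: 'p set. INF b :: real ^ 'p. risk b + 4 * lam * l1_norm (restrict_vec (- J) b)
            + 27 * K / 4 * lam\<^sup>2 * real (card J))"
    by (intro cINF_greatest) (use bound(2) in \<open>auto simp: diff_le_eq\<close>)
  then show ?thesis using bound(1) by linarith
qed

end
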